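(* The operator $A$ generates a $C_0$-semigroup $\{T(t)\}_{t\ge0}$ of contractions on $L^2(\mathbb{R}^d;\mathbb{C}^m)$.
   Context: Let $d,m\ge1$. Standing assumptions: (a) $Q=(q_{ij}):\mathbb{R}^d\to\mathbb{R}^{d\times d}$ is such that $q_{ij}=q_{ji}$ is bounded and continuously differentiable with bounded derivatives, and there are $\eta_1,\eta_2>0$ with $\eta_1|\xi|^2\le\langle Q(x)\xi,\xi\rangle\le\eta_2|\xi|^2$ for all $x,\xi\in\mathbb{R}^d$; (b) $V=(v_{ij}):\mathbb{R}^d\to\mathbb{R}^{m\times m}$ has entries $v_{ij}\in L^\infty_{\mathrm{loc}}(\mathbb{R}^d)$ and $\mathrm{Re}\langle V(x)\xi,\xi\rangle\ge0$ for all $x\in\mathbb{R}^d$, $\xi\in\mathbb{C}^m$. $\mathcal{A}u=\Delta_Q u-Vu$, where $\Delta_Q u=\mathrm{div}(Q\nabla u)$ acts componentwise on $u=(u_1,\dots,u_m)$ in the sense of distributions. $A$ is the operator on $L^2(\mathbb{R}^d;\mathbb{C}^m)$ given by $Au=\mathcal{A}u$ with $D(A)=\{u\in H^1(\mathbb{R}^d;\mathbb{C}^m):\mathcal{A}u\in L^2(\mathbb{R}^d;\mathbb{C}^m)\}$. *)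

theory Defs
  imports "HOL-Analysis.Analysis"
begin

class complex_normed_vector = real_normed_vector +
  fixes scaleC :: "complex \<Rightarrow> 'a \<Rightarrow> 'a"  (infixr "*\<^sub>C" 75)
  assumes scaleC_add_right: "c *\<^sub>C (x + y) = c *\<^sub>C x + c *\<^sub>C y"
    and scaleC_add_left: "(b + c) *\<^sub>C x = b *\<^sub>C x + c *\<^sub>C x"
    and scaleC_scaleC: "b *\<^sub>C (c *\<^sub>C x) = (b * c) *\<^sub>C x"
    and scaleC_of_real: "complex_of_real r *\<^sub>C x = r *\<^sub>R x"
    and norm_scaleC: "norm (c *\<^sub>C x) = cmod c * norm x"

definition bounded_clinear :: "('a::complex_normed_vector \<Rightarrow> 'b::complex_normed_vector) \<Rightarrow> bool"
  where "bounded_clinear f \<longleftrightarrow> bounded_linear f \<and> (\<forall>c x. f (c *\<^sub>C x) = c *\<^sub>C f x)"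

text \<open>A semigroup is a function on all of \<^typ>\<open>real\<close>; its values at negative times are irrelevant.\<close>

definition C0_semigroup :: "(real \<Rightarrow> 'a::complex_normed_vector \<Rightarrow> 'a) \<Rightarrow> bool"
  where "C0_semigroup T \<longleftrightarrow>
    (\<forall>t\<ge>0. bounded_clinear (T t)) \<and>
    T 0 = id \<and>
    (\<forall>s\<ge>0. \<forall>t\<ge>0. T (s + t) = T s \<circ> T t) \<and>
    (\<forall>x. ((\<lambda>t. T t x) \<longlongrightarrow> x) (at_right 0))"

definition contraction_semigroup :: "(real \<Rightarrow> 'a::complex_normed_vector \<Rightarrow> 'a) \<Rightarrow> bool"
  where "contraction_semigroup T \<longleftrightarrow> C0_semigroup T \<and> (\<forall>t\<ge>0. \<forall>x. norm (T t x) \<le> norm x)"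

text \<open>Unbounded operators are represented by their graphs, so that equality of operators
  includes equality of their domains.\<close>

definition generator :: "(real \<Rightarrow> 'a::complex_normed_vector \<Rightarrow> 'a) \<Rightarrow> ('a \<times> 'a) set"
  where "generator T = {(x, y). ((\<lambda>h. (T h x - x) /\<^sub>R h) \<longlongrightarrow> y) (at_right 0)}"

definition generates :: "('a \<times> 'a) set \<Rightarrow> (real \<Rightarrow> 'a::complex_normed_vector \<Rightarrow> 'a) \<Rightarrow> bool"
  where "generates A T \<longleftrightarrow> generator T = A"

definition square_integrable :: "((real^'d) \<Rightarrow> (complex^'m)) \<Rightarrow> bool"
  where "square_integrable f \<longleftrightarrow>
    f \<in> borel_measurable lebesgue \<and> integrable lebesgue (\<lambda>x. (norm (f x))\<^sup>2)"

lemma square_integrable_0: "square_integrable (\<lambda>x. 0)"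
  by (simp add: square_integrable_def)

lemma square_integrable_add:
  assumes "square_integrable f" "square_integrable g"
  shows "square_integrable (\<lambda>x. f x + g x)"
proof -
  have m: "f \<in> borel_measurable lebesgue" "g \<in> borel_measurable lebesgue"
    using assms by (auto simp: square_integrable_def)
  have "integrable lebesgue (\<lambda>x. 2 * (norm (f x))\<^sup>2 + 2 * (norm (g x))\<^sup>2)"
    using assms by (auto simp: square_integrable_def)
  moreover have "(norm (f x + g x))\<^sup>2 \<le> 2 * (norm (f x))\<^sup>2 + 2 * (norm (g x))\<^sup>2" for x
  proof -
    have "(norm (f x + g x))\<^sup>2 \<le> (norm (f x) + norm (g x))\<^sup>2"
      by (intro power_mono norm_triangle_ineq norm_ge_zero)
    also have "\<dots> \<le> 2 * (norm (f x))\<^sup>2 + 2 * (norm (g x))\<^sup>2"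
      using sum_squares_bound[of "norm (f x)" "norm (g x)"] by (simp add: power2_sum)
    finally show ?thesis .
  qed
  ultimately have "integrable lebesgue (\<lambda>x. (norm (f x + g x))\<^sup>2)"
    using m by (intro Bochner_Integration.integrable_bound[where
        f = "\<lambda>x. 2 * (norm (f x))\<^sup>2 + 2 * (norm (g x))\<^sup>2" and g = "\<lambda>x. (norm (f x + g x))\<^sup>2"]) auto
  then show ?thesis using m by (auto simp: square_integrable_def)
qed

lemma square_integrable_scaleR:
  assumes "square_integrable f"
  shows "square_integrable (\<lambda>x. r *\<^sub>R f x)"
  using assms by (auto simp: square_integrable_def power_mult_distrib)

lemma square_integrable_diff:
  assumes "square_integrable f" "square_integrable g"
  shows "square_integrable (\<lambda>x. f x - g x)"
  using square_integrable_add[OF assms(1) square_integrable_scaleR[OF assms(2), of "-1"]] by simp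

lemma norm_vector_scalar_mult: "norm (c *s v) = cmod c * norm v" for v :: "complex^'m"
  by (simp add: norm_vec_def norm_mult L2_set_right_distrib)

lemma measurable_vector_scalar_mult:
  fixes f :: "(real^'d) \<Rightarrow> (complex^'m)"
  assumes "f \<in> borel_measurable lebesgue"
  shows "(\<lambda>x. c *s f x) \<in> borel_measurable lebesgue"
proof -
  have "continuous_on UNIV (\<lambda>v::complex^'m. c *s v)"
    unfolding vector_scalar_mult_def by (intro continuous_intros)
  from borel_measurable_continuous_on[OF this assms] show ?thesis .
qed

lemma square_integrable_scaleC:
  assumes "square_integrable f"
  shows "square_integrable (\<lambda>x. c *s f x)"
  using assms
  by (auto simp: square_integrable_def measurable_vector_scalar_mult norm_vector_scalar_mult
      power_mult_distrib)

lemma integrable_inner_square_integrable: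
  assumes "square_integrable f" "square_integrable g"
  shows "integrable lebesgue (\<lambda>x. f x \<bullet> g x)"
proof (rule Bochner_Integration.integrable_bound)
  show "integrable lebesgue (\<lambda>x. (norm (f x))\<^sup>2 + (norm (g x))\<^sup>2)"
    using assms by (auto simp: square_integrable_def)
  show "(\<lambda>x. f x \<bullet> g x) \<in> borel_measurable lebesgue"
    using assms by (auto simp: square_integrable_def)
  have "\<bar>f x \<bullet> g x\<bar> \<le> (norm (f x))\<^sup>2 + (norm (g x))\<^sup>2" for x
  proof -
    have "\<bar>f x \<bullet> g x\<bar> \<le> norm (f x) * norm (g x)" by (rule Cauchy_Schwarz_ineq2)
    also have "\<dots> \<le> 2 * norm (f x) * norm (g x)" by simp
    also have "\<dots> \<le> (norm (f x))\<^sup>2 + (norm (g x))\<^sup>2" by (rule sum_squares_bound)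
    finally show ?thesis .
  qed
  then show "AE x in lebesgue. norm (f x \<bullet> g x) \<le> norm ((norm (f x))\<^sup>2 + (norm (g x))\<^sup>2)"
    by auto
qed

definition L2_rel :: "((real^'d) \<Rightarrow> (complex^'m)) \<Rightarrow> ((real^'d) \<Rightarrow> (complex^'m)) \<Rightarrow> bool"
  where "L2_rel f g \<longleftrightarrow>
    square_integrable f \<and> square_integrable g \<and> (AE x in lebesgue. f x = g x)"

lemma part_equivp_L2_rel: "part_equivp (L2_rel :: ((real^'d) \<Rightarrow> (complex^'m)) \<Rightarrow> _)"
proof (rule part_equivpI)
  show "\<exists>f :: (real^'d) \<Rightarrow> (complex^'m). L2_rel f f"
    using square_integrable_0 by (auto simp: L2_rel_def)
  show "symp (L2_rel :: ((real^'d) \<Rightarrow> (complex^'m)) \<Rightarrow> _)"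
    by (rule sympI) (auto simp: L2_rel_def elim: eventually_mono)
  show "transp (L2_rel :: ((real^'d) \<Rightarrow> (complex^'m)) \<Rightarrow> _)"
  proof (rule transpI)
    fix f g h :: "(real^'d) \<Rightarrow> (complex^'m)"
    assume *: "L2_rel f g" "L2_rel g h"
    then have "AE x in lebesgue. f x = g x" "AE x in lebesgue. g x = h x"
      by (auto simp: L2_rel_def)
    then have "AE x in lebesgue. f x = h x" by eventually_elim simp
    with * show "L2_rel f h" by (simp add: L2_rel_def)
  qed
qed

quotient_type ('d, 'm) L2 = "(real^'d::finite) \<Rightarrow> (complex^'m::finite)" / partial: L2_rel
  by (rule part_equivp_L2_rel)

lemma square_integrable_rep_L2: "square_integrable (rep_L2 u)"
  using Quotient_rep_reflp[OF Quotient_L2, of u] by (simp add: L2_rel_def)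

instantiation L2 :: (finite, finite) real_vector
begin

lift_definition zero_L2 :: "('a, 'b) L2" is "\<lambda>x. 0"
  by (simp add: L2_rel_def square_integrable_0)

lift_definition plus_L2 :: "('a, 'b) L2 \<Rightarrow> ('a, 'b) L2 \<Rightarrow> ('a, 'b) L2" is "\<lambda>f g x. f x + g x"
  unfolding L2_rel_def by (auto intro: square_integrable_add)

lift_definition scaleR_L2 :: "real \<Rightarrow> ('a, 'b) L2 \<Rightarrow> ('a, 'b) L2" is "\<lambda>r f x. r *\<^sub>R f x"
  unfolding L2_rel_def by (auto intro: square_integrable_scaleR)

lift_definition uminus_L2 :: "('a, 'b) L2 \<Rightarrow> ('a, 'b) L2" is "\<lambda>f x. - f x"
  unfolding L2_rel_def by (auto simp: square_integrable_def)

lift_definition minus_L2 :: "('a, 'b) L2 \<Rightarrow> ('a, 'b) L2 \<Rightarrow> ('a, 'b) L2" is "\<lambda>f g x. f x - g x"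
  unfolding L2_rel_def by (auto intro: square_integrable_diff)

instance
proof
  fix u v w :: "('a, 'b) L2" and r s :: real
  show "u + v + w = u + (v + w)"
    by transfer (auto simp: L2_rel_def add.assoc intro!: square_integrable_add)
  show "u + v = v + u"
    by transfer (auto simp: L2_rel_def add.commute intro!: square_integrable_add)
  show "0 + u = u"
    by transfer (auto simp: L2_rel_def)
  show "- u + u = 0"
    by transfer (auto simp: L2_rel_def square_integrable_0)
  show "u - v = u + - v"
    by transfer (auto simp: L2_rel_def intro!: square_integrable_diff)
  show "r *\<^sub>R (u + v) = r *\<^sub>R u + r *\<^sub>R v"
    by transfer (auto simp: L2_rel_def scaleR_add_right
        intro!: square_integrable_add square_integrable_scaleR)
  show "(r + s) *\<^sub>R u = r *\<^sub>R u + s *\<^sub>R u"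
    by transfer (auto simp: L2_rel_def scaleR_add_left
        intro!: square_integrable_add square_integrable_scaleR)
  show "r *\<^sub>R s *\<^sub>R u = (r * s) *\<^sub>R u"
    by transfer (auto simp: L2_rel_def intro!: square_integrable_scaleR)
  show "1 *\<^sub>R u = u"
    by transfer (auto simp: L2_rel_def)
qed

end

instantiation L2 :: (finite, finite) real_inner
begin

text \<open>On \<^typ>\<open>complex^'b\<close> the inner product \<^term>\<open>v \<bullet> w\<close> is the real part of the Hermitian one.\<close>

lift_definition inner_L2 :: "('a, 'b) L2 \<Rightarrow> ('a, 'b) L2 \<Rightarrow> real"
  is "\<lambda>f g. LINT x|lebesgue. f x \<bullet> g x"
proof -
  fix f f' g g' :: "(real^'a) \<Rightarrow> (complex^'b)"
  assume *: "L2_rel f f'" "L2_rel g g'"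
  then have "AE x in lebesgue. f x = f' x" "AE x in lebesgue. g x = g' x"
    by (auto simp: L2_rel_def)
  then have "AE x in lebesgue. f x \<bullet> g x = f' x \<bullet> g' x" by eventually_elim simp
  with * show "(LINT x|lebesgue. f x \<bullet> g x) = (LINT x|lebesgue. f' x \<bullet> g' x)"
    by (intro integral_cong_AE) (auto simp: L2_rel_def square_integrable_def)
qed

definition norm_L2 :: "('a, 'b) L2 \<Rightarrow> real"
  where "norm_L2 u = sqrt (u \<bullet> u)"

definition sgn_L2 :: "('a, 'b) L2 \<Rightarrow> ('a, 'b) L2"
  where "sgn_L2 u = u /\<^sub>R norm u"

definition dist_L2 :: "('a, 'b) L2 \<Rightarrow> ('a, 'b) L2 \<Rightarrow> real"
  where "dist_L2 u v = norm (u - v)"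

definition uniformity_L2 :: "(('a, 'b) L2 \<times> ('a, 'b) L2) filter"
  where "uniformity_L2 = (INF e\<in>{0<..}. principal {(x, y). dist x y < e})"

definition open_L2 :: "('a, 'b) L2 set \<Rightarrow> bool"
  where "open_L2 U \<longleftrightarrow> (\<forall>x\<in>U. \<forall>\<^sub>F (x', y) in uniformity. x' = x \<longrightarrow> y \<in> U)"

instance
proof
  fix u v w :: "('a, 'b) L2" and r s :: real and U :: "('a, 'b) L2 set"
  show "u \<bullet> v = v \<bullet> u"
    by transfer (simp add: inner_commute)
  show "(u + v) \<bullet> w = u \<bullet> w + v \<bullet> w"
    by transfer (simp add: L2_rel_def inner_add_left integrable_inner_square_integrable)
  show "(r *\<^sub>R u) \<bullet> v = r * (u \<bullet> v)"
    by transfer simp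
  show "0 \<le> u \<bullet> u"
    by transfer (simp add: integral_nonneg_AE)
  show "(u \<bullet> u = 0) = (u = 0)"
  proof transfer
    fix f :: "(real^'a) \<Rightarrow> (complex^'b)"
    assume "L2_rel f f"
    then have f: "square_integrable f" by (simp add: L2_rel_def)
    have "(LINT x|lebesgue. f x \<bullet> f x) = 0 \<longleftrightarrow> (AE x in lebesgue. f x \<bullet> f x = 0)"
      by (intro integral_nonneg_eq_0_iff_AE integrable_inner_square_integrable f) auto
    then show "((LINT x|lebesgue. f x \<bullet> f x) = 0) = L2_rel f (\<lambda>x. 0)"
      using f by (simp add: L2_rel_def square_integrable_0)
  qed
  show "norm u = sqrt (u \<bullet> u)" by (fact norm_L2_def)
  show "sgn u = u /\<^sub>R norm u" by (fact sgn_L2_def)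
  show "dist u v = norm (u - v)" by (fact dist_L2_def)
  show "(uniformity :: (('a, 'b) L2 \<times> ('a, 'b) L2) filter) =
      (INF e\<in>{0<..}. principal {(x, y). dist x y < e})" by (fact uniformity_L2_def)
  show "open U = (\<forall>x\<in>U. \<forall>\<^sub>F (x', y) in uniformity. x' = x \<longrightarrow> y \<in> U)" by (fact open_L2_def)
qed

end

instantiation L2 :: (finite, finite) complex_normed_vector
begin

lift_definition scaleC_L2 :: "complex \<Rightarrow> ('a, 'b) L2 \<Rightarrow> ('a, 'b) L2" is "\<lambda>c f x. c *s f x"
  unfolding L2_rel_def by (auto intro: square_integrable_scaleC)

instance
proof
  fix u v :: "('a, 'b) L2" and b c :: complex and r :: real
  show "c *\<^sub>C (u + v) = c *\<^sub>C u + c *\<^sub>C v"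
    by transfer (auto simp: L2_rel_def vector_add_ldistrib
        intro!: square_integrable_add square_integrable_scaleC)
  show "(b + c) *\<^sub>C u = b *\<^sub>C u + c *\<^sub>C u"
    by transfer (auto simp: L2_rel_def vector_sadd_rdistrib
        intro!: square_integrable_add square_integrable_scaleC)
  show "b *\<^sub>C (c *\<^sub>C u) = (b * c) *\<^sub>C u"
    by transfer (auto simp: L2_rel_def vector_smult_assoc intro!: square_integrable_scaleC)
  have *: "complex_of_real r *s x = r *\<^sub>R x" for r and x :: "complex^'b"
    by (simp add: vec_eq_iff scaleR_conv_of_real[where 'a = complex])
  show "complex_of_real r *\<^sub>C u = r *\<^sub>R u"
    by transfer (auto simp: L2_rel_def * intro!: square_integrable_scaleR)
  have "(c *\<^sub>C u) \<bullet> (c *\<^sub>C u) = (cmod c)\<^sup>2 * (u \<bullet> u)"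
    by transfer (simp add: dot_square_norm norm_vector_scalar_mult power_mult_distrib)
  then show "norm (c *\<^sub>C u) = cmod c * norm u"
    by (simp add: norm_L2_def real_sqrt_mult)
qed

end

definition partial_deriv :: "'d \<Rightarrow> ((real^'d) \<Rightarrow> 'b::real_normed_vector) \<Rightarrow> (real^'d) \<Rightarrow> 'b"
  where "partial_deriv k f x = frechet_derivative f (at x) (axis k 1)"

primrec C_k :: "nat \<Rightarrow> ((real^'d) \<Rightarrow> 'b::real_normed_vector) \<Rightarrow> bool"
  where
    "C_k 0 f \<longleftrightarrow> continuous_on UNIV f"
  | "C_k (Suc n) f \<longleftrightarrow> (\<forall>x. f differentiable (at x)) \<and> (\<forall>k. C_k n (partial_deriv k f))"

definition test_functions :: "((real^'d) \<Rightarrow> complex) set"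
  where "test_functions = {\<phi>. (\<forall>n. C_k n \<phi>) \<and> compact (closure {x. \<phi> x \<noteq> 0})}"

text \<open>A distribution is represented by a functional on all functions, of which only
  the values on test functions matter.\<close>

type_synonym 'd distribution = "((real^'d) \<Rightarrow> complex) \<Rightarrow> complex"

definition distr_eq :: "'d::finite distribution \<Rightarrow> 'd distribution \<Rightarrow> bool"
  where "distr_eq S T \<longleftrightarrow> (\<forall>\<phi>\<in>test_functions. S \<phi> = T \<phi>)"

definition regular_distr :: "((real^'d) \<Rightarrow> complex) \<Rightarrow> 'd::finite distribution"
  where "regular_distr f \<phi> = (LINT x|lebesgue. f x * \<phi> x)"

definition distr_deriv :: "'d::finite \<Rightarrow> 'd distribution \<Rightarrow> 'd distribution"
  where "distr_deriv k T \<phi> = - T (partial_deriv k \<phi>)"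

definition component :: "('d::finite, 'm::finite) L2 \<Rightarrow> 'm \<Rightarrow> (real^'d) \<Rightarrow> complex"
  where "component u i x = rep_L2 u x $ i"

definition has_weak_deriv :: "'d \<Rightarrow> ('d::finite, 'm::finite) L2 \<Rightarrow> ('d, 'm) L2 \<Rightarrow> bool"
  where "has_weak_deriv k u g \<longleftrightarrow>
    (\<forall>i. distr_eq (distr_deriv k (regular_distr (component u i))) (regular_distr (component g i)))"

definition weak_deriv :: "'d \<Rightarrow> ('d::finite, 'm::finite) L2 \<Rightarrow> ('d, 'm) L2"
  where "weak_deriv k u = (SOME g. has_weak_deriv k u g)"

definition H1 :: "('d::finite, 'm::finite) L2 set"
  where "H1 = {u. \<forall>k. \<exists>g. has_weak_deriv k u g}"

definition diffusion_matrix :: "((real^'d) \<Rightarrow> real^'d^'d) \<Rightarrow> bool"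
  where "diffusion_matrix Q \<longleftrightarrow>
    (\<forall>x i j. Q x $ i $ j = Q x $ j $ i) \<and>
    (\<forall>i j. bounded (range (\<lambda>x. Q x $ i $ j))) \<and>
    (\<forall>i j. C_k 1 (\<lambda>x. Q x $ i $ j)) \<and>
    (\<forall>i j k. bounded (range (partial_deriv k (\<lambda>x. Q x $ i $ j)))) \<and>
    (\<exists>\<eta>\<^sub>1>0. \<exists>\<eta>\<^sub>2>0. \<forall>x \<xi>.
      \<eta>\<^sub>1 * (norm \<xi>)\<^sup>2 \<le> (Q x *v \<xi>) \<bullet> \<xi> \<and> (Q x *v \<xi>) \<bullet> \<xi> \<le> \<eta>\<^sub>2 * (norm \<xi>)\<^sup>2)"

definition Linf_loc :: "((real^'d) \<Rightarrow> real) \<Rightarrow> bool"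
  where "Linf_loc f \<longleftrightarrow>
    f \<in> borel_measurable lebesgue \<and>
    (\<forall>K. compact K \<longrightarrow> (\<exists>C. AE x in lebesgue. x \<in> K \<longrightarrow> \<bar>f x\<bar> \<le> C))"

definition complex_matrix :: "real^'m^'m \<Rightarrow> complex^'m^'m"
  where "complex_matrix M = (\<chi> i j. complex_of_real (M $ i $ j))"

definition hermitian_inner :: "complex^'m \<Rightarrow> complex^'m \<Rightarrow> complex"
  where "hermitian_inner \<xi> \<zeta> = (\<Sum>i\<in>UNIV. \<xi> $ i * cnj (\<zeta> $ i))"

definition accretive_potential :: "((real^'d) \<Rightarrow> real^'m^'m) \<Rightarrow> bool"
  where "accretive_potential V \<longleftrightarrow>
    (\<forall>i j. Linf_loc (\<lambda>x. V x $ i $ j)) \<and>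
    (\<forall>x \<xi>. 0 \<le> Re (hermitian_inner (complex_matrix (V x) *v \<xi>) \<xi>))"

text \<open>The distribution $\mathrm{div}(Q\nabla u_i)$, for \<^term>\<open>u \<in> H1\<close>.\<close>

definition Delta_Q :: "((real^'d) \<Rightarrow> real^'d^'d) \<Rightarrow> ('d::finite, 'm::finite) L2 \<Rightarrow> 'm \<Rightarrow> 'd distribution"
  where "Delta_Q Q u i \<phi> =
    (\<Sum>j\<in>UNIV. distr_deriv j
      (regular_distr (\<lambda>x. \<Sum>k\<in>UNIV. complex_of_real (Q x $ j $ k) * component (weak_deriv k u) i x)) \<phi>)"

definition calA :: "((real^'d) \<Rightarrow> real^'d^'d) \<Rightarrow> ((real^'d) \<Rightarrow> real^'m^'m) \<Rightarrow>
    ('d::finite, 'm::finite) L2 \<Rightarrow> 'm \<Rightarrow> 'd distribution"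
  where "calA Q V u i \<phi> =
    Delta_Q Q u i \<phi> - regular_distr (\<lambda>x. (complex_matrix (V x) *v rep_L2 u x) $ i) \<phi>"

text \<open>The graph of $A$: the condition that $\mathcal{A}u$ lies in $L^2$, which cuts out $D(A)$
  inside $H^1$, is expressed by the existence of \<^term>\<open>f\<close>, and then $Au = f$.\<close>

definition operator_A :: "((real^'d) \<Rightarrow> real^'d^'d) \<Rightarrow> ((real^'d) \<Rightarrow> real^'m^'m) \<Rightarrow>
    (('d::finite, 'm::finite) L2 \<times> ('d, 'm) L2) set"
  where "operator_A Q V =
    {(u, f). u \<in> H1 \<and> (\<forall>i. distr_eq (calA Q V u i) (regular_distr (component f i)))}"

end

theory Submission
  imports Defs
begin

text \<open>
A Hilbert space operator $A$ generates a contraction semigroup as soon as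
$\mathrm{Re}\langle Au,u\rangle\le0$ on $D(A)$ and $I-hA$ is onto for every $h>0$; density of $D(A)$
is then automatic, because $v\perp D(A)$ and $v=u-Au$ give $|u|^2\le\langle v,u\rangle=0$. The
semigroup is the limit of the backward Euler schemes $(I-2^{-p}A)^{-\lfloor 2^pt\rfloor}$, which
converge geometrically on $D(A^2)$ (locale \<open>m_dissipative\<close>).

Both conditions on $A$ are read off from its weak form (\<open>operator_A_iff\<close>): $(u,f)$ belongs to the
graph iff $u$ has weak gradient $G\in L^2$ and
$\sum_k\langle G_k,(Q^{T}\nabla\psi)_k\rangle+\langle u,V^{T}\psi\rangle+\langle f,\psi\rangle=0$
for all test functions $\psi$. With the coefficients on the side of $\psi$ every pairing is one of
$L^2$ functions, since $V$ is bounded on the support of $\psi$, and a real inner product suffices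
because test functions may be multiplied by $i$.

Surjectivity of $I-hA$ is a linear variational problem: the form
$\langle u,\psi\rangle+h\langle G,Q^{T}\nabla\psi\rangle+h\langle u,V^{T}\psi\rangle$ is, for fixed $\psi$,
bounded in $u\in H^1$, and it is coercive on the diagonal by ellipticity of $Q$ and accretivity of
$V$. This is the situation of Lions' theorem (\<open>lions_solvability\<close>), which makes $H^1$ the space of
solutions while only test functions are used for testing.

Dissipativity is the delicate part, since $u\in D(A)$ itself is no test function and $Vu$ need not
be in $L^2$. The weak form is first extended to $\theta u$ with a smooth cutoff $\theta$
(\<open>weak_form_extends_to_cutoff\<close>): mollifications of $\theta u$ are test functions with supports in one
ball, where $V$ is bounded, and they converge to $\theta u$ in $H^1$. The terms with $Q$ and $V$ that
carry $\theta$ have a sign, and with $\theta(x)=\beta(x/n)$ the one with $\nabla\theta$ is $O(1/n)$.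
Convergence of mollifications rests on density of test functions in $L^2$, which holds because
products of one-dimensional bumps approximate indicators of boxes.
\<close>

section \<open>Orthogonality in complete inner product spaces\<close>

text \<open>The parallelogram law at midpoints, which stay in the subspace, makes a sequence that minimizes the
distance to $x$ a Cauchy sequence.\<close>

lemma orthogonal_projection_exists:
  fixes S :: "'a::{real_inner, complete_space} set"
  assumes S: "subspace S" and "closed S"
  obtains p where "p \<in> S" "\<And>s. s \<in> S \<Longrightarrow> (x - p) \<bullet> s = 0"
proof -
  define I where "I = (\<lambda>s. (norm (x - s))\<^sup>2) ` S"
  define d where "d = Inf I"
  have bdd: "bdd_below I" unfolding I_def by (rule bdd_belowI[of _ 0]) auto
  have I: "I \<noteq> {}" using subspace_0[OF S] by (auto simp: I_def)
  have d_le: "d \<le> (norm (x - s))\<^sup>2" if "s \<in> S" for s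
    unfolding d_def using bdd that by (intro cInf_lower) (auto simp: I_def)
  have "\<exists>s\<in>S. (norm (x - s))\<^sup>2 < d + 1 / real (Suc n)" for n
    using cInf_lessD[OF I, of "d + 1 / real (Suc n)"] unfolding d_def[symmetric]
    by (auto simp: I_def)
  then obtain s where s: "\<And>n. s n \<in> S" "\<And>n. (norm (x - s n))\<^sup>2 < d + 1 / real (Suc n)"
    by metis
  have close: "(dist (s m) (s n))\<^sup>2 \<le> 2 / real (Suc m) + 2 / real (Suc n)" for m n
  proof -
    have "(1/2) *\<^sub>R (s m + s n) \<in> S"
      using S s by (intro subspace_scale subspace_add)
    from d_le[OF this] have "4 * d \<le> (norm (2 *\<^sub>R (x - (1/2) *\<^sub>R (s m + s n))))\<^sup>2"
      unfolding norm_scaleR by (simp add: power_mult_distrib)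
    also have "2 *\<^sub>R (x - (1/2) *\<^sub>R (s m + s n)) = (x - s m) + (x - s n)"
      by (simp add: algebra_simps scaleR_2)
    finally have "4 * d \<le> (norm ((x - s m) + (x - s n)))\<^sup>2" .
    moreover have "(norm ((x - s m) + (x - s n)))\<^sup>2 + (norm (s m - s n))\<^sup>2
        = 2 * (norm (x - s m))\<^sup>2 + 2 * (norm (x - s n))\<^sup>2"
      by (simp add: power2_norm_eq_inner inner_diff_left inner_diff_right inner_add_left
          inner_add_right inner_commute)
    ultimately show ?thesis using s(2)[of m] s(2)[of n] by (simp add: dist_norm)
  qed
  have "Cauchy s"
  proof (rule metric_CauchyI)
    fix e :: real assume "e > 0"
    then obtain N :: nat where N: "4 / e\<^sup>2 < real N" using reals_Archimedean2 by blast
    have "dist (s m) (s n) < e" if "m \<ge> N" "n \<ge> N" for m n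
    proof -
      have "real N > 0" using N \<open>e > 0\<close> by (smt (verit) divide_nonneg_nonneg zero_le_power2)
      have "2 / real (Suc k) < e\<^sup>2 / 2" if "k \<ge> N" for k
      proof -
        have "2 / real (Suc k) < 2 / real N"
          using that \<open>real N > 0\<close> by (intro divide_strict_left_mono) auto
        also have "\<dots> \<le> e\<^sup>2 / 2"
          using N \<open>e > 0\<close> \<open>real N > 0\<close> by (simp add: field_simps)
        finally show ?thesis .
      qed
      from this[OF that(1)] this[OF that(2)] have "(dist (s m) (s n))\<^sup>2 < e\<^sup>2"
        using close[of m n] by linarith
      then show ?thesis using \<open>e > 0\<close> by (simp add: power2_less_imp_less)
    qed
    then show "\<exists>M. \<forall>m\<ge>M. \<forall>n\<ge>M. dist (s m) (s n) < e" by blast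
  qed
  then obtain p where p: "s \<longlonglongrightarrow> p" using Cauchy_convergent convergent_def by blast
  have "p \<in> S" using closed_sequentially[OF \<open>closed S\<close>] s(1) p by blast
  have "(norm (x - p))\<^sup>2 \<le> d + 0"
  proof (rule LIMSEQ_le)
    show "(\<lambda>n. (norm (x - s n))\<^sup>2) \<longlonglongrightarrow> (norm (x - p))\<^sup>2" by (intro tendsto_intros p)
    show "(\<lambda>n. d + 1 / real (Suc n)) \<longlonglongrightarrow> d + 0"
      by (intro tendsto_intros LIMSEQ_Suc[OF lim_1_over_n])
    show "\<exists>N. \<forall>n\<ge>N. (norm (x - s n))\<^sup>2 \<le> d + 1 / real (Suc n)" using s(2) less_imp_le by blast
  qed
  then have min: "(norm (x - p))\<^sup>2 \<le> (norm (x - q))\<^sup>2" if "q \<in> S" for q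
    using d_le[OF that] by linarith
  have "(x - p) \<bullet> s = 0" if "s \<in> S" for s
  proof (cases "s = 0")
    case False
    \<comment> \<open>The minimizer of the quadratic polynomial $|x-p-ts|^2$ in $t$.\<close>
    define t where "t = ((x - p) \<bullet> s) / (s \<bullet> s)"
    have "p + t *\<^sub>R s \<in> S" using S that \<open>p \<in> S\<close> by (intro subspace_add subspace_scale)
    from min[OF this] have "0 \<le> t * t * (s \<bullet> s) - 2 * t * ((x - p) \<bullet> s)"
      by (simp add: power2_norm_eq_inner inner_diff_left inner_diff_right inner_add_left
          inner_add_right inner_commute algebra_simps)
    also have "\<dots> = - (((x - p) \<bullet> s)\<^sup>2 / (s \<bullet> s))"
      using False by (simp add: t_def power2_eq_square field_simps)
    finally have "((x - p) \<bullet> s)\<^sup>2 / (s \<bullet> s) \<le> 0" by simp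
    moreover have "s \<bullet> s > 0" using False by simp
    ultimately have "((x - p) \<bullet> s)\<^sup>2 \<le> 0" by (simp add: divide_le_0_iff)
    then show ?thesis by simp
  qed simp
  with that \<open>p \<in> S\<close> show thesis by blast
qed

lemma subspace_closure:
  fixes S :: "'a::real_normed_vector set"
  assumes "subspace S"
  shows "subspace (closure S)"
proof (rule subspaceI)
  show "0 \<in> closure S" using subspace_0[OF assms] closure_subset by blast
next
  fix x y assume "x \<in> closure S" "y \<in> closure S"
  then obtain u v where u: "\<And>n. u n \<in> S" "u \<longlonglongrightarrow> x" and v: "\<And>n. v n \<in> S" "v \<longlonglongrightarrow> y"
    by (auto simp: closure_sequential)
  have "(\<lambda>n. u n + v n) \<longlonglongrightarrow> x + y" by (intro tendsto_intros u v)
  moreover have "u n + v n \<in> S" for n using assms u v by (intro subspace_add)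
  ultimately show "x + y \<in> closure S"
    unfolding closure_sequential by (intro exI[of _ "\<lambda>n. u n + v n"]) simp
next
  fix r x assume "x \<in> closure S"
  then obtain u where u: "\<And>n. u n \<in> S" "u \<longlonglongrightarrow> x" by (auto simp: closure_sequential)
  have "(\<lambda>n. r *\<^sub>R u n) \<longlonglongrightarrow> r *\<^sub>R x" by (intro tendsto_intros u)
  moreover have "r *\<^sub>R u n \<in> S" for n using assms u by (intro subspace_scale)
  ultimately show "r *\<^sub>R x \<in> closure S"
    unfolding closure_sequential by (intro exI[of _ "\<lambda>n. r *\<^sub>R u n"]) simp
qed

lemma dense_if_orthogonal_trivial:
  fixes D :: "'a::{real_inner, complete_space} set"
  assumes "subspace D" and triv: "\<And>v. (\<And>d. d \<in> D \<Longrightarrow> v \<bullet> d = 0) \<Longrightarrow> v = 0"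
  shows "closure D = UNIV"
proof -
  have "x \<in> closure D" for x
  proof -
    obtain p where p: "p \<in> closure D" "\<And>s. s \<in> closure D \<Longrightarrow> (x - p) \<bullet> s = 0"
      using orthogonal_projection_exists[OF subspace_closure[OF assms(1)] closed_closure, of x]
      by blast
    have "x - p = 0" using p(2) closure_subset[of D] by (intro triv) auto
    with p(1) show ?thesis by simp
  qed
  then show ?thesis by auto
qed

text \<open>Lions' theorem. Elements of $R$ are pairs $(p,s)$ in which $p$ represents a test function and $s$ the
functional $a(\cdot,p)$; the equation $a(w,p)=F(p)$ becomes $\langle w,s\rangle=\langle F,p\rangle$.
The subspace $M$ consists of constraints satisfied by all $p$, and the solution inherits them; this is
how a solution in the closed subspace $H^1$ of an ambient product space is obtained. By coercivity
$|p|\le|s+m|/c$, so the pairs $(s+m,\langle F,p\rangle)$ stay away from $(0,1)$. The component of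
$(0,1)$ orthogonal to these pairs is $(a,b)$ with $b\ne0$, and $w=-a/b$.\<close>

lemma lions_solvability:
  fixes R :: "('k::{real_inner, complete_space} \<times> 'k) set" and M :: "'k set"
  assumes R: "subspace R" and M: "subspace M" and "c > 0"
    and orth: "\<And>p s m. (p, s) \<in> R \<Longrightarrow> m \<in> M \<Longrightarrow> p \<bullet> m = 0"
    and coercive: "\<And>p s. (p, s) \<in> R \<Longrightarrow> c * (norm p)\<^sup>2 \<le> p \<bullet> s"
  obtains w where "\<And>m. m \<in> M \<Longrightarrow> w \<bullet> m = 0" "\<And>p s. (p, s) \<in> R \<Longrightarrow> w \<bullet> s = F \<bullet> p"
proof -
  define Z0 where "Z0 = {(s + m, F \<bullet> p) | p s m. (p, s) \<in> R \<and> m \<in> M}"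
  have Z0I: "(s + m, F \<bullet> p) \<in> Z0" if "(p, s) \<in> R" "m \<in> M" for p s m
    using that by (auto simp: Z0_def)
  have Z0: "subspace Z0"
  proof (rule subspaceI)
    show "0 \<in> Z0" using Z0I[of 0 0 0] subspace_0[OF R] subspace_0[OF M] by (simp add: zero_prod_def)
  next
    fix x y assume "x \<in> Z0" "y \<in> Z0"
    then obtain p s m q t n where *: "x = (s + m, F \<bullet> p)" "y = (t + n, F \<bullet> q)"
      "(p, s) \<in> R" "m \<in> M" "(q, t) \<in> R" "n \<in> M" by (auto simp: Z0_def)
    have "(p + q, s + t) \<in> R" using subspace_add[OF R *(3,5)] by simp
    from Z0I[OF this subspace_add[OF M *(4,6)]] show "x + y \<in> Z0"
      by (simp add: * inner_add_right algebra_simps)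
  next
    fix r x assume "x \<in> Z0"
    then obtain p s m where *: "x = (s + m, F \<bullet> p)" "(p, s) \<in> R" "m \<in> M" by (auto simp: Z0_def)
    have "(r *\<^sub>R p, r *\<^sub>R s) \<in> R" using subspace_scale[OF R *(2)] by simp
    from Z0I[OF this subspace_scale[OF M *(3)]] show "r *\<^sub>R x \<in> Z0"
      by (simp add: * algebra_simps)
  qed
  have bound: "\<bar>snd z\<bar> \<le> norm F / c * norm (fst z)" if z: "z \<in> Z0" for z
  proof -
    obtain p s m where *: "z = (s + m, F \<bullet> p)" "(p, s) \<in> R" "m \<in> M"
      using z unfolding Z0_def by blast
    have "c * (norm p)\<^sup>2 \<le> p \<bullet> (s + m)"
      using coercive[OF *(2)] orth[OF *(2,3)] by (simp add: inner_add_right)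
    also have "\<dots> \<le> norm p * norm (s + m)" by (rule norm_cauchy_schwarz)
    finally have "norm p * (c * norm p) \<le> norm p * norm (s + m)"
      by (simp add: power2_eq_square mult.left_commute)
    then have "c * norm p \<le> norm (s + m)"
      by (cases "p = 0") (auto simp: mult_le_cancel_left)
    then have "norm p \<le> norm (s + m) / c" using \<open>c > 0\<close> by (simp add: field_simps)
    then have "norm F * norm p \<le> norm F * (norm (s + m) / c)" by (intro mult_left_mono) auto
    then show ?thesis using Cauchy_Schwarz_ineq2[of F p] by (simp add: *)
  qed
  have "closed {z :: 'k \<times> real. \<bar>snd z\<bar> \<le> norm F / c * norm (fst z)}"
    by (intro closed_Collect_le continuous_intros)
  then have "closure Z0 \<subseteq> {z. \<bar>snd z\<bar> \<le> norm F / c * norm (fst z)}"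
    using bound by (intro closure_minimal subsetI CollectI)
  then have bound': "\<bar>snd z\<bar> \<le> norm F / c * norm (fst z)" if "z \<in> closure Z0" for z
    using that by auto
  obtain q where q: "q \<in> closure Z0" "\<And>z. z \<in> closure Z0 \<Longrightarrow> ((0, 1) - q) \<bullet> z = 0"
    using orthogonal_projection_exists[OF subspace_closure[OF Z0] closed_closure, of "(0, 1)"]
    by blast
  obtain a b where ab: "(0, 1) - q = (a, b)" by (cases "(0, 1) - q")
  have "(0, 1) - q \<noteq> (0 :: 'k \<times> real)" using bound'[of "(0, 1)"] q(1) by auto
  moreover have "((0, 1) - q) \<bullet> ((0, 1) - q) = b"
    using q(2)[OF q(1)] by (simp add: inner_diff_right) (simp add: ab inner_Pair_0)
  ultimately have "b \<noteq> 0" by (metis inner_eq_zero_iff)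
  have main: "((- 1 / b) *\<^sub>R a) \<bullet> (s + m) = F \<bullet> p" if "(p, s) \<in> R" "m \<in> M" for p s m
  proof -
    have "(s + m, F \<bullet> p) \<in> closure Z0" using Z0I[OF that] closure_subset by blast
    from q(2)[OF this] have "a \<bullet> (s + m) + b * (F \<bullet> p) = 0" by (simp add: ab)
    then show ?thesis using \<open>b \<noteq> 0\<close> by (simp add: field_simps)
  qed
  show thesis
  proof (rule that)
    show "((- 1 / b) *\<^sub>R a) \<bullet> m = 0" if "m \<in> M" for m
      using main[of 0 0 m] that subspace_0[OF R] by (simp add: zero_prod_def)
    show "((- 1 / b) *\<^sub>R a) \<bullet> s = F \<bullet> p" if "(p, s) \<in> R" for p s
      using main[OF that subspace_0[OF M]] by simp
  qed
qed

section \<open>The Hille--Yosida theorem for contractions\<close>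

text \<open>Unbounded operators are given by their graphs. For $x\in D(A^2)$ the error of one backward Euler step
of size $2h$ against two steps of size $h$ is $h^2|A^2x|$; summing over the $t/h$ steps leaves $O(h)$,
so that the schemes with step sizes $2^{-p}$ form a Cauchy sequence. Contractivity of the steps
carries the limit over from the dense set $D(A^2)$ to the whole space.\<close>

locale m_dissipative =
  fixes A :: "('a::banach \<times> 'a) set"
  assumes subspace_A: "subspace A"
    and dissipative: "\<And>x y h. (x, y) \<in> A \<Longrightarrow> h > 0 \<Longrightarrow> norm x \<le> norm (x - h *\<^sub>R y)"
    and range: "\<And>h z. h > 0 \<Longrightarrow> \<exists>x y. (x, y) \<in> A \<and> x - h *\<^sub>R y = z"
    and dense: "closure (fst ` A) = UNIV"
begin

lemma A_add: "(x, y) \<in> A \<Longrightarrow> (x', y') \<in> A \<Longrightarrow> (x + x', y + y') \<in> A"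
  using subspace_add[OF subspace_A, of "(x, y)" "(x', y')"] by simp

lemma A_diff: "(x, y) \<in> A \<Longrightarrow> (x', y') \<in> A \<Longrightarrow> (x - x', y - y') \<in> A"
  using subspace_diff[OF subspace_A, of "(x, y)" "(x', y')"] by simp

lemma A_scale: "(x, y) \<in> A \<Longrightarrow> (r *\<^sub>R x, r *\<^sub>R y) \<in> A"
  using subspace_scale[OF subspace_A, of "(x, y)" r] by simp

text \<open>The resolvent $(I-hA)^{-1}$, one step of the backward Euler scheme.\<close>

definition J :: "real \<Rightarrow> 'a \<Rightarrow> 'a"
  where "J h z = (THE x. \<exists>y. (x, y) \<in> A \<and> x - h *\<^sub>R y = z)"

lemma J_eqI:
  assumes "(x, y) \<in> A" "h > 0" "x - h *\<^sub>R y = z"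
  shows "J h z = x"
  unfolding J_def
proof (rule the_equality)
  show "\<exists>y. (x, y) \<in> A \<and> x - h *\<^sub>R y = z" using assms by blast
next
  fix x' assume "\<exists>y. (x', y) \<in> A \<and> x' - h *\<^sub>R y = z"
  then obtain y' where y': "(x', y') \<in> A" "x' - h *\<^sub>R y' = z" by blast
  have "x - x' - h *\<^sub>R (y - y') = 0" using assms(3) y'(2) by (simp add: algebra_simps)
  then have "norm (x - x') \<le> 0" using dissipative[OF A_diff[OF assms(1) y'(1)] assms(2)] by simp
  then show "x' = x" by simp
qed

lemma J_in_A:
  assumes "h > 0"
  obtains w where "(J h z, w) \<in> A" "J h z - h *\<^sub>R w = z"
  using range[OF assms, of z] J_eqI[OF _ assms] by metis

lemma linear_J:
  assumes "h > 0"
  shows "linear (J h)"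
proof (rule linearI)
  fix x y
  obtain v w where "(J h x, v) \<in> A" "J h x - h *\<^sub>R v = x" "(J h y, w) \<in> A" "J h y - h *\<^sub>R w = y"
    using J_in_A[OF assms] by metis
  then show "J h (x + y) = J h x + J h y"
    using assms by (intro J_eqI[of _ "v + w"] A_add) (auto simp: algebra_simps)
next
  fix r x
  obtain v where "(J h x, v) \<in> A" and v: "J h x - h *\<^sub>R v = x" using J_in_A[OF assms] .
  then show "J h (r *\<^sub>R x) = r *\<^sub>R J h x"
    using assms arg_cong[OF v, of "\<lambda>u. r *\<^sub>R u"]
    by (intro J_eqI[of _ "r *\<^sub>R v"] A_scale) (auto simp: algebra_simps)
qed

lemma norm_J_le: "h > 0 \<Longrightarrow> norm (J h x) \<le> norm x"
  by (metis J_in_A dissipative)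

lemma J_graph:
  assumes xy: "(x, y) \<in> A" and h: "h > 0"
  shows "J h x = x + h *\<^sub>R J h y"
proof -
  have "J h (x - h *\<^sub>R y) = x" using assms by (intro J_eqI) auto
  then show ?thesis
    using linear_diff[OF linear_J[OF h], of x "h *\<^sub>R y"]
      linear_scale[OF linear_J[OF h], of h y] by (simp add: algebra_simps)
qed

lemma J_commutes:
  assumes xy: "(x, y) \<in> A" and h: "h > 0"
  shows "(J h x, J h y) \<in> A"
proof -
  obtain v where v: "(J h x, v) \<in> A" "J h x - h *\<^sub>R v = x" using J_in_A[OF h] .
  then have "h *\<^sub>R v = h *\<^sub>R J h y" using J_graph[OF xy h] by (auto simp: algebra_simps)
  then have "v = J h y" using h by simp
  with v show ?thesis by simp
qed

lemma norm_J_diff_le: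
  assumes "(x, y) \<in> A" "h > 0"
  shows "norm (J h x - x) \<le> h * norm y"
  using J_graph[OF assms] norm_J_le[OF assms(2), of y] assms(2) by simp

text \<open>For $w=J_h^2x$ one has $x=(I-hA)^2w=(I-2hA)w+h^2A^2w$, hence $J_{2h}x-w=h^2J_{2h}J_h^2A^2x$.\<close>

lemma norm_J_two_steps_le:
  assumes xy: "(x, y) \<in> A" and yz: "(y, z) \<in> A" and h: "h > 0"
  shows "norm (J (2 * h) x - J h (J h x)) \<le> h\<^sup>2 * norm z"
proof -
  have h2: "2 * h > 0" using h by simp
  define w w' w'' where "w = J h (J h x)" and "w' = J h (J h y)" and "w'' = J h (J h z)"
  have w: "(w, w') \<in> A"
    unfolding w_def w'_def using xy h by (intro J_commutes)
  have "w = J h x + h *\<^sub>R w'" "J h y + h *\<^sub>R w'' = w'" "J h x = x + h *\<^sub>R J h y"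
    unfolding w_def w'_def w''_def
    using J_graph[OF J_commutes[OF xy h] h] J_graph[OF J_commutes[OF yz h] h] J_graph[OF xy h]
    by simp_all
  then have "x - h\<^sup>2 *\<^sub>R w'' = w - (2 * h) *\<^sub>R w'"
    by (simp add: algebra_simps power2_eq_square scaleR_2 flip: scaleR_scaleR scaleR_add_right)
  then have "J (2 * h) (x - h\<^sup>2 *\<^sub>R w'') = w" using w h2 by (intro J_eqI) auto
  then have "J (2 * h) x - w = h\<^sup>2 *\<^sub>R J (2 * h) w''"
    using linear_diff[OF linear_J[OF h2], of x "h\<^sup>2 *\<^sub>R w''"]
      linear_scale[OF linear_J[OF h2], of "h\<^sup>2" w'']
    by (auto simp: algebra_simps)
  then have "norm (J (2 * h) x - w) \<le> h\<^sup>2 * norm w''"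
    using norm_J_le[OF h2, of w''] by (simp add: mult_left_mono)
  also have "norm w'' \<le> norm z"
    unfolding w''_def using norm_J_le[OF h] order_trans by blast
  finally show ?thesis by (simp add: w_def mult_left_mono)
qed

lemma linear_J_power: "h > 0 \<Longrightarrow> linear (J h ^^ k)"
  by (induction k) (auto intro: linear_compose linear_J simp: linear_id[unfolded id_def] id_def)

lemma norm_J_power_le: "h > 0 \<Longrightarrow> norm ((J h ^^ k) x) \<le> norm x"
  by (induction k) (auto intro: order_trans norm_J_le)

lemma J_power_commutes: "(x, y) \<in> A \<Longrightarrow> h > 0 \<Longrightarrow> ((J h ^^ k) x, (J h ^^ k) y) \<in> A"
  by (induction k) (auto intro: J_commutes)

lemma norm_J_power_diff_le:
  assumes "(x, y) \<in> A" "h > 0"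
  shows "norm ((J h ^^ k) x - x) \<le> k * h * norm y"
proof (induction k)
  case (Suc k)
  have "norm ((J h ^^ Suc k) x - x) \<le> norm (J h ((J h ^^ k) x) - (J h ^^ k) x) + norm ((J h ^^ k) x - x)"
    using norm_triangle_ineq[of "(J h ^^ Suc k) x - (J h ^^ k) x" "(J h ^^ k) x - x"] by simp
  also have "norm (J h ((J h ^^ k) x) - (J h ^^ k) x) \<le> h * norm ((J h ^^ k) y)"
    using norm_J_diff_le[OF J_power_commutes[OF assms] assms(2)] .
  also have "\<dots> \<le> h * norm y" using assms(2) norm_J_power_le by (simp add: mult_left_mono)
  finally show ?case using Suc by (simp add: algebra_simps)
qed simp

text \<open>A first-order Taylor expansion of the scheme, uniform in the number of steps; in the limit it
identifies the derivative of the semigroup at $0$.\<close>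

lemma norm_J_power_expansion_le:
  assumes xy: "(x, y) \<in> A" and yz: "(y, z) \<in> A" and h: "h > 0"
  shows "norm ((J h ^^ k) x - x - (k * h) *\<^sub>R y) \<le> (k * h)\<^sup>2 * norm z"
proof (induction k)
  case (Suc k)
  have "(J h ^^ Suc k) x = (J h ^^ k) x + h *\<^sub>R (J h ^^ Suc k) y"
    using J_graph[OF J_power_commutes[OF xy h, of k] h] by simp
  then have "(J h ^^ Suc k) x - x - (Suc k * h) *\<^sub>R y
      = ((J h ^^ k) x - x - (k * h) *\<^sub>R y) + h *\<^sub>R ((J h ^^ Suc k) y - y)"
    by (simp add: algebra_simps del: funpow.simps)
  also have "norm \<dots> \<le> (k * h)\<^sup>2 * norm z + h * (Suc k * h * norm z)"
  proof (rule order_trans[OF norm_triangle_ineq], rule add_mono[OF Suc.IH])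
    show "norm (h *\<^sub>R ((J h ^^ Suc k) y - y)) \<le> h * (Suc k * h * norm z)"
      using norm_J_power_diff_le[OF yz h, of "Suc k"] h by (simp add: mult_left_mono del: funpow.simps)
  qed
  also have "\<dots> = ((k * h)\<^sup>2 + h * (Suc k * h)) * norm z" by (simp add: algebra_simps)
  also have "\<dots> \<le> (Suc k * h)\<^sup>2 * norm z"
    using h by (intro mult_right_mono) (simp_all add: algebra_simps power2_eq_square)
  finally show ?case .
qed simp

text \<open>The backward Euler scheme with step size $2^{-p}$, run up to the last grid point before $t$.\<close>

definition approx :: "nat \<Rightarrow> real \<Rightarrow> 'a \<Rightarrow> 'a"
  where "approx p t = J (1 / 2 ^ p) ^^ nat \<lfloor>2 ^ p * t\<rfloor>"

lemma linear_approx: "linear (approx p t)"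
  unfolding approx_def by (intro linear_J_power) simp

lemma norm_approx_le: "norm (approx p t x) \<le> norm x"
  unfolding approx_def by (intro norm_J_power_le) simp

text \<open>Every step of size $2h=2^{-p}$ is replaced by two of size $h$. The finer grid may reach one step
further, which costs another $h|Ax|$.\<close>

lemma norm_approx_step_le:
  assumes xy: "(x, y) \<in> A" and yz: "(y, z) \<in> A" and t: "t \<ge> 0"
  shows "norm (approx (Suc p) t x - approx p t x) \<le> (t * norm z + norm y) * (1 / 2) ^ p"
proof -
  define h :: real where "h = 1 / 2 ^ Suc p"
  define k where "k = nat \<lfloor>2 ^ p * t\<rfloor>"
  have h: "h > 0" by (simp add: h_def)
  have h2: "2 * h > 0" "1 / 2 ^ p = 2 * h" by (simp_all add: h_def)
  have kt: "k * (2 * h) \<le> t"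
    using of_nat_floor[of "2 ^ p * t"] t by (simp add: k_def h_def field_simps)
  have two: "norm ((J (2 * h) ^^ j) x - (J h ^^ (2 * j)) x) \<le> j * (h\<^sup>2 * norm z)" for j
  proof (induction j)
    case (Suc j)
    let ?u = "(J h ^^ (2 * j)) x"
    have "(J (2 * h) ^^ Suc j) x - (J h ^^ (2 * Suc j)) x
        = J (2 * h) ((J (2 * h) ^^ j) x - ?u) + (J (2 * h) ?u - J h (J h ?u))"
      using linear_diff[OF linear_J[OF h2(1)]] by simp
    also have "norm \<dots> \<le> j * (h\<^sup>2 * norm z) + h\<^sup>2 * norm z"
    proof (rule order_trans[OF norm_triangle_ineq], rule add_mono)
      show "norm (J (2 * h) ((J (2 * h) ^^ j) x - ?u)) \<le> j * (h\<^sup>2 * norm z)"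
        using norm_J_le[OF h2(1)] Suc.IH order_trans by blast
      have "norm (J (2 * h) ?u - J h (J h ?u)) \<le> h\<^sup>2 * norm ((J h ^^ (2 * j)) z)"
        using J_power_commutes[OF xy h] J_power_commutes[OF yz h] h by (rule norm_J_two_steps_le)
      also have "\<dots> \<le> h\<^sup>2 * norm z" by (intro mult_left_mono norm_J_power_le h) simp
      finally show "norm (J (2 * h) ?u - J h (J h ?u)) \<le> h\<^sup>2 * norm z" .
    qed
    finally show ?case by (simp add: algebra_simps)
  qed simp
  have "\<lfloor>2 ^ Suc p * t\<rfloor> = 2 * \<lfloor>2 ^ p * t\<rfloor> \<or> \<lfloor>2 ^ Suc p * t\<rfloor> = 2 * \<lfloor>2 ^ p * t\<rfloor> + 1"
    by (simp, linarith)
  moreover have "\<lfloor>2 ^ p * t\<rfloor> \<ge> 0" using t by simp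
  ultimately have cases: "nat \<lfloor>2 ^ Suc p * t\<rfloor> = 2 * k \<or> nat \<lfloor>2 ^ Suc p * t\<rfloor> = Suc (2 * k)"
    unfolding k_def by linarith
  have extra: "norm ((J h ^^ nat \<lfloor>2 ^ Suc p * t\<rfloor>) x - (J h ^^ (2 * k)) x) \<le> h * norm y"
  proof -
    have "norm (J h ((J h ^^ (2 * k)) x) - (J h ^^ (2 * k)) x) \<le> h * norm ((J h ^^ (2 * k)) y)"
      by (intro norm_J_diff_le J_power_commutes xy h)
    also have "\<dots> \<le> h * norm y" by (intro mult_left_mono norm_J_power_le) (use h in auto)
    finally show ?thesis using cases h by auto
  qed
  have "norm (approx (Suc p) t x - approx p t x)
      \<le> norm ((J h ^^ nat \<lfloor>2 ^ Suc p * t\<rfloor>) x - (J h ^^ (2 * k)) x)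
        + norm ((J (2 * h) ^^ k) x - (J h ^^ (2 * k)) x)"
    unfolding approx_def h2(2) k_def[symmetric] unfolding h_def[symmetric]
    by (rule norm_diff_triangle_le[OF order_refl]) (simp add: norm_minus_commute)
  also have "\<dots> \<le> h * norm y + (k * (2 * h)) * (h * norm z) / 2"
    using extra two[of k] by (simp add: power2_eq_square algebra_simps)
  also have "\<dots> \<le> h * norm y + t * (h * norm z) / 2"
    using kt h by (intro add_left_mono divide_right_mono mult_right_mono) auto
  also have "\<dots> = h * (norm y + t * norm z / 2)" by (simp add: algebra_simps)
  also have "\<dots> \<le> (1 / 2) ^ p * (t * norm z + norm y)"
    using t by (intro mult_mono) (auto simp: h_def power_divide divide_simps)
  finally show ?thesis by (simp add: mult.commute)
qed

text \<open>The resolvent maps $D(A)$ into $D(A^2)$, and $J_hx\to x$ as $h\to0$.\<close>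

lemma dense_domain_squared:
  "closure {x. \<exists>y z. (x, y) \<in> A \<and> (y, z) \<in> A} = UNIV" (is "closure ?D = _")
proof -
  have "closure (fst ` A) \<subseteq> closure ?D"
  proof (rule closure_minimal[OF _ closed_closure], safe)
    fix x y assume xy: "(x, y) \<in> A"
    have *: "J (1 / real (Suc n)) x \<in> ?D" for n
    proof -
      have h: "1 / real (Suc n) > 0" by simp
      obtain w where "(J (1 / real (Suc n)) y, w) \<in> A" using J_in_A[OF h] by blast
      then show ?thesis using J_commutes[OF xy h] by blast
    qed
    have "(\<lambda>n. J (1 / real (Suc n)) x) \<longlonglongrightarrow> x"
    proof (rule Lim_transform_bound[OF _ tendsto_mult_left_zero[OF LIMSEQ_Suc[OF lim_1_over_n]],
        THEN Lim_null[THEN iffD2]])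
      show "\<forall>\<^sub>F n in sequentially. norm (J (1 / real (Suc n)) x - x) \<le> norm (1 / real (Suc n) * norm y)"
        using norm_J_diff_le[OF xy, of "1 / real (Suc n)" for n]
        by (intro always_eventually allI) (simp del: of_nat_Suc)
    qed
    then show "fst (x, y) \<in> closure ?D" using *
      unfolding closure_sequential fst_conv by (intro exI[of _ "\<lambda>n. J (1 / real (Suc n)) x"]) simp
  qed
  then show ?thesis using dense by auto
qed

lemma approx_convergent:
  assumes t: "t \<ge> 0"
  shows "convergent (\<lambda>p. approx p t x)"
proof -
  have D2: "Cauchy (\<lambda>p. approx p t x)" if xy: "(x, y) \<in> A" and yz: "(y, z) \<in> A" for x y z
  proof -
    have "summable (\<lambda>p. approx (Suc p) t x - approx p t x)"
      by (rule summable_comparison_test'[where N = 0 and g = "\<lambda>p. (t * norm z + norm y) * (1 / 2) ^ p"])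
        (intro summable_mult summable_geometric, simp, rule norm_approx_step_le[OF xy yz t])
    then have "convergent (\<lambda>n. approx n t x - approx 0 t x)"
      by (simp add: summable_iff_convergent sum_lessThan_telescope[of "\<lambda>p. approx p t x"])
    then have "convergent (\<lambda>n. (approx n t x - approx 0 t x) + approx 0 t x)"
      by (intro convergent_add convergent_const)
    then show ?thesis by (simp add: convergent_Cauchy)
  qed
  have "Cauchy (\<lambda>p. approx p t x)"
  proof (rule metric_CauchyI)
    fix e :: real assume "e > 0"
    then obtain x' y z where x': "(x', y) \<in> A" "(y, z) \<in> A" "dist x' x < e / 3"
      using dense_domain_squared unfolding closure_approachable set_eq_iff
      by (auto dest!: spec[of _ x] spec[of _ "e / 3"])
    obtain M where M: "\<And>m n. m \<ge> M \<Longrightarrow> n \<ge> M \<Longrightarrow> dist (approx m t x') (approx n t x') < e / 3"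
      using metric_CauchyD[OF D2[OF x'(1,2)], of "e / 3"] \<open>e > 0\<close> by auto
    have near: "dist (approx p t x) (approx p t x') < e / 3" for p
      using norm_approx_le[of p t "x - x'"] x'(3)
      by (simp add: dist_norm linear_diff[OF linear_approx] norm_minus_commute)
    have "dist (approx m t x) (approx n t x) < e" if "m \<ge> M" "n \<ge> M" for m n
      using M[OF that] near[of m] near[of n]
        dist_triangle[of "approx m t x" "approx n t x" "approx m t x'"]
        dist_triangle[of "approx m t x'" "approx n t x" "approx n t x'"]
      by (simp add: dist_commute)
    then show "\<exists>M. \<forall>m\<ge>M. \<forall>n\<ge>M. dist (approx m t x) (approx n t x) < e" by blast
  qed
  then show ?thesis by (rule Cauchy_convergent)
qed

definition T :: "real \<Rightarrow> 'a \<Rightarrow> 'a"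
  where "T t x = lim (\<lambda>p. approx p t x)"

lemma approx_tendsto: "t \<ge> 0 \<Longrightarrow> (\<lambda>p. approx p t x) \<longlonglongrightarrow> T t x"
  unfolding T_def using approx_convergent convergent_LIMSEQ_iff by blast

lemma norm_T_le: "t \<ge> 0 \<Longrightarrow> norm (T t x) \<le> norm x"
  by (rule LIMSEQ_le_const2[OF tendsto_norm[OF approx_tendsto]]) (auto intro: norm_approx_le)

lemma linear_T:
  assumes "t \<ge> 0"
  shows "linear (T t)"
proof (rule linearI)
  fix x y r
  have "(\<lambda>p. approx p t x + approx p t y) \<longlonglongrightarrow> T t x + T t y"
    by (intro tendsto_intros approx_tendsto assms)
  then show "T t (x + y) = T t x + T t y"
    using LIMSEQ_unique[OF approx_tendsto[OF assms]] by (simp add: linear_add[OF linear_approx])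
  have "(\<lambda>p. r *\<^sub>R approx p t x) \<longlonglongrightarrow> r *\<^sub>R T t x"
    by (intro tendsto_intros approx_tendsto assms)
  then show "T t (r *\<^sub>R x) = r *\<^sub>R T t x"
    using LIMSEQ_unique[OF approx_tendsto[OF assms]] by (simp add: linear_scale[OF linear_approx])
qed

lemma bounded_linear_T: "t \<ge> 0 \<Longrightarrow> bounded_linear (T t)"
  using linear_T norm_T_le
  by (intro bounded_linear_intro[where K = 1]) (auto simp: linear_add linear_scale)

lemma T_0: "T 0 = id"
proof
  fix x show "T 0 x = id x"
    using LIMSEQ_unique[OF approx_tendsto[of 0 x], of x] by (simp add: approx_def)
qed

text \<open>Applied to multiplication by a complex number, this makes the semigroup of a complex linear operator
complex linear, although its construction only uses the real structure.\<close>

lemma T_commutes: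
  assumes B: "bounded_linear B" and BA: "\<And>x y. (x, y) \<in> A \<Longrightarrow> (B x, B y) \<in> A" and t: "t \<ge> 0"
  shows "T t (B x) = B (T t x)"
proof -
  interpret B: bounded_linear B by fact
  have J: "J h (B x) = B (J h x)" if "h > 0" for h x
  proof -
    obtain w where w: "(J h x, w) \<in> A" "J h x - h *\<^sub>R w = x" using J_in_A[OF \<open>h > 0\<close>] .
    have "B (J h x) - h *\<^sub>R B w = B x" using w(2) by (metis B.diff B.scaleR)
    then show ?thesis using BA[OF w(1)] that by (intro J_eqI)
  qed
  have "(J h ^^ k) (B x) = B ((J h ^^ k) x)" if "h > 0" for h k
    by (induction k) (simp_all add: J that)
  then have "approx p t (B x) = B (approx p t x)" for p by (simp add: approx_def)
  then have "(\<lambda>p. approx p t (B x)) \<longlonglongrightarrow> B (T t x)"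
    using B.tendsto[OF approx_tendsto[OF t]] by simp
  then show ?thesis using LIMSEQ_unique approx_tendsto[OF t] by blast
qed

lemma eq_on_dense_domain:
  assumes "continuous_on UNIV f" "continuous_on UNIV g" "\<And>x y. (x, y) \<in> A \<Longrightarrow> f x = (g x :: 'a)"
  shows "f x = g x"
proof -
  have "closed {x. f x = g x}" using assms(1,2) by (intro closed_Collect_eq)
  moreover have "fst ` A \<subseteq> {x. f x = g x}" using assms(3) by auto
  ultimately have "closure (fst ` A) \<subseteq> {x. f x = g x}" by (intro closure_minimal)
  then show ?thesis using dense by auto
qed

text \<open>Since $\lfloor 2^p(s+t)\rfloor$ exceeds $\lfloor 2^ps\rfloor+\lfloor 2^pt\rfloor$ by at most $1$, the
schemes satisfy the semigroup law up to one step.\<close>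

lemma T_add:
  assumes s: "s \<ge> 0" and t: "t \<ge> 0"
  shows "T (s + t) = T s \<circ> T t"
proof
  fix x
  show "T (s + t) x = (T s \<circ> T t) x"
  proof (rule eq_on_dense_domain[of "T (s + t)" "T s \<circ> T t"])
    show "continuous_on UNIV (T (s + t))" "continuous_on UNIV (T s \<circ> T t)"
      using bounded_linear_T[OF s] bounded_linear_T[OF t] bounded_linear_T[of "s + t"] s t
      by (auto intro!: linear_continuous_on bounded_linear_compose[of "T s" "T t"] simp: comp_def)
  next
    fix x y assume xy: "(x, y) \<in> A"
    have "norm (approx p (s + t) x - approx p s (approx p t x)) \<le> (1 / 2 ^ p) * norm y" for p
    proof -
      define h :: real where "h = 1 / 2 ^ p"
      have h: "h > 0" by (simp add: h_def)
      define k where "k = nat \<lfloor>2 ^ p * s\<rfloor> + nat \<lfloor>2 ^ p * t\<rfloor>"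
      have "\<lfloor>2 ^ p * (s + t)\<rfloor> = \<lfloor>2 ^ p * s\<rfloor> + \<lfloor>2 ^ p * t\<rfloor>
          \<or> \<lfloor>2 ^ p * (s + t)\<rfloor> = \<lfloor>2 ^ p * s\<rfloor> + \<lfloor>2 ^ p * t\<rfloor> + 1"
        unfolding distrib_left by linarith
      moreover have "\<lfloor>2 ^ p * s\<rfloor> \<ge> 0" "\<lfloor>2 ^ p * t\<rfloor> \<ge> 0" using s t by auto
      ultimately have cases: "nat \<lfloor>2 ^ p * (s + t)\<rfloor> = k \<or> nat \<lfloor>2 ^ p * (s + t)\<rfloor> = Suc k"
        unfolding k_def by linarith
      have "norm (J h ((J h ^^ k) x) - (J h ^^ k) x) \<le> h * norm ((J h ^^ k) y)"
        by (intro norm_J_diff_le J_power_commutes xy h)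
      also have "\<dots> \<le> h * norm y" by (intro mult_left_mono norm_J_power_le) (use h in auto)
      finally have "norm ((J h ^^ nat \<lfloor>2 ^ p * (s + t)\<rfloor>) x - (J h ^^ k) x) \<le> h * norm y"
        using cases h by auto
      then show ?thesis unfolding approx_def k_def h_def by (simp add: funpow_add)
    qed
    then have "(\<lambda>p. approx p (s + t) x - approx p s (approx p t x)) \<longlonglongrightarrow> 0"
    proof (rule Lim_null_comparison[OF always_eventually[OF allI]])
      show "(\<lambda>p. (1 / 2 ^ p) * norm y) \<longlonglongrightarrow> 0"
        by (rule tendsto_mult_left_zero[OF LIMSEQ_divide_realpow_zero]) simp
    qed
    moreover have "(\<lambda>p. approx p s (approx p t x)) \<longlonglongrightarrow> T s (T t x)"
    proof -
      have "(\<lambda>p. approx p s (approx p t x - T t x)) \<longlonglongrightarrow> 0"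
        by (rule Lim_null_comparison[OF always_eventually[rule_format, OF norm_approx_le]])
          (use approx_tendsto[OF t, of x] in \<open>simp add: tendsto_norm_zero LIM_zero\<close>)
      then have "(\<lambda>p. approx p s (approx p t x - T t x) + approx p s (T t x)) \<longlonglongrightarrow> 0 + T s (T t x)"
        by (intro tendsto_add approx_tendsto s)
      then show ?thesis by (simp add: linear_diff[OF linear_approx])
    qed
    ultimately have "(\<lambda>p. (approx p (s + t) x - approx p s (approx p t x))
        + approx p s (approx p t x)) \<longlonglongrightarrow> 0 + T s (T t x)" by (rule tendsto_add)
    then show "T (s + t) x = (T s \<circ> T t) x"
      using LIMSEQ_unique[OF approx_tendsto[of "s + t"]] s t by simp
  qed
qed

lemma floor_step_tendsto: "t \<ge> 0 \<Longrightarrow> (\<lambda>p. real (nat \<lfloor>2 ^ p * t\<rfloor>) * (1 / 2 ^ p)) \<longlonglongrightarrow> t"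
proof (rule LIMSEQ_I)
  fix e :: real assume t: "t \<ge> 0" and "e > 0"
  obtain N where N: "(1 / 2) ^ N < e" using \<open>e > 0\<close> real_arch_pow_inv[of e "1 / 2"] by auto
  have "norm (real (nat \<lfloor>2 ^ p * t\<rfloor>) * (1 / 2 ^ p) - t) < e" if "p \<ge> N" for p
  proof -
    have "\<bar>real (nat \<lfloor>2 ^ p * t\<rfloor>) - 2 ^ p * t\<bar> \<le> 1" using t by (simp add: of_nat_nat) linarith
    then have "\<bar>real (nat \<lfloor>2 ^ p * t\<rfloor>) - 2 ^ p * t\<bar> * (1 / 2 ^ p) \<le> 1 * (1 / 2 ^ p)"
      by (intro mult_right_mono) auto
    moreover have "real (nat \<lfloor>2 ^ p * t\<rfloor>) * (1 / 2 ^ p) - t = (real (nat \<lfloor>2 ^ p * t\<rfloor>) - 2 ^ p * t) * (1 / 2 ^ p)"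
      by (simp add: field_simps)
    ultimately have "\<bar>real (nat \<lfloor>2 ^ p * t\<rfloor>) * (1 / 2 ^ p) - t\<bar> \<le> (1 / 2) ^ p"
      by (simp add: abs_mult power_divide)
    also have "(1 / 2 :: real) ^ p \<le> (1 / 2) ^ N" using that by (intro power_decreasing) auto
    finally show ?thesis using N by simp
  qed
  then show "\<exists>N. \<forall>p\<ge>N. norm (real (nat \<lfloor>2 ^ p * t\<rfloor>) * (1 / 2 ^ p) - t) < e" by blast
qed

lemma norm_T_diff_le:
  assumes "(x, y) \<in> A" "t \<ge> 0"
  shows "norm (T t x - x) \<le> t * norm y"
proof (rule LIMSEQ_le)
  show "(\<lambda>p. norm (approx p t x - x)) \<longlonglongrightarrow> norm (T t x - x)"
    by (intro tendsto_intros approx_tendsto assms)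
  show "(\<lambda>p. real (nat \<lfloor>2 ^ p * t\<rfloor>) * (1 / 2 ^ p) * norm y) \<longlonglongrightarrow> t * norm y"
    by (intro tendsto_intros floor_step_tendsto assms)
  show "\<exists>N. \<forall>p\<ge>N. norm (approx p t x - x) \<le> real (nat \<lfloor>2 ^ p * t\<rfloor>) * (1 / 2 ^ p) * norm y"
    unfolding approx_def using norm_J_power_diff_le[OF assms(1), of "1 / 2 ^ p" for p]
    by (intro exI[of _ 0] allI impI) simp
qed

lemma norm_T_expansion_le:
  assumes "(x, y) \<in> A" "(y, z) \<in> A" "t \<ge> 0"
  shows "norm (T t x - x - t *\<^sub>R y) \<le> t\<^sup>2 * norm z"
proof (rule LIMSEQ_le)
  show "(\<lambda>p. norm (approx p t x - x - (real (nat \<lfloor>2 ^ p * t\<rfloor>) * (1 / 2 ^ p)) *\<^sub>R y))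
      \<longlonglongrightarrow> norm (T t x - x - t *\<^sub>R y)"
    by (intro tendsto_intros approx_tendsto floor_step_tendsto assms)
  show "(\<lambda>p. (real (nat \<lfloor>2 ^ p * t\<rfloor>) * (1 / 2 ^ p))\<^sup>2 * norm z) \<longlonglongrightarrow> t\<^sup>2 * norm z"
    by (intro tendsto_intros floor_step_tendsto assms)
  show "\<exists>N. \<forall>p\<ge>N. norm (approx p t x - x - (real (nat \<lfloor>2 ^ p * t\<rfloor>) * (1 / 2 ^ p)) *\<^sub>R y)
      \<le> (real (nat \<lfloor>2 ^ p * t\<rfloor>) * (1 / 2 ^ p))\<^sup>2 * norm z"
    unfolding approx_def using norm_J_power_expansion_le[OF assms(1,2), of "1 / 2 ^ p" for p]
    by (intro exI[of _ 0] allI impI) simp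
qed

lemma T_strongly_continuous: "((\<lambda>t. T t x) \<longlongrightarrow> x) (at_right 0)"
proof (rule tendstoI)
  fix e :: real assume "e > 0"
  then obtain x' y where x': "(x', y) \<in> A" "dist x' x < e / 3"
    using dense unfolding closure_approachable set_eq_iff
    by (auto dest!: spec[of _ x] spec[of _ "e / 3"])
  have "((\<lambda>t. t * norm y) \<longlongrightarrow> 0 * norm y) (at_right 0)" by (intro tendsto_intros)
  then have "\<forall>\<^sub>F t in at_right 0. t * norm y < e / 3"
    using \<open>e > 0\<close> by (intro order_tendstoD(2)) auto
  moreover have "\<forall>\<^sub>F t::real in at_right 0. t > 0" by (rule eventually_at_right_less)
  ultimately show "\<forall>\<^sub>F t in at_right 0. dist (T t x) x < e"
  proof eventually_elim
    case (elim t)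
    have "dist (T t x) (T t x') \<le> dist x x'"
      using norm_T_le[of t "x - x'"] elim(2) by (simp add: dist_norm linear_diff[OF linear_T])
    moreover have "dist (T t x') x' < e / 3"
      using norm_T_diff_le[OF x'(1), of t] elim by (simp add: dist_norm)
    ultimately show ?case
      using dist_triangle[of "T t x" x "T t x'"] dist_triangle[of "T t x'" x x'] x'(2)
      by (simp add: dist_commute)
  qed
qed

text \<open>The expansion of the semigroup is quadratic only on $D(A^2)$. Pairs $(J_hx,J_hy)$ approximate
$(x,y)\in A$ in the graph norm, and passing to them changes the error of the difference quotient by
at most $2|y-J_hy|$.\<close>

lemma A_subset_generator:
  assumes xy: "(x, y) \<in> A"
  shows "((\<lambda>t. (T t x - x) /\<^sub>R t) \<longlongrightarrow> y) (at_right 0)"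
proof (rule tendstoI)
  fix e :: real assume "e > 0"
  have "\<exists>x' y' z. (x', y') \<in> A \<and> (y', z) \<in> A \<and> norm (y' - y) < e / 3"
  proof -
    obtain v w where vw: "(v, w) \<in> A" "norm (v - y) < e / 9"
      using dense \<open>e > 0\<close> unfolding closure_approachable set_eq_iff
      by (auto dest!: spec[of _ y] spec[of _ "e / 9"] simp: dist_norm)
    \<comment> \<open>Chosen such that $|J_hy-y|\le|J_h(y-v)|+h|w|+|v-y|<e/3$.\<close>
    define h where "h = e / (9 * (norm w + 1))"
    have h: "h > 0" and hw: "h * norm w \<le> e / 9"
      using \<open>e > 0\<close> by (auto simp: h_def field_simps add_pos_nonneg add_nonneg_pos)
    obtain z where z: "(J h y, z) \<in> A" using J_in_A[OF h] by blast
    have "J h y - y = J h (y - v) + (J h v - v) + (v - y)"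
      by (simp add: linear_diff[OF linear_J[OF h]])
    then have "norm (J h y - y) \<le> norm (J h (y - v)) + norm (J h v - v) + norm (v - y)"
      using norm_triangle_ineq[of "J h (y - v) + (J h v - v)" "v - y"]
        norm_triangle_ineq[of "J h (y - v)" "J h v - v"] by simp
    moreover have "norm (J h v - v) \<le> e / 9" using norm_J_diff_le[OF vw(1) h] hw by simp
    moreover have "norm (J h (y - v)) < e / 9" using norm_J_le[OF h, of "y - v"] vw(2)
      by (simp add: norm_minus_commute)
    ultimately have "norm (J h y - y) < e / 3" using vw(2) by simp
    then show ?thesis using J_commutes[OF xy h] z by blast
  qed
  then obtain x' y' z where x': "(x', y') \<in> A" "(y', z) \<in> A" "norm (y' - y) < e / 3" by blast
  have "((\<lambda>t. t * norm z) \<longlongrightarrow> 0 * norm z) (at_right 0)" by (intro tendsto_intros)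
  then have "\<forall>\<^sub>F t in at_right 0. t * norm z < e / 3"
    using \<open>e > 0\<close> by (intro order_tendstoD(2)) auto
  moreover have "\<forall>\<^sub>F t::real in at_right 0. t > 0" by (rule eventually_at_right_less)
  ultimately show "\<forall>\<^sub>F t in at_right 0. dist ((T t x - x) /\<^sub>R t) y < e"
  proof eventually_elim
    case (elim t)
    then have t: "t > 0" "t \<ge> 0" by auto
    have *: "norm (T t (x - x') - (x - x')) \<le> t * norm (y - y')"
      by (intro norm_T_diff_le A_diff xy x' t)
    have "t *\<^sub>R ((T t x - x) /\<^sub>R t - y) = (T t (x - x') - (x - x')) + (T t x' - x' - t *\<^sub>R y') + t *\<^sub>R (y' - y)"
      using t by (simp add: linear_diff[OF linear_T] algebra_simps)
    then have "t * norm ((T t x - x) /\<^sub>R t - y) = norm ((T t (x - x') - (x - x')) + (T t x' - x' - t *\<^sub>R y') + t *\<^sub>R (y' - y))"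
      using t by (metis norm_scaleR abs_of_pos)
    also have "\<dots> \<le> t * norm (y - y') + t\<^sup>2 * norm z + t * norm (y' - y)"
      using * norm_T_expansion_le[OF x'(1,2) t(2)] t
      by (intro norm_triangle_mono) auto
    also have "\<dots> = t * (2 * norm (y' - y) + t * norm z)"
      by (simp add: algebra_simps power2_eq_square norm_minus_commute)
    finally have "norm ((T t x - x) /\<^sub>R t - y) \<le> 2 * norm (y' - y) + t * norm z"
      using t by simp
    then show ?case using elim x'(3) by (simp add: dist_norm)
  qed
qed

text \<open>The generator of a contraction semigroup cannot properly extend an operator for which $I-A$ is onto:
otherwise it would contain a pair $(v,v)$ with $v\ne0$, and $T_tv\approx(1+t)v$ contradicts
contractivity.\<close>

lemma generator_subset_A:
  assumes xy: "((\<lambda>t. (T t x - x) /\<^sub>R t) \<longlongrightarrow> y) (at_right 0)"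
  shows "(x, y) \<in> A"
proof -
  obtain u w where uw: "(u, w) \<in> A" "u - 1 *\<^sub>R w = x - y" using range[of 1 "x - y"] by auto
  define v where "v = x - u"
  have v: "v = y - w" using uw(2) by (simp add: v_def algebra_simps)
  have pos: "\<forall>\<^sub>F t::real in at_right 0. t > 0" by (rule eventually_at_right_less)
  have "((\<lambda>t. (T t x - x) /\<^sub>R t - (T t u - u) /\<^sub>R t) \<longlongrightarrow> y - w) (at_right 0)"
    by (intro tendsto_diff xy A_subset_generator uw)
  then have "((\<lambda>t. (T t v - v) /\<^sub>R t) \<longlongrightarrow> v) (at_right 0)"
    unfolding v[symmetric]
    by (rule Lim_transform_eventually)
      (use pos in \<open>eventually_elim, simp add: v_def linear_diff[OF linear_T] algebra_simps\<close>)
  then have "((\<lambda>t. norm ((T t v - v) /\<^sub>R t - v)) \<longlongrightarrow> norm (v - v)) (at_right 0)"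
    by (intro tendsto_intros)
  moreover have "\<forall>\<^sub>F t in at_right 0. norm v \<le> norm ((T t v - v) /\<^sub>R t - v)"
    using pos
  proof eventually_elim
    case (elim t)
    have "t *\<^sub>R ((T t v - v) /\<^sub>R t - v) = T t v - (1 + t) *\<^sub>R v"
      using elim by (simp add: algebra_simps)
    then have "t * norm ((T t v - v) /\<^sub>R t - v) = norm (T t v - (1 + t) *\<^sub>R v)"
      using elim by (metis norm_scaleR abs_of_pos)
    also have "\<dots> \<ge> norm ((1 + t) *\<^sub>R v) - norm (T t v)"
      by (metis norm_minus_commute norm_triangle_ineq2)
    finally have "t * norm ((T t v - v) /\<^sub>R t - v) \<ge> (1 + t) * norm v - norm v"
      using norm_T_le[of t v] elim by simp
    then have "t * norm v \<le> t * norm ((T t v - v) /\<^sub>R t - v)" by (simp add: algebra_simps)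
    then show ?case using elim by simp
  qed
  ultimately have "norm v \<le> 0"
    by (intro tendsto_lowerbound[of _ 0 "at_right 0" "norm v"]) auto
  then show ?thesis using uw(1) v by (simp add: v_def)
qed

lemma generator_T: "{(x, y). ((\<lambda>t. (T t x - x) /\<^sub>R t) \<longlongrightarrow> y) (at_right 0)} = A"
  using A_subset_generator generator_subset_A by auto

end

section \<open>The Hilbert space of square-integrable functions\<close>

lemma abs_rep_L2 [simp]: "abs_L2 (rep_L2 u) = u"
  by (rule Quotient_abs_rep[OF Quotient_L2])

lemma abs_L2_eqI:
  assumes "square_integrable f" "square_integrable g" "AE x in lebesgue. f x = g x"
  shows "abs_L2 f = abs_L2 g"
  using Quotient_rel_abs[OF Quotient_L2, of f g] assms by (simp add: L2_rel_def)

lemma inner_abs_L2: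
  assumes "square_integrable f" "square_integrable g"
  shows "abs_L2 f \<bullet> abs_L2 g = (LINT x|lebesgue. f x \<bullet> g x)"
  using assms by (simp add: inner_L2.abs_eq L2_rel_def)

lemma inner_abs_L2_right:
  assumes "square_integrable g"
  shows "u \<bullet> abs_L2 g = (LINT x|lebesgue. rep_L2 u x \<bullet> g x)"
  using inner_abs_L2[OF square_integrable_rep_L2 assms, of u] by simp

lemma abs_L2_add:
  "square_integrable f \<Longrightarrow> square_integrable g \<Longrightarrow> abs_L2 (\<lambda>x. f x + g x) = abs_L2 f + abs_L2 g"
  by (simp add: plus_L2.abs_eq L2_rel_def)

lemma abs_L2_diff:
  "square_integrable f \<Longrightarrow> square_integrable g \<Longrightarrow> abs_L2 (\<lambda>x. f x - g x) = abs_L2 f - abs_L2 g"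
  by (simp add: minus_L2.abs_eq L2_rel_def)

lemma abs_L2_scaleR: "square_integrable f \<Longrightarrow> abs_L2 (\<lambda>x. r *\<^sub>R f x) = r *\<^sub>R abs_L2 f"
  by (simp add: scaleR_L2.abs_eq L2_rel_def)

lemma norm_abs_L2: "square_integrable f \<Longrightarrow> (norm (abs_L2 f))\<^sup>2 = (LINT x|lebesgue. (norm (f x))\<^sup>2)"
  by (simp add: power2_norm_eq_inner inner_abs_L2)

lemma nn_integral_norm_square:
  assumes "square_integrable f"
  shows "(\<integral>\<^sup>+x. ennreal ((norm (f x))\<^sup>2) \<partial>lebesgue) = ennreal ((norm (abs_L2 f))\<^sup>2)"
  unfolding norm_abs_L2[OF assms] using assms
  by (intro nn_integral_eq_integral) (auto simp: square_integrable_def)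

lemma square_integrable_nn_integral:
  assumes "f \<in> borel_measurable lebesgue"
    and "(\<integral>\<^sup>+x. ennreal ((norm (f x))\<^sup>2) \<partial>lebesgue) < \<infinity>"
  shows "square_integrable f"
  unfolding square_integrable_def
proof (intro conjI integrableI_bounded)
  show "(\<integral>\<^sup>+x. ennreal (norm ((norm (f x))\<^sup>2)) \<partial>lebesgue) < \<infinity>"
    using assms(2) by simp
qed (use assms(1) in auto)

text \<open>Finiteness of the sum forces $|a_n|\le 2^{-n/2}$ eventually. The weights replace an application of the
Cauchy-Schwarz inequality for series.\<close>

lemma summable_norm_if_weighted_squares_finite:
  fixes a :: "nat \<Rightarrow> 'a::real_normed_vector"
  assumes "(\<Sum>n. ennreal (2 ^ n * (norm (a n))\<^sup>2)) \<noteq> \<infinity>"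
  shows "summable (\<lambda>n. norm (a n))"
proof -
  have "summable (\<lambda>n. 2 ^ n * (norm (a n))\<^sup>2)"
    by (rule summable_suminf_not_top) (use assms in auto)
  then have "(\<lambda>n. 2 ^ n * (norm (a n))\<^sup>2) \<longlonglongrightarrow> 0" by (rule summable_LIMSEQ_zero)
  then have "\<forall>\<^sub>F n in sequentially. 2 ^ n * (norm (a n))\<^sup>2 < 1"
    by (rule order_tendstoD) simp
  then have "\<forall>\<^sub>F n in sequentially. norm (norm (a n)) \<le> (1 / sqrt 2) ^ n"
  proof eventually_elim
    case (elim n)
    have "(sqrt 2 ^ n * norm (a n))\<^sup>2 = 2 ^ n * (norm (a n))\<^sup>2"
      by (simp add: power_mult_distrib flip: power_mult power_even_eq) (metis power_mult
          power_mult_distrib real_sqrt_pow2 mult.commute zero_le_numeral)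
    then have "(sqrt 2 ^ n * norm (a n))\<^sup>2 < 1\<^sup>2" using elim by simp
    then have "sqrt 2 ^ n * norm (a n) < 1" by (rule power2_less_imp_less) simp
    then show ?case by (simp add: power_divide field_simps)
  qed
  moreover have "summable (\<lambda>n. (1 / sqrt 2) ^ n)"
    by (rule summable_geometric) simp
  ultimately show ?thesis by (rule summable_comparison_test_ev)
qed

text \<open>The argument of Riesz and Fischer: squared increments are at most $4^{-n}$ in the mean, so they stay
summable after multiplication by $2^n$; hence the increments are absolutely summable at almost every
point, and Fatou's lemma turns the pointwise limit into a limit in norm.\<close>

lemma L2_fast_Cauchy_converges:
  fixes u :: "nat \<Rightarrow> ('d::finite, 'm::finite) L2"
  assumes fast: "\<And>n. norm (u (Suc n) - u n) \<le> (1 / 2) ^ n"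
  shows "convergent u"
proof -
  define f where "f n = rep_L2 (u n)" for n
  have f: "square_integrable (f n)" for n by (simp add: f_def square_integrable_rep_L2)
  have m [measurable]: "f n \<in> borel_measurable lebesgue" for n
    using f by (simp add: square_integrable_def)
  have abs_f: "abs_L2 (\<lambda>x. f m x - f n x) = u m - u n" for m n
    using f by (simp add: abs_L2_diff) (simp add: f_def)
  have "(\<integral>\<^sup>+x. (\<Sum>n. ennreal (2 ^ n * (norm (f (Suc n) x - f n x))\<^sup>2)) \<partial>lebesgue)
      = (\<Sum>n. \<integral>\<^sup>+x. ennreal (2 ^ n * (norm (f (Suc n) x - f n x))\<^sup>2) \<partial>lebesgue)"
    by (intro nn_integral_suminf) measurable
  also have "\<dots> \<le> (\<Sum>n. ennreal ((1 / 2) ^ n))"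
  proof (intro suminf_le summableI)
    fix n
    have "(\<integral>\<^sup>+x. ennreal (2 ^ n * (norm (f (Suc n) x - f n x))\<^sup>2) \<partial>lebesgue)
        = ennreal (2 ^ n) * (\<integral>\<^sup>+x. ennreal ((norm (f (Suc n) x - f n x))\<^sup>2) \<partial>lebesgue)"
      by (simp add: ennreal_mult nn_integral_cmult)
    also have "\<dots> = ennreal (2 ^ n * (norm (u (Suc n) - u n))\<^sup>2)"
      by (simp add: nn_integral_norm_square square_integrable_diff f abs_f ennreal_mult)
    also have "\<dots> \<le> ennreal (2 ^ n * ((1 / 2) ^ n)\<^sup>2)"
      by (intro ennreal_leI mult_left_mono power_mono fast) auto
    also have "2 ^ n * ((1 / 2) ^ n)\<^sup>2 = (1 / 2 :: real) ^ n"
      by (simp add: power2_eq_square power_divide)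
    finally show "(\<integral>\<^sup>+x. ennreal (2 ^ n * (norm (f (Suc n) x - f n x))\<^sup>2) \<partial>lebesgue)
        \<le> ennreal ((1 / 2) ^ n)" .
  qed
  also have "\<dots> = ennreal (\<Sum>n. (1 / 2) ^ n)"
    by (intro suminf_ennreal2 summable_geometric) auto
  also have "\<dots> < \<infinity>" by simp
  finally have "AE x in lebesgue. (\<Sum>n. ennreal (2 ^ n * (norm (f (Suc n) x - f n x))\<^sup>2)) \<noteq> \<infinity>"
    by (intro nn_integral_noteq_infinite) auto
  then have conv: "AE x in lebesgue. convergent (\<lambda>n. f n x)"
  proof eventually_elim
    case (elim x)
    have "summable (\<lambda>n. f (Suc n) x - f n x)"
      using summable_norm_if_weighted_squares_finite[OF elim] by (rule summable_norm_cancel)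
    then have "convergent (\<lambda>n. f n x - f 0 x)"
      by (simp add: summable_iff_convergent sum_lessThan_telescope[of "\<lambda>n. f n x"])
    then have "convergent (\<lambda>n. (f n x - f 0 x) + f 0 x)"
      by (intro convergent_add convergent_const)
    then show ?case by simp
  qed
  define g where "g x = lim (\<lambda>n. f n x)" for x
  have g [measurable]: "g \<in> borel_measurable lebesgue"
    unfolding g_def by measurable
  have lim: "AE x in lebesgue. (\<lambda>n. f n x) \<longlonglongrightarrow> g x"
    using conv by eventually_elim (simp add: g_def convergent_LIMSEQ_iff)
  have tail: "norm (u (n + k) - u n) \<le> 2 * (1 / 2) ^ n" for n k
  proof -
    have "norm (u (n + k) - u n) \<le> 2 * (1 / 2) ^ n - 2 * (1 / 2) ^ (n + k)"
    proof (induction k)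
      case (Suc k)
      have "norm (u (n + Suc k) - u n) \<le> norm (u (Suc (n + k)) - u (n + k)) + norm (u (n + k) - u n)"
        using norm_triangle_ineq[of "u (Suc (n + k)) - u (n + k)" "u (n + k) - u n"] by simp
      then show ?case using fast[of "n + k"] Suc by simp
    qed simp
    then show ?thesis by (smt (verit) zero_le_power divide_nonneg_nonneg)
  qed
  have bound: "(\<integral>\<^sup>+x. ennreal ((norm (g x - f n x))\<^sup>2) \<partial>lebesgue) \<le> ennreal ((2 * (1 / 2) ^ n)\<^sup>2)" for n
  proof -
    have "(\<integral>\<^sup>+x. ennreal ((norm (g x - f n x))\<^sup>2) \<partial>lebesgue)
        = (\<integral>\<^sup>+x. liminf (\<lambda>k. ennreal ((norm (f (n + k) x - f n x))\<^sup>2)) \<partial>lebesgue)"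
    proof (rule nn_integral_cong_AE, use lim in eventually_elim)
      case (elim x)
      have "(\<lambda>k. f (n + k) x) \<longlonglongrightarrow> g x" using LIMSEQ_ignore_initial_segment[OF elim, of n]
        by (simp add: add.commute)
      then have "(\<lambda>k. ennreal ((norm (f (n + k) x - f n x))\<^sup>2)) \<longlonglongrightarrow> ennreal ((norm (g x - f n x))\<^sup>2)"
        by (intro tendsto_intros)
      from lim_imp_Liminf[OF trivial_limit_sequentially this] show ?case by (rule sym)
    qed
    also have "\<dots> \<le> liminf (\<lambda>k. \<integral>\<^sup>+x. ennreal ((norm (f (n + k) x - f n x))\<^sup>2) \<partial>lebesgue)"
      by (intro nn_integral_liminf) measurable
    also have "\<dots> \<le> liminf (\<lambda>k::nat. ennreal ((2 * (1 / 2) ^ n)\<^sup>2))"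
    proof (intro Liminf_mono always_eventually allI)
      fix k
      show "(\<integral>\<^sup>+x. ennreal ((norm (f (n + k) x - f n x))\<^sup>2) \<partial>lebesgue) \<le> ennreal ((2 * (1 / 2) ^ n)\<^sup>2)"
        unfolding nn_integral_norm_square[OF square_integrable_diff[OF f f]] abs_f
        by (intro ennreal_leI power_mono tail) simp
    qed
    also have "\<dots> = ennreal ((2 * (1 / 2) ^ n)\<^sup>2)" by (intro Liminf_const) simp
    finally show ?thesis .
  qed
  have diff: "square_integrable (\<lambda>x. g x - f n x)" for n
    using bound[of n] le_less_trans by (intro square_integrable_nn_integral) (measurable, fastforce)
  then have sg: "square_integrable g"
    using square_integrable_add[OF diff[of 0] f[of 0]] by simp
  have "norm (abs_L2 g - u n) \<le> 2 * (1 / 2) ^ n" for n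
  proof -
    have "abs_L2 (\<lambda>x. g x - f n x) = abs_L2 g - u n"
      using abs_L2_diff[OF sg f[of n]] by (simp add: f_def)
    then have "ennreal ((norm (abs_L2 g - u n))\<^sup>2) \<le> ennreal ((2 * (1 / 2) ^ n)\<^sup>2)"
      using bound[of n] nn_integral_norm_square[OF diff[of n]] by simp
    then have "(norm (abs_L2 g - u n))\<^sup>2 \<le> (2 * (1 / 2) ^ n)\<^sup>2"
      by (subst (asm) ennreal_le_iff) auto
    then show ?thesis by (rule power2_le_imp_le) simp
  qed
  then have "\<forall>\<^sub>F n in sequentially. norm (u n - abs_L2 g) \<le> 2 * (1 / 2) ^ n"
    by (simp add: norm_minus_commute)
  moreover have "(\<lambda>n. 2 * (1 / 2) ^ n :: real) \<longlonglongrightarrow> 0"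
    by (rule tendsto_mult_right_zero[OF LIMSEQ_realpow_zero]) auto
  ultimately have "(\<lambda>n. u n - abs_L2 g) \<longlonglongrightarrow> 0" by (rule Lim_null_comparison)
  then have "u \<longlonglongrightarrow> abs_L2 g" by (rule LIM_zero_cancel)
  then show ?thesis by (rule convergentI)
qed

instance L2 :: (finite, finite) banach
proof
  fix u :: "nat \<Rightarrow> ('a, 'b) L2"
  assume u: "Cauchy u"
  \<comment> \<open>A Cauchy sequence has a subsequence whose increments decay geometrically.\<close>
  have "\<exists>N. \<forall>m\<ge>N. \<forall>n\<ge>N. norm (u m - u n) < (1 / 2) ^ k" for k
    using CauchyD[OF u, of "(1 / 2) ^ k"] by simp
  then obtain N where N: "\<And>k m n. m \<ge> N k \<Longrightarrow> n \<ge> N k \<Longrightarrow> norm (u m - u n) < (1 / 2) ^ k"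
    by metis
  \<comment> \<open>Summation makes the chosen indices strictly increasing.\<close>
  define r where "r k = (\<Sum>j\<le>k. Suc (N j))" for k
  have "strict_mono r" unfolding r_def strict_mono_Suc_iff by simp
  have "r k \<ge> N k" for k
    unfolding r_def using member_le_sum[of k "{..k}" "\<lambda>j. Suc (N j)"] by simp
  moreover have "r (Suc k) \<ge> r k" for k using \<open>strict_mono r\<close> by (simp add: strict_mono_less_eq)
  ultimately have "norm (u (r (Suc k)) - u (r k)) \<le> (1 / 2) ^ k" for k
    using N[of k] by (meson less_imp_le order_trans)
  then have "convergent (u \<circ> r)" by (intro L2_fast_Cauchy_converges) simp
  then obtain l where "(u \<circ> r) \<longlonglongrightarrow> l" by (auto simp: convergent_def)
  then show "convergent u"
    using Cauchy_converges_subseq[OF u \<open>strict_mono r\<close>] by (auto simp: convergent_def)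
qed

section \<open>Smooth functions\<close>

lemmas has_frechet_derivative = frechet_derivative_works[THEN iffD1]

lemma partial_deriv_eqI: "(f has_derivative D) (at x) \<Longrightarrow> partial_deriv k f x = D (axis k 1)"
  unfolding partial_deriv_def by (simp add: frechet_derivative_at[symmetric])

lemma frechet_derivative_eq_sum_partial_deriv:
  fixes f :: "real^'d::finite \<Rightarrow> 'b::real_normed_vector"
  assumes "f differentiable (at x)"
  shows "frechet_derivative f (at x) h = (\<Sum>k\<in>UNIV. h $ k *\<^sub>R partial_deriv k f x)"
proof -
  interpret D: linear "frechet_derivative f (at x)"
    using linear_frechet_derivative[OF assms] .
  have "h = (\<Sum>k\<in>UNIV. h $ k *\<^sub>R axis k 1)"
    using basis_expansion[of h] by (simp add: scalar_mult_eq_scaleR)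
  then have "frechet_derivative f (at x) h = frechet_derivative f (at x) (\<Sum>k\<in>UNIV. h $ k *\<^sub>R axis k 1)"
    by simp
  then show ?thesis by (simp add: D.sum D.scale partial_deriv_def)
qed

lemma has_derivative_sum_partial_deriv:
  fixes f :: "real^'d::finite \<Rightarrow> 'b::real_normed_vector"
  assumes "f differentiable (at x)"
  shows "(f has_derivative (\<lambda>h. \<Sum>k\<in>UNIV. h $ k *\<^sub>R partial_deriv k f x)) (at x)"
  using has_frechet_derivative[OF assms]
  by (simp add: frechet_derivative_eq_sum_partial_deriv[OF assms, abs_def])

lemma C_k_imp_continuous: "C_k n f \<Longrightarrow> continuous_on UNIV f"
  by (cases n) (auto intro: differentiable_imp_continuous_on
      simp: differentiable_on_def differentiable_at_withinI)

lemma C_k_SucD: "C_k (Suc n) f \<Longrightarrow> C_k n f"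
proof (induction n arbitrary: f)
  case 0
  then show ?case using C_k_imp_continuous by fastforce
next
  case (Suc n)
  then show ?case using C_k.simps(2) by blast
qed

lemma C_k_const: "C_k n (\<lambda>x :: real^'d::finite. c)"
proof (induction n arbitrary: c)
  case (Suc n)
  have "partial_deriv k (\<lambda>x :: real^'d. c) = (\<lambda>x. 0)" for k
    using partial_deriv_eqI[OF has_derivative_const] by fastforce
  then show ?case using Suc by simp
qed simp

lemma partial_deriv_add:
  assumes "f differentiable (at x)" "g differentiable (at x)"
  shows "partial_deriv k (\<lambda>x. f x + g x) x = partial_deriv k f x + partial_deriv k g x"
  using partial_deriv_eqI[OF has_derivative_add[OF assms[THEN has_frechet_derivative]]]
  by (simp add: partial_deriv_def)

lemma C_k_add: "C_k n f \<Longrightarrow> C_k n g \<Longrightarrow> C_k n (\<lambda>x. f x + g x)"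
proof (induction n arbitrary: f g)
  case (Suc n)
  then have "partial_deriv k (\<lambda>x. f x + g x) = (\<lambda>x. partial_deriv k f x + partial_deriv k g x)" for k
    by (intro ext partial_deriv_add) auto
  with Suc show ?case by auto
qed (simp add: continuous_on_add)

lemma partial_deriv_linear:
  assumes "bounded_linear L" "f differentiable (at x)"
  shows "partial_deriv k (\<lambda>x. L (f x)) x = L (partial_deriv k f x)"
  using partial_deriv_eqI[OF bounded_linear.has_derivative[OF assms(1) has_frechet_derivative[OF assms(2)]]]
  by (simp add: partial_deriv_def)

lemma C_k_linear: "bounded_linear L \<Longrightarrow> C_k n f \<Longrightarrow> C_k n (\<lambda>x. L (f x))"
proof (induction n arbitrary: f)
  case (Suc n)
  then have "partial_deriv k (\<lambda>x. L (f x)) = (\<lambda>x. L (partial_deriv k f x))" for k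
    by (intro ext partial_deriv_linear) auto
  with Suc show ?case by (auto intro: bounded_linear_imp_differentiable differentiable_chain_at[unfolded comp_def])
qed (auto intro: continuous_on_compose2[OF linear_continuous_on])

lemma partial_deriv_bilinear:
  assumes "bounded_bilinear B" "f differentiable (at x)" "g differentiable (at x)"
  shows "partial_deriv k (\<lambda>x. B (f x) (g x)) x = B (f x) (partial_deriv k g x) + B (partial_deriv k f x) (g x)"
  using partial_deriv_eqI[OF bounded_bilinear.FDERIV[OF assms(1) assms(2,3)[THEN has_frechet_derivative]]]
  by (simp add: partial_deriv_def)

lemma C_k_bilinear:
  assumes B: "bounded_bilinear B"
  shows "C_k n f \<Longrightarrow> C_k n g \<Longrightarrow> C_k n (\<lambda>x. B (f x) (g x))"
proof (induction n arbitrary: f g)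
  case 0
  then show ?case using bounded_bilinear.continuous_on[OF B] by simp
next
  case (Suc n)
  have d: "f differentiable (at x)" "g differentiable (at x)" for x using Suc.prems by auto
  have "partial_deriv k (\<lambda>x. B (f x) (g x)) = (\<lambda>x. B (f x) (partial_deriv k g x) + B (partial_deriv k f x) (g x))" for k
    by (intro ext partial_deriv_bilinear B d)
  moreover have "(\<lambda>x. B (f x) (g x)) differentiable (at x)" for x
    using bounded_bilinear.FDERIV[OF B d[THEN has_frechet_derivative]] differentiable_def by blast
  moreover have "C_k n f" "C_k n g" using Suc.prems[THEN C_k_SucD] .
  ultimately show ?case using Suc.prems by (auto intro!: C_k_add Suc.IH)
qed

lemma partial_deriv_affine:
  fixes f :: "real^'d::finite \<Rightarrow> 'b::real_normed_vector"
  assumes "f differentiable (at (c *\<^sub>R x + a))"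
  shows "partial_deriv k (\<lambda>x. f (c *\<^sub>R x + a)) x = c *\<^sub>R partial_deriv k f (c *\<^sub>R x + a)"
    and "(\<lambda>x. f (c *\<^sub>R x + a)) differentiable (at x)"
proof -
  have "((\<lambda>x. c *\<^sub>R x + a) has_derivative (\<lambda>h. c *\<^sub>R h)) (at x)"
    by (auto intro!: derivative_eq_intros)
  then have "((\<lambda>x. f (c *\<^sub>R x + a)) has_derivative
      (\<lambda>h. frechet_derivative f (at (c *\<^sub>R x + a)) (c *\<^sub>R h))) (at x)"
    by (rule has_derivative_compose[where g = f]) (rule has_frechet_derivative[OF assms])
  from partial_deriv_eqI[OF this] this
  show "partial_deriv k (\<lambda>x. f (c *\<^sub>R x + a)) x = c *\<^sub>R partial_deriv k f (c *\<^sub>R x + a)"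
    "(\<lambda>x. f (c *\<^sub>R x + a)) differentiable (at x)"
    using linear_scale[OF linear_frechet_derivative[OF assms]]
    by (auto simp: partial_deriv_def differentiable_def)
qed

lemma C_k_affine: "C_k n f \<Longrightarrow> C_k n (\<lambda>x :: real^'d::finite. f (c *\<^sub>R x + a))"
proof (induction n arbitrary: f)
  case 0
  then show ?case by (auto intro!: continuous_on_compose2[of UNIV f] continuous_intros)
next
  case (Suc n)
  have "partial_deriv k (\<lambda>x. f (c *\<^sub>R x + a)) = (\<lambda>x. c *\<^sub>R partial_deriv k f (c *\<^sub>R x + a))" for k
    using Suc.prems by (intro ext partial_deriv_affine) auto
  then show ?case using Suc by (auto intro: partial_deriv_affine C_k_linear[OF bounded_linear_scaleR_right])
qed

lemma C_k_prod:
  fixes f :: "'i \<Rightarrow> real^'d::finite \<Rightarrow> real"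
  assumes "\<And>i. i \<in> I \<Longrightarrow> C_k n (f i)"
  shows "C_k n (\<lambda>x. \<Prod>i\<in>I. f i x)"
  using assms
proof (induction I rule: infinite_finite_induct)
  case (insert i I)
  then show ?case by (simp add: C_k_bilinear[OF bounded_bilinear_mult])
qed (simp_all add: C_k_const)

text \<open>The derivatives of $e^{-1/t}$ are linear combinations of the functions $e^{-1/t}t^{-j}$. All of these
are treated at once because the family is closed under differentiation, so that smoothness follows
by induction.\<close>

definition flat :: "nat \<Rightarrow> real \<Rightarrow> real"
  where "flat j t = (if t > 0 then exp (- (1 / t)) / t ^ j else 0)"

lemma flat_tendsto_0: "(flat j \<longlongrightarrow> 0) (at 0)"
proof (rule filterlim_split_at)
  have "\<forall>\<^sub>F t::real in at_left 0. 0 = flat j t"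
    by (auto simp: flat_def eventually_at_filter)
  then show "(flat j \<longlongrightarrow> 0) (at_left 0)" by (rule Lim_transform_eventually[rotated]) simp
  have "((\<lambda>s::real. s ^ j / exp s) \<longlongrightarrow> 0) at_top" by (rule tendsto_power_div_exp_0)
  from filterlim_compose[OF this filterlim_inverse_at_top_right]
  show "(flat j \<longlongrightarrow> 0) (at_right 0)"
    by (rule Lim_transform_eventually)
      (use eventually_at_right_less[of "0::real"] in \<open>eventually_elim,
        simp add: flat_def exp_minus inverse_eq_divide power_divide\<close>)
qed

lemma flat_has_derivative: "(flat j has_real_derivative (flat (j + 2) t - j * flat (j + 1) t)) (at t)"
proof -
  consider "t > 0" | "t < 0" | "t = 0" by linarith
  then show ?thesis
  proof cases
    case 1
    have "((\<lambda>t. exp (- (1 / t)) / t ^ j) has_real_derivative (flat (j + 2) t - j * flat (j + 1) t)) (at t)"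
      using 1
      apply (cases j)
       apply (auto intro!: derivative_eq_intros simp: flat_def field_simps power2_eq_square)
      subgoal for i by (cases i) auto
      done
    moreover have "\<forall>\<^sub>F s in nhds t. exp (- (1 / s)) / s ^ j = flat j s"
      using eventually_nhds_in_open[of "{0<..}" t] 1 by (auto elim: eventually_mono simp: flat_def)
    ultimately show ?thesis
      by (subst (asm) DERIV_cong_ev[OF refl _ refl]) auto
  next
    case 2
    have "((\<lambda>t. 0) has_real_derivative (flat (j + 2) t - j * flat (j + 1) t)) (at t)"
      using 2 by (auto simp: flat_def)
    moreover have "\<forall>\<^sub>F s in nhds t. 0 = flat j s"
      using eventually_nhds_in_open[of "{..<0}" t] 2 by (auto elim: eventually_mono simp: flat_def)
    ultimately show ?thesis
      by (subst (asm) DERIV_cong_ev[OF refl _ refl]) auto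
  next
    case 3
    have "(flat j h - flat j 0) / (h - 0) = flat (j + 1) h" for h
      by (simp add: flat_def)
    then show ?thesis using flat_tendsto_0[of "j + 1"] 3
      by (simp add: has_field_derivative_iff flat_def[of _ 0])
  qed
qed

lemma flat_coordinate_has_derivative:
  "((\<lambda>x :: real^'d::finite. flat j (c * x $ i + a)) has_derivative
    (\<lambda>h. (flat (j + 2) (c * x $ i + a) - j * flat (j + 1) (c * x $ i + a)) * (c * h $ i))) (at x)"
proof -
  have "((\<lambda>x :: real^'d. c * x $ i + a) has_derivative (\<lambda>h. c * h $ i)) (at x)"
    by (auto intro!: derivative_eq_intros bounded_linear.has_derivative[OF bounded_linear_vec_nth])
  then show ?thesis
    by (rule has_derivative_compose[OF _ flat_has_derivative[unfolded has_field_derivative_def]])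
qed

lemma partial_deriv_flat:
  "partial_deriv k (\<lambda>x :: real^'d::finite. flat j (c * x $ i + a)) = (\<lambda>x. (c * axis k 1 $ i) *
    (flat (j + 2) (c * x $ i + a) + - real j * flat (j + 1) (c * x $ i + a)))"
  by (rule ext) (simp add: partial_deriv_eqI[OF flat_coordinate_has_derivative] mult.commute)

lemma flat_differentiable: "(\<lambda>x :: real^'d::finite. flat j (c * x $ i + a)) differentiable (at x)"
  using flat_coordinate_has_derivative unfolding differentiable_def by blast

lemma C_k_flat: "C_k n (\<lambda>x :: real^'d::finite. flat j (c * x $ i + a))"
proof (induction n arbitrary: j)
  case 0
  then show ?case
    by (auto intro!: differentiable_imp_continuous_on flat_differentiable simp: differentiable_on_def
        intro: differentiable_at_withinI)
next
  case (Suc n)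
  show ?case unfolding C_k.simps(2) partial_deriv_flat
    by (intro conjI allI flat_differentiable C_k_linear[OF bounded_linear_mult_right] C_k_add Suc.IH)
qed

text \<open>For $s>0$ a smooth function, positive exactly on the open box from $a$ to $b$; as $s\to\infty$ it
increases to the indicator of the box.\<close>

definition bump :: "real \<Rightarrow> real^'d \<Rightarrow> real^'d \<Rightarrow> real^'d \<Rightarrow> real"
  where "bump s a b x = (\<Prod>i\<in>UNIV. flat 0 (s * (x $ i - a $ i)) * flat 0 (s * (b $ i - x $ i)))"

lemma C_k_bump: "C_k n (bump s a b :: real^'d::finite \<Rightarrow> real)"
proof -
  have "C_k n (\<lambda>x. flat 0 (s * x $ i + - (s * a $ i)) * flat 0 (- s * x $ i + s * b $ i))" for i
    by (intro C_k_bilinear[OF bounded_bilinear_mult] C_k_flat)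
  then have "C_k n (\<lambda>x. \<Prod>i\<in>UNIV. flat 0 (s * x $ i + - (s * a $ i)) * flat 0 (- s * x $ i + s * b $ i))"
    by (rule C_k_prod)
  then show ?thesis by (simp add: bump_def[abs_def] algebra_simps)
qed

lemma flat_0_bounds: "0 \<le> flat 0 t" "flat 0 t \<le> 1"
  by (auto simp: flat_def)

lemma flat_0_pos_iff: "flat 0 t \<noteq> 0 \<longleftrightarrow> t > 0"
  by (auto simp: flat_def)

lemma bump_bounds: "0 \<le> bump s a b x" "bump s a b x \<le> 1"
  unfolding bump_def by (auto intro!: prod_nonneg prod_le_1 mult_le_one simp: flat_0_bounds)

lemma bump_nonzero_iff:
  assumes "s > 0"
  shows "bump s a b x \<noteq> 0 \<longleftrightarrow> x \<in> box a b"
  using assms by (auto simp: bump_def flat_0_pos_iff mem_box_cart zero_less_mult_iff)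

lemma bump_tendsto_indicator:
  "(\<lambda>n. bump (real (Suc n)) a b x) \<longlonglongrightarrow> indicator (box a b) (x :: real^'d::finite)"
proof (cases "x \<in> box a b")
  case True
  have *: "(\<lambda>n. flat 0 (real (Suc n) * t)) \<longlonglongrightarrow> 1" if "t > 0" for t
  proof -
    have "(\<lambda>n. exp (- (1 / t * (1 / real (Suc n))))) \<longlonglongrightarrow> exp (- (1 / t * 0))"
      by (intro tendsto_intros LIMSEQ_Suc[OF lim_1_over_n])
    moreover have "flat 0 (real (Suc n) * t) = exp (- (1 / t * (1 / real (Suc n))))" for n
      using that unfolding flat_def by (auto simp: zero_less_mult_iff mult.commute)
    ultimately show ?thesis by simp
  qed
  have "(\<lambda>n. bump (real (Suc n)) a b x) \<longlonglongrightarrow> (\<Prod>i\<in>(UNIV :: 'd set). 1 * 1)"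
    unfolding bump_def using True by (intro tendsto_prod tendsto_mult *) (auto simp: mem_box_cart)
  then show ?thesis using True by simp
next
  case False
  then have "bump (real (Suc n)) a b x = 0" for n using bump_nonzero_iff[of "real (Suc n)" a b x] by simp
  then show ?thesis using False by simp
qed

section \<open>Test functions\<close>

text \<open>Test functions with values in any normed space: real ones serve as cutoffs and mollifiers,
vector-valued ones test all components of a system at once.\<close>

definition test_fun :: "(real^'d::finite \<Rightarrow> 'b::real_normed_vector) \<Rightarrow> bool"
  where "test_fun f \<longleftrightarrow> (\<forall>n. C_k n f) \<and> bounded {x. f x \<noteq> 0}"

lemma test_funI: "(\<And>n. C_k n f) \<Longrightarrow> bounded S \<Longrightarrow> {x. f x \<noteq> 0} \<subseteq> S \<Longrightarrow> test_fun f"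
  unfolding test_fun_def by (auto intro: bounded_subset)

lemma test_fun_C_k: "test_fun f \<Longrightarrow> C_k n f"
  and test_fun_bounded_support: "test_fun f \<Longrightarrow> bounded {x. f x \<noteq> 0}"
  by (simp_all add: test_fun_def)

lemma test_functions_iff: "f \<in> test_functions \<longleftrightarrow> test_fun f"
  by (simp add: test_functions_def test_fun_def compact_closure)

lemma test_fun_differentiable: "test_fun f \<Longrightarrow> f differentiable (at x)"
  unfolding test_fun_def using C_k.simps(2)[of 0 f] by metis

lemma test_fun_continuous: "test_fun f \<Longrightarrow> continuous_on S f"
  unfolding test_fun_def by (metis C_k_imp_continuous continuous_on_subset subset_UNIV)

lemma partial_deriv_eq_0:
  assumes "x \<notin> closure {x. f x \<noteq> 0}"
  shows "partial_deriv k f x = 0"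
proof -
  have "((\<lambda>x. 0) has_derivative (\<lambda>h. 0)) (at x)" by simp
  then have "(f has_derivative (\<lambda>h. 0)) (at x)"
    by (rule has_derivative_transform_within_open[of _ _ _ _ "- closure {x. f x \<noteq> 0}"])
      (use assms closure_subset[of "{x. f x \<noteq> 0}"] in auto)
  then show ?thesis by (simp add: partial_deriv_eqI)
qed

lemma test_fun_partial_deriv:
  assumes "test_fun f"
  shows "test_fun (partial_deriv k f)"
  unfolding test_fun_def
proof (intro conjI allI)
  fix n
  have "C_k (Suc n) f" using assms unfolding test_fun_def by (elim conjE allE)
  then show "C_k n (partial_deriv k f)" by simp
next
  have "{x. partial_deriv k f x \<noteq> 0} \<subseteq> closure {x. f x \<noteq> 0}"
    using partial_deriv_eq_0[of _ f k] by auto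
  moreover have "bounded (closure {x. f x \<noteq> 0})"
    using assms unfolding test_fun_def by (blast intro: bounded_closure)
  ultimately show "bounded {x. partial_deriv k f x \<noteq> 0}" by (rule bounded_subset[rotated])
qed

lemma test_fun_0: "test_fun (\<lambda>x. 0)"
  by (simp add: test_fun_def C_k_const)

lemma test_fun_add:
  assumes "test_fun f" "test_fun g"
  shows "test_fun (\<lambda>x. f x + g x)"
proof -
  have "{x. f x + g x \<noteq> 0} \<subseteq> {x. f x \<noteq> 0} \<union> {x. g x \<noteq> 0}" by auto
  then show ?thesis
    by (rule test_funI[OF C_k_add[OF assms[THEN test_fun_C_k]]
          bounded_Un[THEN iffD2, OF conjI[OF assms[THEN test_fun_bounded_support]]]])
qed

lemma test_fun_linear:
  assumes L: "bounded_linear L" and f: "test_fun f"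
  shows "test_fun (\<lambda>x. L (f x))"
proof -
  have "{x. L (f x) \<noteq> 0} \<subseteq> {x. f x \<noteq> 0}" using linear_simps(3)[OF L] by auto
  then show ?thesis
    by (rule test_funI[OF C_k_linear[OF L test_fun_C_k[OF f]] test_fun_bounded_support[OF f]])
qed

lemma test_fun_bilinear:
  assumes B: "bounded_bilinear B" and f: "test_fun f" and g: "\<And>n. C_k n g"
  shows "test_fun (\<lambda>x. B (f x) (g x))"
proof -
  have "{x. B (f x) (g x) \<noteq> 0} \<subseteq> {x. f x \<noteq> 0}" using bounded_bilinear.zero_left[OF B] by auto
  then show ?thesis
    by (rule test_funI[OF C_k_bilinear[OF B test_fun_C_k[OF f] g] test_fun_bounded_support[OF f]])
qed

lemma test_fun_affine:
  fixes f :: "real^'d::finite \<Rightarrow> 'b::real_normed_vector"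
  assumes f: "test_fun f" and "c \<noteq> 0"
  shows "test_fun (\<lambda>x. f (c *\<^sub>R x + a))"
proof -
  have "{x. f (c *\<^sub>R x + a) \<noteq> 0} \<subseteq> (\<lambda>y. (1 / c) *\<^sub>R (y - a)) ` {x. f x \<noteq> 0}"
    using assms by (auto intro!: image_eqI[of _ _ "c *\<^sub>R x + a" for x])
  moreover have "bounded ((\<lambda>y. (1 / c) *\<^sub>R (y - a)) ` {x. f x \<noteq> 0})"
    using f bounded_scaling[OF bounded_translation_minus[of "{x. f x \<noteq> 0}" a], of "1 / c"]
    by (simp add: test_fun_def image_image)
  ultimately show ?thesis by (intro test_funI[OF C_k_affine[OF test_fun_C_k[OF f]]])
qed

lemma test_fun_bump: "s > 0 \<Longrightarrow> test_fun (bump s a b)"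
  unfolding test_fun_def using bump_nonzero_iff[of s a b]
  by (auto simp: C_k_bump)

lemma test_fun_bounded:
  assumes "test_fun f"
  obtains B where "B \<ge> 0" "\<And>x. norm (f x) \<le> B"
proof -
  have "compact (closure {x. f x \<noteq> 0})" using assms by (simp add: test_fun_def compact_closure)
  then have "bounded (f ` closure {x. f x \<noteq> 0})"
    by (intro compact_imp_bounded compact_continuous_image test_fun_continuous assms)
  then obtain B where "B > 0" "\<And>x. x \<in> closure {x. f x \<noteq> 0} \<Longrightarrow> norm (f x) \<le> B"
    unfolding bounded_pos by blast
  then show thesis using closure_subset[of "{x. f x \<noteq> 0}"]
    by (intro that[of B]) (smt (verit) mem_Collect_eq norm_zero subsetD)+
qed

lemma test_fun_measurable:
  fixes f :: "real^'d::finite \<Rightarrow> 'b::real_normed_vector"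
  assumes "test_fun f"
  shows "f \<in> borel_measurable borel"
  by (intro borel_measurable_continuous_onI test_fun_continuous assms)

lemma test_fun_lebesgue_measurable:
  fixes f :: "real^'d::finite \<Rightarrow> 'b::real_normed_vector"
  assumes "test_fun f"
  shows "f \<in> borel_measurable lebesgue"
  by (rule measurable_completion) (use test_fun_measurable[OF assms] in simp)

lemma test_fun_integrable:
  fixes f :: "real^'d::finite \<Rightarrow> 'b::{banach, second_countable_topology}"
  assumes f: "test_fun f"
  shows "integrable lebesgue f"
proof -
  obtain B where B: "\<And>x. norm (f x) \<le> B" using test_fun_bounded[OF f] by blast
  obtain c where c: "{x. f x \<noteq> 0} \<subseteq> cball 0 c"
    using f unfolding test_fun_def bounded_iff subset_eq by auto
  have "integrable lebesgue (\<lambda>x. B * indicator (cball (0::real^'d) c) x)"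
    by (intro integrable_mult_right integrable_real_indicator) (use emeasure_bounded_finite[OF bounded_cball[of "0::real^'d" c]] in auto)
  moreover have "norm (f x) \<le> norm (B * indicator (cball 0 c) x)" for x
    using B[of x] c by (cases "f x = 0") (auto simp: indicator_def)
  ultimately show ?thesis
    by (intro Bochner_Integration.integrable_bound[OF _ test_fun_lebesgue_measurable[OF f]] AE_I2)
qed

lemma test_fun_Lipschitz:
  fixes f :: "real^'d::finite \<Rightarrow> 'b::real_normed_vector"
  assumes f: "test_fun f"
  obtains B where "B \<ge> 0" "\<And>x y. norm (f x - f y) \<le> B * norm (x - y)"
    "\<And>x h. norm (\<Sum>k\<in>UNIV. h $ k *\<^sub>R partial_deriv k f x) \<le> B * norm h"
proof -
  have "\<exists>b\<ge>0. \<forall>x. norm (partial_deriv k f x) \<le> b" for k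
    using test_fun_bounded[OF test_fun_partial_deriv[OF f]] by metis
  then obtain b where b: "\<And>k. b k \<ge> 0" "\<And>k x. norm (partial_deriv k f x) \<le> b k" by metis
  define B where "B = (\<Sum>k\<in>UNIV. b k)"
  have D: "norm (\<Sum>k\<in>UNIV. h $ k *\<^sub>R partial_deriv k f x) \<le> B * norm h" for x and h :: "real^'d"
  proof -
    have "norm (\<Sum>k\<in>UNIV. h $ k *\<^sub>R partial_deriv k f x) \<le> (\<Sum>k\<in>UNIV. norm h * b k)"
      by (rule sum_norm_le) (auto intro!: mult_mono b component_le_norm_cart)
    then show ?thesis by (simp add: B_def sum_distrib_left mult.commute)
  qed
  have "norm (f x - f y) \<le> B * norm (x - y)" for x y
    by (rule differentiable_bound[of UNIV f "\<lambda>x h. \<Sum>k\<in>UNIV. h $ k *\<^sub>R partial_deriv k f x"])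
      (auto intro!: has_derivative_sum_partial_deriv test_fun_differentiable f onorm_bound D
        sum_nonneg b simp: B_def[symmetric], simp add: B_def sum_nonneg b)
  with D show thesis using b(1) by (intro that[of B]) (auto simp: B_def sum_nonneg)
qed

lemma test_fun_square_integrable:
  fixes f :: "real^'d::finite \<Rightarrow> complex^'m::finite"
  assumes f: "test_fun f"
  shows "square_integrable f"
proof -
  have "test_fun (\<lambda>x. f x \<bullet> f x)"
    by (rule test_fun_bilinear[OF bounded_bilinear_inner f test_fun_C_k[OF f]])
  from test_fun_integrable[OF this] show ?thesis
    using test_fun_lebesgue_measurable[OF f] by (simp add: square_integrable_def power2_norm_eq_inner)
qed

lemma integral_lebesgue_translate:
  fixes f :: "'a::euclidean_space \<Rightarrow> 'b::{banach, second_countable_topology}"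
  assumes [measurable]: "f \<in> borel_measurable borel"
  shows "(LINT x|lebesgue. f (x + a)) = (LINT x|lebesgue. f x)"
proof -
  have "(LINT x|lborel. f x) = (LINT x|distr lborel borel ((+) a). f x)" by (simp add: lborel_distr_plus)
  also have "\<dots> = (LINT x|lborel. f (a + x))" by (rule integral_distr) measurable
  finally show ?thesis by (simp add: integral_completion add.commute)
qed

lemma integral_lebesgue_reflect:
  fixes f :: "'a::euclidean_space \<Rightarrow> 'b::{banach, second_countable_topology}"
  assumes [measurable]: "f \<in> borel_measurable borel"
  shows "(LINT y|lebesgue. f (x - y)) = (LINT x|lebesgue. f x)"
proof -
  have "lborel = distr lborel borel (\<lambda>y. x - y)"
    using lborel_affine[of "-1" x] by (simp add: density_1)
  then have "(LINT y|lborel. f y) = (LINT y|distr lborel borel (\<lambda>y. x - y). f y)" by simp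
  also have "\<dots> = (LINT y|lborel. f (x - y))" by (rule integral_distr) measurable
  finally show ?thesis by (simp add: integral_completion)
qed

text \<open>In this form dominated convergence applies to difference quotients.\<close>

lemma has_derivative_iff_sequentially:
  "(f has_derivative D) (at x) \<longleftrightarrow> bounded_linear D \<and>
    (\<forall>X. (\<forall>n. X n \<noteq> 0) \<longrightarrow> X \<longlonglongrightarrow> 0 \<longrightarrow>
      (\<lambda>n. (f (x + X n) - f x - D (X n)) /\<^sub>R norm (X n)) \<longlonglongrightarrow> 0)"
proof -
  have "(\<lambda>h. norm (f (x + h) - f x - D h) / norm h) \<midarrow>0\<rightarrow> 0
      \<longleftrightarrow> (\<lambda>h. (f (x + h) - f x - D h) /\<^sub>R norm h) \<midarrow>0\<rightarrow> 0"
    by (subst tendsto_norm_zero_iff[symmetric]) (simp add: divide_inverse mult.commute)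
  then show ?thesis
    unfolding has_derivative_at tendsto_at_iff_sequentially by (simp add: comp_def)
qed

text \<open>Difference quotients have integral $0$ by translation invariance, and they converge boundedly with
supports in a fixed ball.\<close>

lemma integral_partial_deriv_eq_0:
  fixes f :: "real^'d::finite \<Rightarrow> 'b::euclidean_space"
  assumes f: "test_fun f"
  shows "(LINT x|lebesgue. partial_deriv k f x) = 0"
proof -
  define t where "t n = (1 / real (Suc n)) *\<^sub>R (axis k 1 :: real^'d)" for n
  have t: "norm (t n) = 1 / real (Suc n)" for n by (simp add: t_def)
  then have t0: "t n \<noteq> 0" for n by (metis divide_eq_0_iff norm_zero of_nat_neq_0 zero_neq_one)
  have tlim: "t \<longlonglongrightarrow> 0"
    using LIMSEQ_Suc[OF lim_1_over_n] by (intro tendsto_norm_zero_cancel[of t]) (simp add: t)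
  define q where "q n x = real (Suc n) *\<^sub>R (f (x + t n) - f x)" for n x
  obtain B where B: "B \<ge> 0" "\<And>x y. norm (f x - f y) \<le> B * norm (x - y)" using test_fun_Lipschitz[OF f] by metis
  obtain c where c: "\<And>x. f x \<noteq> 0 \<Longrightarrow> norm x \<le> c"
    using test_fun_bounded_support[OF f] unfolding bounded_iff by auto
  have [measurable]: "f \<in> borel_measurable borel" by (rule test_fun_measurable[OF f])
  have lim: "(\<lambda>n. q n x) \<longlonglongrightarrow> partial_deriv k f x" for x
  proof -
    let ?D = "\<lambda>h. \<Sum>j\<in>UNIV. h $ j *\<^sub>R partial_deriv j f x"
    have D: "?D (t n) = (1 / real (Suc n)) *\<^sub>R partial_deriv k f x" for n
      by (simp add: t_def axis_def if_distrib if_distribR sum.delta cong: if_cong)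
    have "(\<lambda>n. (f (x + t n) - f x - ?D (t n)) /\<^sub>R norm (t n)) \<longlonglongrightarrow> 0"
      using has_derivative_sum_partial_deriv[OF test_fun_differentiable[OF f]] t0 tlim
      unfolding has_derivative_iff_sequentially by blast
    then have "(\<lambda>n. q n x - partial_deriv k f x) \<longlonglongrightarrow> 0"
      by (simp add: D t q_def scaleR_diff_right)
    then show ?thesis by (rule LIM_zero_cancel)
  qed
  have "(\<lambda>n. LINT x|lebesgue. q n x) \<longlonglongrightarrow> (LINT x|lebesgue. partial_deriv k f x)"
  proof (rule integral_dominated_convergence[where w = "\<lambda>x. B * indicator (cball (0 :: real^'d) (c + 1)) x"])
    show "partial_deriv k f \<in> borel_measurable lebesgue"
      by (intro test_fun_lebesgue_measurable test_fun_partial_deriv f)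
    show "q n \<in> borel_measurable lebesgue" for n
      unfolding q_def by (rule measurable_completion) simp
    show "integrable lebesgue (\<lambda>x. B * indicator (cball (0::real^'d) (c + 1)) x)"
      using emeasure_bounded_finite[OF bounded_cball[of "0::real^'d" "c + 1"]]
      by (intro integrable_mult_right integrable_real_indicator) auto
    show "AE x in lebesgue. (\<lambda>n. q n x) \<longlonglongrightarrow> partial_deriv k f x" using lim by simp
    show "AE x in lebesgue. norm (q n x) \<le> B * indicator (cball 0 (c + 1)) x" for n
    proof (rule AE_I2)
      fix x :: "real^'d"
      have "norm (q n x) \<le> B"
        using B(2)[of "x + t n" x] unfolding q_def norm_scaleR by (simp add: t field_simps del: of_nat_Suc)
      moreover have "norm x \<le> c + 1" if "q n x \<noteq> 0"
      proof -
        have "norm (t n) \<le> 1" by (simp add: t)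
        moreover have "norm x \<le> norm (x + t n) + norm (t n)" by (metis add_diff_cancel norm_triangle_ineq4)
        ultimately show ?thesis using that c[of x] c[of "x + t n"] by (fastforce simp: q_def)
      qed
      ultimately show "norm (q n x) \<le> B * indicator (cball 0 (c + 1)) x"
        by (cases "q n x = 0") (auto simp: indicator_def B(1))
    qed
  qed
  moreover have "(LINT x|lebesgue. q n x) = 0" for n
  proof -
    have "integrable lebesgue (\<lambda>x. f (x + t n))"
      using test_fun_integrable[OF test_fun_affine[OF f, of 1 "t n"]] by simp
    then show ?thesis
      unfolding q_def by (simp add: test_fun_integrable[OF f] integral_lebesgue_translate)
  qed
  ultimately show ?thesis by (simp add: LIMSEQ_const_iff)
qed

lemma integration_by_parts:
  fixes f :: "real^'d::finite \<Rightarrow> 'b::euclidean_space" and g :: "real^'d::finite \<Rightarrow> 'b"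
  assumes f: "test_fun f" and g: "test_fun g"
  shows "(LINT x|lebesgue. f x \<bullet> partial_deriv k g x) = - (LINT x|lebesgue. partial_deriv k f x \<bullet> g x)"
proof -
  have fg: "test_fun (\<lambda>x. f x \<bullet> g x)"
    by (rule test_fun_bilinear[OF bounded_bilinear_inner f test_fun_C_k[OF g]])
  have 1: "integrable lebesgue (\<lambda>x. f x \<bullet> partial_deriv k g x)"
    by (rule test_fun_integrable[OF test_fun_bilinear[OF bounded_bilinear_inner f test_fun_C_k[OF test_fun_partial_deriv[OF g]]]])
  have 2: "integrable lebesgue (\<lambda>x. partial_deriv k f x \<bullet> g x)"
    by (rule test_fun_integrable[OF test_fun_bilinear[OF bounded_bilinear_inner test_fun_partial_deriv[OF f] test_fun_C_k[OF g]]])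
  have "partial_deriv k (\<lambda>x. f x \<bullet> g x) = (\<lambda>x. f x \<bullet> partial_deriv k g x + partial_deriv k f x \<bullet> g x)"
    by (intro ext partial_deriv_bilinear bounded_bilinear_inner test_fun_differentiable f g)
  then show ?thesis using integral_partial_deriv_eq_0[OF fg, of k] 1 2 by simp
qed

section \<open>Density of test functions\<close>

lemma sigma_finite_lebesgue: "sigma_finite_measure (lebesgue :: 'a::euclidean_space measure)"
proof
  show "\<exists>A. countable A \<and> A \<subseteq> sets (lebesgue :: 'a measure) \<and> \<Union> A = space lebesgue
      \<and> (\<forall>a\<in>A. emeasure lebesgue a \<noteq> \<infinity>)"
  proof (intro exI[of _ "range (\<lambda>n::nat. ball 0 (real n))"] conjI ballI)
    show "\<Union> (range (\<lambda>n::nat. ball (0::'a) (real n))) = space lebesgue"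
      using reals_Archimedean2 by (auto simp: dist_norm)
    show "emeasure lebesgue a \<noteq> \<infinity>" if "a \<in> range (\<lambda>n::nat. ball (0::'a) (real n))" for a
    proof -
      obtain n where "a = ball 0 (real n)" using \<open>a \<in> _\<close> by blast
      then show ?thesis using emeasure_bounded_finite[OF bounded_ball[of "0::'a" "real n"]] by auto
    qed
  qed auto
qed

lemma integrable_indicator_bounded:
  fixes S :: "'a::euclidean_space set"
  assumes "S \<in> sets borel" "bounded S"
  shows "integrable lebesgue (indicator S :: 'a \<Rightarrow> real)"
  using assms emeasure_bounded_finite[of S]
  by (intro integrable_real_indicator) (auto simp: emeasure_completion)

text \<open>Boxes form an intersection-stable generator of the Borel sets, and the sets on which the integral
vanishes form a Dynkin system; null sets account for the remaining Lebesgue sets.\<close>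

lemma integral_zero_on_boxes_imp_AE_zero:
  fixes f :: "real^'d::finite \<Rightarrow> 'b::{banach, second_countable_topology}"
  assumes f: "integrable lebesgue f"
    and boxes: "\<And>a b. (LINT x:box a b|lebesgue. f x) = 0"
    and total: "(LINT x|lebesgue. f x) = 0"
  shows "AE x in lebesgue. f x = 0"
proof (rule sigma_finite_measure.density_zero[OF sigma_finite_lebesgue f])
  have si: "set_integrable lebesgue S f" if "S \<in> sets lebesgue" for S
    unfolding set_integrable_def using f that by (rule integrable_mult_indicator[rotated])
  let ?E = "range (\<lambda>(a, b). box a b :: (real^'d) set)"
  have E: "Int_stable ?E" "?E \<subseteq> Pow UNIV" by (auto simp: Int_stable_def box_Int_box)
  have sets_E: "sigma_sets UNIV ?E = sets borel" by (simp add: borel_eq_box)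
  have borel: "(LINT x:S|lebesgue. f x) = 0" if "S \<in> sigma_sets UNIV ?E" for S
    using E that
  proof (induct rule: sigma_sets_induct_disjoint)
    case (basic A) then show ?case using boxes by auto
  next
    case empty show ?case by (simp add: set_lebesgue_integral_def)
  next
    case (compl A)
    then have A: "A \<in> sets lebesgue" by (simp add: sets_E)
    have "(LINT x:UNIV - A|lebesgue. f x) = (LINT x|lebesgue. f x - indicator A x *\<^sub>R f x)"
      unfolding set_lebesgue_integral_def by (intro Bochner_Integration.integral_cong) (auto simp: indicator_def)
    also have "\<dots> = 0"
      using compl(2) total si[OF A] f by (simp add: set_lebesgue_integral_def set_integrable_def)
    finally show ?case .
  next
    case (union A)
    have A: "A i \<in> sets lebesgue" for i using union(2) by (simp add: sets_E)
    have "(LINT x:(\<Union>i. A i)|lebesgue. f x) = (\<Sum>i. LINT x:A i|lebesgue. f x)"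
      by (intro lebesgue_integral_countable_add si) (use A union(1) in \<open>auto simp: disjoint_family_on_def\<close>)
    then show ?case using union(3) by simp
  qed
  fix S :: "(real^'d) set" assume "S \<in> sets lebesgue"
  then obtain T N N' where S: "S = T \<union> N" "N \<subseteq> N'" "N' \<in> null_sets lborel" "T \<in> sets lborel"
    by (auto elim: sets_completionE)
  have "AE x in lebesgue. x \<notin> N'" using S(3) by (intro AE_not_in) (simp add: null_sets_completionI)
  then have "AE x in lebesgue. indicator S x *\<^sub>R f x = indicator T x *\<^sub>R f x"
    by eventually_elim (use S in \<open>auto simp: indicator_def\<close>)
  then have "(LINT x:S|lebesgue. f x) = (LINT x:T|lebesgue. f x)"
    unfolding set_lebesgue_integral_def
  proof (rule integral_cong_AE[rotated 2])
    show "(\<lambda>x. indicator S x *\<^sub>R f x) \<in> borel_measurable lebesgue"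
      using si[OF \<open>S \<in> sets lebesgue\<close>] unfolding set_integrable_def by (rule borel_measurable_integrable)
    have "T \<in> sets lebesgue" using S(4) by simp
    from si[OF this] show "(\<lambda>x. indicator T x *\<^sub>R f x) \<in> borel_measurable lebesgue"
      unfolding set_integrable_def by (rule borel_measurable_integrable)
  qed
  also have "\<dots> = 0" using S(4) by (intro borel) (simp add: sets_E)
  finally show "(LINT x:S|lebesgue. f x) = 0" .
qed

text \<open>Testing with bumps times a basis vector and passing to the limit shows that $u$ has mean $0$ on every
box. This is the fundamental lemma of the calculus of variations; it gives uniqueness of weak
derivatives as well as density of test functions.\<close>

lemma orthogonal_to_test_funs_imp_0:
  fixes u :: "('d::finite, 'm::finite) L2"
  assumes orth: "\<And>\<psi>. test_fun \<psi> \<Longrightarrow> u \<bullet> abs_L2 \<psi> = 0"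
  shows "u = 0"
proof -
  let ?f = "rep_L2 u"
  have f: "square_integrable ?f" and [measurable]: "?f \<in> borel_measurable lebesgue"
    using square_integrable_rep_L2[of u] by (auto simp: square_integrable_def)
  have si: "set_integrable lebesgue (box a b) ?f" for a b
    unfolding set_integrable_def
  proof (rule Bochner_Integration.integrable_bound)
    show "integrable lebesgue (\<lambda>x. indicator (box a b) x + (norm (?f x))\<^sup>2)"
      using f integrable_indicator_bounded[of "box a b"]
      by (intro Bochner_Integration.integrable_add) (auto simp: square_integrable_def)
    show "AE x in lebesgue. norm (indicator (box a b) x *\<^sub>R ?f x) \<le> norm (indicator (box a b) x + (norm (?f x))\<^sup>2)"
    proof (rule AE_I2)
      fix x
      have "norm (?f x) \<le> 1 + (norm (?f x))\<^sup>2"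
        using sum_squares_bound[of 1 "norm (?f x)"] norm_ge_zero[of "?f x"] by (simp, linarith)
      then show "norm (indicator (box a b) x *\<^sub>R ?f x) \<le> norm (indicator (box a b) x + (norm (?f x))\<^sup>2)"
        by (simp add: indicator_def)
    qed
    show "(\<lambda>x. indicator (box a b) x *\<^sub>R ?f x) \<in> borel_measurable lebesgue"
      using f by (intro borel_measurable_scaleR borel_measurable_indicator) (auto simp: square_integrable_def)
  qed
  have boxes: "(LINT x:box a b|lebesgue. ?f x) = 0" for a b
  proof (rule euclidean_eqI)
    fix e :: "complex^'m" assume "e \<in> Basis"
    have "(\<lambda>n. LINT x|lebesgue. ?f x \<bullet> bump (real (Suc n)) a b x *\<^sub>R e)
        \<longlonglongrightarrow> (LINT x|lebesgue. (indicator (box a b) x *\<^sub>R ?f x) \<bullet> e)"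
    proof (rule integral_dominated_convergence[where w = "\<lambda>x. norm (indicator (box a b) x *\<^sub>R ?f x) * norm e"])
      show "integrable lebesgue (\<lambda>x. norm (indicator (box a b) x *\<^sub>R ?f x) * norm e)"
        using si unfolding set_integrable_def by (intro integrable_mult_left integrable_norm)
      show "(\<lambda>x. ?f x \<bullet> bump (real (Suc n)) a b x *\<^sub>R e) \<in> borel_measurable lebesgue" for n
      proof -
        have [measurable]: "bump (real (Suc n)) a b \<in> borel_measurable lebesgue"
          by (intro test_fun_lebesgue_measurable test_fun_bump) simp
        show ?thesis by measurable
      qed
      show "AE x in lebesgue. (\<lambda>n. ?f x \<bullet> bump (real (Suc n)) a b x *\<^sub>R e)
          \<longlonglongrightarrow> (indicator (box a b) x *\<^sub>R ?f x) \<bullet> e"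
      proof (rule AE_I2)
        fix x
        have "(\<lambda>n. ?f x \<bullet> bump (real (Suc n)) a b x *\<^sub>R e) \<longlonglongrightarrow> ?f x \<bullet> (indicator (box a b) x *\<^sub>R e)"
          by (intro tendsto_intros bump_tendsto_indicator)
        then show "(\<lambda>n. ?f x \<bullet> bump (real (Suc n)) a b x *\<^sub>R e)
          \<longlonglongrightarrow> (indicator (box a b) x *\<^sub>R ?f x) \<bullet> e" by simp
      qed
      show "AE x in lebesgue. norm (?f x \<bullet> bump (real (Suc n)) a b x *\<^sub>R e)
          \<le> norm (indicator (box a b) x *\<^sub>R ?f x) * norm e" for n
      proof (rule AE_I2)
        fix x
        have "\<bar>bump (real (Suc n)) a b x\<bar> \<le> indicator (box a b) x"
          using bump_bounds[of "real (Suc n)" a b x] bump_nonzero_iff[of "real (Suc n)" a b x]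
          by (auto simp: indicator_def)
        then have "\<bar>bump (real (Suc n)) a b x\<bar> * \<bar>?f x \<bullet> e\<bar> \<le> indicator (box a b) x * (norm (?f x) * norm e)"
          by (intro mult_mono Cauchy_Schwarz_ineq2) auto
        then show "norm (?f x \<bullet> bump (real (Suc n)) a b x *\<^sub>R e)
          \<le> norm (indicator (box a b) x *\<^sub>R ?f x) * norm e"
          by (simp add: abs_mult mult.assoc)
      qed
      show "(\<lambda>x. (indicator (box a b) x *\<^sub>R ?f x) \<bullet> e) \<in> borel_measurable lebesgue"
        using si[unfolded set_integrable_def]
        by (intro borel_measurable_inner borel_measurable_const borel_measurable_integrable)
    qed
    moreover have "(LINT x|lebesgue. ?f x \<bullet> bump (real (Suc n)) a b x *\<^sub>R e) = 0" for n
    proof -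
      have t: "test_fun (\<lambda>x. bump (real (Suc n)) a b x *\<^sub>R e)"
        by (rule test_fun_linear[OF bounded_linear_scaleR_left test_fun_bump]) simp
      from orth[OF this] show ?thesis
        unfolding inner_abs_L2_right[OF test_fun_square_integrable[OF t]] .
    qed
    ultimately have "(LINT x|lebesgue. (indicator (box a b) x *\<^sub>R ?f x) \<bullet> e) = 0"
      by (simp add: LIMSEQ_const_iff)
    moreover have "(LINT x|lebesgue. (indicator (box a b) x *\<^sub>R ?f x) \<bullet> e)
        = (LINT x|lebesgue. indicator (box a b) x *\<^sub>R ?f x) \<bullet> e"
      by (rule integral_inner_left) (use si in \<open>auto simp: set_integrable_def\<close>)
    ultimately show "(LINT x:box a b|lebesgue. ?f x) \<bullet> e = 0 \<bullet> e"
      by (simp add: set_lebesgue_integral_def)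
  qed
  let ?K = "\<lambda>n::nat. box (- (real n *\<^sub>R One)) (real n *\<^sub>R One) :: (real^'d) set"
  have "AE x in lebesgue. indicator (?K n) x *\<^sub>R ?f x = 0" for n
  proof (rule integral_zero_on_boxes_imp_AE_zero)
    show "integrable lebesgue (\<lambda>x. indicator (?K n) x *\<^sub>R ?f x)"
      using si by (simp add: set_integrable_def)
    show "(LINT x|lebesgue. indicator (?K n) x *\<^sub>R ?f x) = 0"
      using boxes by (simp add: set_lebesgue_integral_def)
    fix a b :: "real^'d"
    have "\<exists>c d. box a b \<inter> ?K n = box c d" by (rule exI, rule exI, rule box_Int_box)
    then obtain c d where "box a b \<inter> ?K n = box c d" by blast
    then have "(LINT x:box a b|lebesgue. indicator (?K n) x *\<^sub>R ?f x) = (LINT x:box c d|lebesgue. ?f x)"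
      unfolding set_lebesgue_integral_def by (simp flip: indicator_inter_arith)
    then show "(LINT x:box a b|lebesgue. indicator (?K n) x *\<^sub>R ?f x) = 0" by (simp add: boxes)
  qed
  then have "AE x in lebesgue. \<forall>n. indicator (?K n) x *\<^sub>R ?f x = 0"
    unfolding AE_all_countable by (rule allI)
  then have "AE x in lebesgue. ?f x = 0"
  proof eventually_elim
    case (elim x)
    obtain n where "x \<in> ?K n" using UN_box_eq_UNIV by auto
    with elim show ?case by (metis indicator_simps(1) scaleR_one)
  qed
  then have "abs_L2 ?f = abs_L2 (\<lambda>x. 0)"
    by (intro abs_L2_eqI f square_integrable_0)
  then show ?thesis by (simp add: zero_L2_def)
qed

lemma test_funs_dense:
  fixes u :: "('d::finite, 'm::finite) L2"
  assumes "e > 0"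
  obtains \<psi> where "test_fun \<psi>" "norm (u - abs_L2 \<psi>) < e"
proof -
  let ?D = "{abs_L2 \<psi> | \<psi>. test_fun \<psi>} :: ('d, 'm) L2 set"
  have "subspace ?D"
  proof (rule subspaceI)
    show "0 \<in> ?D" using test_fun_0 by (auto simp: zero_L2_def)
  next
    fix x y assume "x \<in> ?D" "y \<in> ?D"
    then show "x + y \<in> ?D"
      by (auto simp flip: abs_L2_add simp: test_fun_square_integrable intro: test_fun_add)
  next
    fix r x assume "x \<in> ?D"
    then show "r *\<^sub>R x \<in> ?D"
      by (auto simp flip: abs_L2_scaleR simp: test_fun_square_integrable
          intro: test_fun_linear[OF bounded_linear_scaleR_right])
  qed
  then have "closure ?D = UNIV"
    by (rule dense_if_orthogonal_trivial) (auto intro: orthogonal_to_test_funs_imp_0)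
  then obtain v where "v \<in> ?D" "dist v u < e"
    using assms closure_approachable[of u ?D] by blast
  then show thesis using that by (auto simp: dist_norm norm_minus_commute)
qed

section \<open>Mollification\<close>

definition conv :: "(real^'d::finite \<Rightarrow> real) \<Rightarrow> (real^'d \<Rightarrow> 'b::euclidean_space) \<Rightarrow> real^'d \<Rightarrow> 'b"
  where "conv \<rho> w x = (LINT y|lebesgue. \<rho> (x - y) *\<^sub>R w y)"

lemma measurable_reflected_test_fun:
  assumes "test_fun \<rho>"
  shows "(\<lambda>y. \<rho> (x - y)) \<in> borel_measurable lebesgue"
  by (rule measurable_completion) (use test_fun_measurable[OF assms] in measurable)

lemma integrable_conv:
  fixes w :: "real^'d::finite \<Rightarrow> 'b::euclidean_space"
  assumes \<rho>: "test_fun \<rho>" and w: "integrable lebesgue w"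
  shows "integrable lebesgue (\<lambda>y. \<rho> (x - y) *\<^sub>R w y)"
proof -
  obtain B where B: "B \<ge> 0" "\<And>x. norm (\<rho> x) \<le> B" using test_fun_bounded[OF \<rho>] by metis
  have "integrable lebesgue (\<lambda>y. B * norm (w y))" using w by simp
  then show ?thesis
  proof (rule Bochner_Integration.integrable_bound)
    show "(\<lambda>y. \<rho> (x - y) *\<^sub>R w y) \<in> borel_measurable lebesgue"
      using w by (intro borel_measurable_scaleR measurable_reflected_test_fun \<rho>) simp
    show "AE y in lebesgue. norm (\<rho> (x - y) *\<^sub>R w y) \<le> norm (B * norm (w y))"
      using B by (intro AE_I2) (auto simp: abs_mult intro!: mult_right_mono)
  qed
qed

text \<open>Differentiation under the integral: the difference quotients of $\rho$ are bounded by its Lipschitz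
constant, hence dominated convergence applies to an integrable $w$.\<close>

lemma conv_has_derivative:
  fixes w :: "real^'d::finite \<Rightarrow> 'b::euclidean_space"
  assumes \<rho>: "test_fun \<rho>" and w: "integrable lebesgue w"
  shows "(conv \<rho> w has_derivative (\<lambda>h. \<Sum>k\<in>UNIV. h $ k *\<^sub>R conv (partial_deriv k \<rho>) w x)) (at x)"
  unfolding has_derivative_iff_sequentially
proof (intro conjI allI impI)
  show "bounded_linear (\<lambda>h. \<Sum>k\<in>UNIV. h $ k *\<^sub>R conv (partial_deriv k \<rho>) w x)"
    by (intro bounded_linear_sum bounded_linear_compose[OF bounded_linear_scaleR_left bounded_linear_vec_nth])
  fix X :: "nat \<Rightarrow> real^'d" assume X: "\<forall>n. X n \<noteq> 0" "X \<longlonglongrightarrow> 0"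
  let ?D = "\<lambda>z h. \<Sum>k\<in>UNIV. h $ k *\<^sub>R partial_deriv k \<rho> z"
  define E where "E n y = ((\<rho> (x - y + X n) - \<rho> (x - y) - ?D (x - y) (X n)) /\<^sub>R norm (X n)) *\<^sub>R w y" for n y
  note \<rho>' = test_fun_partial_deriv[OF \<rho>]
  obtain B where B: "B \<ge> 0" "\<And>x y. norm (\<rho> x - \<rho> y) \<le> B * norm (x - y)"
    "\<And>x h. norm (?D x h) \<le> B * norm h" using test_fun_Lipschitz[OF \<rho>] by metis
  have E_eq: "E n y = (\<rho> (x + X n - y) *\<^sub>R w y - \<rho> (x - y) *\<^sub>R w y
      - (\<Sum>k\<in>UNIV. X n $ k *\<^sub>R (partial_deriv k \<rho> (x - y) *\<^sub>R w y))) /\<^sub>R norm (X n)" for n y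
    by (simp add: E_def algebra_simps scaleR_sum_left scaleR_sum_right sum_distrib_left)
  have int: "(LINT y|lebesgue. E n y) = (conv \<rho> w (x + X n) - conv \<rho> w x
      - (\<Sum>k\<in>UNIV. X n $ k *\<^sub>R conv (partial_deriv k \<rho>) w x)) /\<^sub>R norm (X n)" for n
    unfolding E_eq conv_def using integrable_conv[OF \<rho> w] integrable_conv[OF \<rho>' w]
    by (simp del: scaleR_scaleR)
  have "(\<lambda>n. LINT y|lebesgue. E n y) \<longlonglongrightarrow> (LINT y::real^'d|lebesgue. 0)"
  proof (rule integral_dominated_convergence[where w = "\<lambda>y. 2 * B * norm (w y)"])
    show "E n \<in> borel_measurable lebesgue" for n
      unfolding E_eq using integrable_conv[OF \<rho> w] integrable_conv[OF \<rho>' w]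
      by (intro borel_measurable_integrable integrable_scaleR_right Bochner_Integration.integrable_diff
          Bochner_Integration.integrable_sum)
    show "integrable lebesgue (\<lambda>y. 2 * B * norm (w y))" using w by simp
    show "AE y in lebesgue. (\<lambda>n. E n y) \<longlonglongrightarrow> 0"
    proof (rule AE_I2)
      fix y
      have "(\<lambda>n. (\<rho> (x - y + X n) - \<rho> (x - y) - ?D (x - y) (X n)) /\<^sub>R norm (X n)) \<longlonglongrightarrow> 0"
        using has_derivative_sum_partial_deriv[OF test_fun_differentiable[OF \<rho>]] X
        unfolding has_derivative_iff_sequentially by blast
      from tendsto_scaleR[OF this tendsto_const[of "w y"]]
      show "(\<lambda>n. E n y) \<longlonglongrightarrow> 0" by (simp add: E_def)
    qed
    show "AE y in lebesgue. norm (E n y) \<le> 2 * B * norm (w y)" for n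
    proof (rule AE_I2)
      fix y
      have "norm (\<rho> (x - y + X n) - \<rho> (x - y) - ?D (x - y) (X n)) \<le> B * norm (X n) + B * norm (X n)"
        using B(2)[of "x - y + X n" "x - y"] B(3)[of "X n" "x - y"]
        by (intro order_trans[OF norm_triangle_ineq4[of "\<rho> (x - y + X n) - \<rho> (x - y)"]] add_mono) auto
      then have "norm ((\<rho> (x - y + X n) - \<rho> (x - y) - ?D (x - y) (X n)) /\<^sub>R norm (X n)) \<le> 2 * B"
        unfolding norm_scaleR using X(1) by (simp add: field_simps)
      then show "norm (E n y) \<le> 2 * B * norm (w y)"
        unfolding E_def norm_scaleR[of _ "w y"] by (intro mult_right_mono) auto
    qed
  qed simp
  then show "(\<lambda>n. (conv \<rho> w (x + X n) - conv \<rho> w x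
      - (\<Sum>k\<in>UNIV. X n $ k *\<^sub>R conv (partial_deriv k \<rho>) w x)) /\<^sub>R norm (X n)) \<longlonglongrightarrow> 0"
    by (simp add: int)
qed

lemma partial_deriv_conv:
  fixes w :: "real^'d::finite \<Rightarrow> 'b::euclidean_space"
  assumes "test_fun \<rho>" "integrable lebesgue w"
  shows "partial_deriv k (conv \<rho> w) = conv (partial_deriv k \<rho>) w"
  by (rule ext, subst partial_deriv_eqI[OF conv_has_derivative[OF assms]])
    (simp add: axis_def if_distrib if_distribR sum.delta cong: if_cong)

lemma C_k_conv:
  fixes w :: "real^'d::finite \<Rightarrow> 'b::euclidean_space"
  assumes w: "integrable lebesgue w"
  shows "test_fun \<rho> \<Longrightarrow> C_k n (conv \<rho> w)"
proof (induction n arbitrary: \<rho>)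
  case 0
  have "conv \<rho> w differentiable (at x)" for x
    using conv_has_derivative[OF 0 w] unfolding differentiable_def by blast
  then show ?case
    by (auto intro!: differentiable_imp_continuous_on differentiable_at_withinI simp: differentiable_on_def)
next
  case (Suc n)
  have "conv \<rho> w differentiable (at x)" for x
    using conv_has_derivative[OF Suc.prems w] unfolding differentiable_def by blast
  then show ?case
    by (simp add: partial_deriv_conv[OF Suc.prems w] Suc.IH test_fun_partial_deriv Suc.prems)
qed

lemma conv_eq_0:
  assumes "\<And>y. w y \<noteq> 0 \<Longrightarrow> norm y \<le> c" and "\<And>z. norm z \<ge> e \<Longrightarrow> \<rho> z = 0" and "norm x \<ge> c + e"
  shows "conv \<rho> w x = 0"
proof -
  have "\<rho> (x - y) *\<^sub>R w y = 0" for y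
  proof (cases "w y = 0")
    case False
    then have "norm (x - y) \<ge> e" using assms(1)[of y] assms(3) norm_triangle_ineq2[of x y] by simp
    then show ?thesis using assms(2) by simp
  qed simp
  then show ?thesis unfolding conv_def by (simp only: integral_zero)
qed

text \<open>The radius $e$ is a bound for the support, so that mollification enlarges supports by at most $e$.\<close>

definition mollifier :: "real \<Rightarrow> (real^'d::finite \<Rightarrow> real) \<Rightarrow> bool"
  where "mollifier e \<rho> \<longleftrightarrow> test_fun \<rho> \<and> (\<forall>z. 0 \<le> \<rho> z) \<and> (LINT z|lebesgue. \<rho> z) = 1 \<and>
    (\<forall>z. norm z \<ge> e \<longrightarrow> \<rho> z = 0)"

lemma mollifier_exists:
  assumes "e > 0"
  obtains \<rho> :: "real^'d::finite \<Rightarrow> real" where "mollifier e \<rho>"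
proof -
  \<comment> \<open>The cube with half side $r$ lies in the ball of radius $e$ by the $\ell^1$ bound for the norm.\<close>
  define r where "r = e / real CARD('d)"
  have r: "r > 0" using assms by (simp add: r_def)
  define b :: "real^'d" where "b = (\<chi> i. r)"
  define \<beta> where "\<beta> = bump 1 (- b) b"
  have \<beta>: "test_fun \<beta>" unfolding \<beta>_def by (rule test_fun_bump) simp
  have nonzero: "\<beta> z \<noteq> 0 \<longleftrightarrow> z \<in> box (- b) b" for z unfolding \<beta>_def by (rule bump_nonzero_iff) simp
  have pos: "\<beta> z \<ge> 0" for z unfolding \<beta>_def by (rule bump_bounds)
  define c where "c = (LINT z|lebesgue. \<beta> z)"
  have "c \<noteq> 0"
  proof
    assume "c = 0"
    then have "AE z in lebesgue. \<beta> z = 0"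
      unfolding c_def using integral_nonneg_eq_0_iff_AE[OF test_fun_integrable[OF \<beta>]] pos by simp
    then have "AE z in lebesgue. z \<notin> box (- b) b" by eventually_elim (use nonzero in auto)
    then have "AE z\<in>box (- b) b in lebesgue. z \<in> {}" by eventually_elim simp
    moreover have "0 \<in> box (- b) b" using r by (simp add: mem_box_cart b_def)
    ultimately have "0 \<in> ({} :: (real^'d) set)"
      by (rule mem_closed_if_AE_lebesgue_open[OF open_box closed_empty])
    then show False by simp
  qed
  moreover have "c \<ge> 0" unfolding c_def using pos by (intro Bochner_Integration.integral_nonneg) auto
  ultimately have c: "c > 0" by simp
  have far: "\<beta> z = 0" if "norm z \<ge> e" for z
  proof (rule ccontr)
    assume "\<beta> z \<noteq> 0"
    then have "\<bar>z $ i\<bar> < r" for i using nonzero by (auto simp: mem_box_cart b_def abs_less_iff minus_less_iff)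
    then have "norm z < real CARD('d) * r"
      using order.strict_trans1[OF norm_le_l1_cart sum_strict_mono[of "UNIV :: 'd set" "\<lambda>i. \<bar>z $ i\<bar>" "\<lambda>i. r"]]
      by simp
    then show False using that by (simp add: r_def)
  qed
  have "mollifier e (\<lambda>z. (1 / c) * \<beta> z)"
    unfolding mollifier_def using far c pos
    using test_fun_linear[OF bounded_linear_mult_right[of "1 / c"] \<beta>] by (simp add: c_def[symmetric])
  then show thesis by (rule that)
qed

lemma test_fun_conv:
  fixes w :: "real^'d::finite \<Rightarrow> 'b::euclidean_space"
  assumes \<rho>: "mollifier e \<rho>" and w: "integrable lebesgue w" "\<And>y. w y \<noteq> 0 \<Longrightarrow> norm y \<le> c"
  shows "test_fun (conv \<rho> w)"
proof (rule test_funI)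
  show "C_k n (conv \<rho> w)" for n using \<rho> w(1) by (intro C_k_conv) (auto simp: mollifier_def)
  show "{x. conv \<rho> w x \<noteq> 0} \<subseteq> cball 0 (c + e)"
  proof
    fix x assume "x \<in> {x. conv \<rho> w x \<noteq> 0}"
    then have "\<not> norm x \<ge> c + e"
      using conv_eq_0[OF w(2), where e = e and \<rho> = \<rho> and x = x] \<rho> by (auto simp: mollifier_def)
    then show "x \<in> cball 0 (c + e)" by simp
  qed
qed simp

lemma mollifier_integral:
  assumes "mollifier e \<rho>"
  shows "(LINT y|lebesgue. \<rho> (x - y)) = 1" "(LINT x|lebesgue. \<rho> (x - y)) = 1"
  using assms integral_lebesgue_reflect[of \<rho> x] integral_lebesgue_translate[of \<rho> "- y"]
  by (auto simp: mollifier_def test_fun_measurable)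

lemma mollifier_integrable: "mollifier e \<rho> \<Longrightarrow> integrable lebesgue (\<lambda>y. \<rho> (x - y))"
  using test_fun_integrable[OF test_fun_affine[of \<rho> "-1" x]] by (simp add: mollifier_def)

text \<open>Jensen's inequality for the probability density $\rho(x-\cdot)$, obtained by averaging
$2a|w(y)|\le a^2+|w(y)|^2$ with $a=|(\rho*w)(x)|$.\<close>

lemma conv_pointwise_Jensen:
  fixes w :: "real^'d::finite \<Rightarrow> complex^'m::finite"
  assumes \<rho>: "mollifier e \<rho>" and w: "integrable lebesgue w" "square_integrable w"
  shows "(norm (conv \<rho> w x))\<^sup>2 \<le> (LINT y|lebesgue. \<rho> (x - y) * (norm (w y))\<^sup>2)"
proof -
  have t: "test_fun \<rho>" "\<And>z. 0 \<le> \<rho> z" using \<rho> by (auto simp: mollifier_def)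
  define a where "a = norm (conv \<rho> w x)"
  have i1: "integrable lebesgue (\<lambda>y. \<rho> (x - y) * norm (w y))"
    using integrable_norm[OF integrable_conv[OF t(1) w(1)], of x] t(2) by simp
  have i2: "integrable lebesgue (\<lambda>y. \<rho> (x - y) * (norm (w y))\<^sup>2)"
    using integrable_conv[OF t(1), of "\<lambda>y. (norm (w y))\<^sup>2" x] w(2) by (simp add: square_integrable_def)
  have i3: "integrable lebesgue (\<lambda>y. \<rho> (x - y) * a\<^sup>2)"
    using mollifier_integrable[OF \<rho>] by simp
  have "a \<le> (LINT y|lebesgue. \<rho> (x - y) * norm (w y))"
    unfolding a_def conv_def
    using integral_norm_bound[of lebesgue "\<lambda>y. \<rho> (x - y) *\<^sub>R w y"] t(2) by simp
  then have "2 * a * a \<le> 2 * a * (LINT y|lebesgue. \<rho> (x - y) * norm (w y))"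
    by (intro mult_left_mono) (auto simp: a_def)
  also have "\<dots> = (LINT y|lebesgue. 2 * a * (\<rho> (x - y) * norm (w y)))" by simp
  also have "\<dots> \<le> (LINT y|lebesgue. \<rho> (x - y) * (norm (w y))\<^sup>2 + \<rho> (x - y) * a\<^sup>2)"
  proof (rule integral_mono)
    fix y
    have "\<rho> (x - y) * (2 * a * norm (w y)) \<le> \<rho> (x - y) * (a\<^sup>2 + (norm (w y))\<^sup>2)"
      by (intro mult_left_mono sum_squares_bound t)
    then show "2 * a * (\<rho> (x - y) * norm (w y)) \<le> \<rho> (x - y) * (norm (w y))\<^sup>2 + \<rho> (x - y) * a\<^sup>2"
      by (simp add: algebra_simps)
  qed (use i1 i2 i3 in auto)
  also have "\<dots> = (LINT y|lebesgue. \<rho> (x - y) * (norm (w y))\<^sup>2) + a\<^sup>2"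
    using i2 i3 mollifier_integral(1)[OF \<rho>] by simp
  finally show ?thesis by (simp add: a_def power2_eq_square)
qed

text \<open>Young's inequality: integrate the pointwise Jensen inequality over $x$ and exchange the integrals.\<close>

lemma conv_L2_contraction:
  fixes w :: "real^'d::finite \<Rightarrow> complex^'m::finite"
  assumes \<rho>: "mollifier e \<rho>" and w: "integrable lebesgue w" "square_integrable w"
  shows "square_integrable (conv \<rho> w)" "norm (abs_L2 (conv \<rho> w)) \<le> norm (abs_L2 w)"
proof -
  have t: "test_fun \<rho>" "\<And>z. 0 \<le> \<rho> z" using \<rho> by (auto simp: mollifier_def)
  have [measurable]: "\<rho> \<in> borel_measurable borel" by (rule test_fun_measurable[OF t(1)])
  \<comment> \<open>Tonelli's theorem is applied on the product of Borel measures, hence to a Borel representative of $|w|^2$.\<close>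
  obtain v0 where [measurable]: "v0 \<in> borel_measurable lborel" and v0: "AE y in lborel. (norm (w y))\<^sup>2 = v0 y"
    using completion_ex_borel_measurable_real[of "\<lambda>y. (norm (w y))\<^sup>2" lborel] w(2)
    by (auto simp: square_integrable_def)
  define v where "v y = \<bar>v0 y\<bar>" for y
  have [measurable]: "v \<in> borel_measurable borel" unfolding v_def by simp
  have "AE y in lborel. (norm (w y))\<^sup>2 = v y"
    using v0 by eventually_elim (metis v_def abs_power2)
  then have v: "AE y in lebesgue. (norm (w y))\<^sup>2 = v y" "\<And>y. v y \<ge> 0"
    by (auto simp: v_def intro: AE_completion)
  have ptw: "ennreal ((norm (conv \<rho> w x))\<^sup>2) \<le> (\<integral>\<^sup>+y. ennreal (\<rho> (x - y) * v y) \<partial>lborel)" for x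
  proof -
    have i2: "integrable lebesgue (\<lambda>y. \<rho> (x - y) * (norm (w y))\<^sup>2)"
      using integrable_conv[OF t(1), of "\<lambda>y. (norm (w y))\<^sup>2" x] w(2) by (simp add: square_integrable_def)
    have "ennreal ((norm (conv \<rho> w x))\<^sup>2) \<le> ennreal (LINT y|lebesgue. \<rho> (x - y) * (norm (w y))\<^sup>2)"
      by (intro ennreal_leI conv_pointwise_Jensen[OF \<rho> w])
    also have "\<dots> = (\<integral>\<^sup>+y. ennreal (\<rho> (x - y) * (norm (w y))\<^sup>2) \<partial>lebesgue)"
      by (rule nn_integral_eq_integral[symmetric, OF i2]) (use t in auto)
    also have "\<dots> = (\<integral>\<^sup>+y. ennreal (\<rho> (x - y) * v y) \<partial>lebesgue)"
      by (rule nn_integral_cong_AE) (use v(1) in eventually_elim, simp)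
    finally show ?thesis by (simp add: nn_integral_completion)
  qed
  have "(\<integral>\<^sup>+x. ennreal ((norm (conv \<rho> w x))\<^sup>2) \<partial>lebesgue) \<le> (\<integral>\<^sup>+x. \<integral>\<^sup>+y. ennreal (\<rho> (x - y) * v y) \<partial>lborel \<partial>lborel)"
    unfolding nn_integral_completion by (intro nn_integral_mono ptw)
  also have "\<dots> = (\<integral>\<^sup>+y. \<integral>\<^sup>+x. ennreal (\<rho> (x - y) * v y) \<partial>lborel \<partial>lborel)"
    by (rule lborel_pair.Fubini'[symmetric]) measurable
  also have "\<dots> = (\<integral>\<^sup>+y. ennreal (v y) \<partial>lborel)"
  proof (rule nn_integral_cong)
    fix y
    have i: "integrable lebesgue (\<lambda>x. \<rho> (x - y))"
      using test_fun_integrable[OF test_fun_affine[OF t(1), of 1 "- y"]] by simp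
    have "(\<integral>\<^sup>+x. ennreal (\<rho> (x - y)) \<partial>lborel) = (\<integral>\<^sup>+x. ennreal (\<rho> (x - y)) \<partial>lebesgue)"
      by (simp add: nn_integral_completion)
    also have "\<dots> = 1"
      using nn_integral_eq_integral[OF i] t(2) mollifier_integral(2)[OF \<rho>] by simp
    finally show "(\<integral>\<^sup>+x. ennreal (\<rho> (x - y) * v y) \<partial>lborel) = ennreal (v y)"
      by (simp add: ennreal_mult t v nn_integral_multc)
  qed
  also have "\<dots> = (\<integral>\<^sup>+y. ennreal (v y) \<partial>lebesgue)" by (simp add: nn_integral_completion)
  also have "\<dots> = (\<integral>\<^sup>+y. ennreal ((norm (w y))\<^sup>2) \<partial>lebesgue)"
    by (rule nn_integral_cong_AE) (use v(1) in eventually_elim, simp)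
  also have "\<dots> = ennreal ((norm (abs_L2 w))\<^sup>2)" by (rule nn_integral_norm_square[OF w(2)])
  finally have le: "(\<integral>\<^sup>+x. ennreal ((norm (conv \<rho> w x))\<^sup>2) \<partial>lebesgue) \<le> ennreal ((norm (abs_L2 w))\<^sup>2)" .
  show sq: "square_integrable (conv \<rho> w)"
  proof (rule square_integrable_nn_integral)
    show "conv \<rho> w \<in> borel_measurable lebesgue"
      using C_k_imp_continuous[OF C_k_conv[OF w(1) t(1)]]
      by (intro measurable_completion) (simp add: borel_measurable_continuous_onI)
    show "(\<integral>\<^sup>+x. ennreal ((norm (conv \<rho> w x))\<^sup>2) \<partial>lebesgue) < \<infinity>"
      using le by (rule le_less_trans) simp
  qed
  from le have "(norm (abs_L2 (conv \<rho> w)))\<^sup>2 \<le> (norm (abs_L2 w))\<^sup>2"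
    unfolding nn_integral_norm_square[OF sq] by (subst (asm) ennreal_le_iff) auto
  then show "norm (abs_L2 (conv \<rho> w)) \<le> norm (abs_L2 w)" by (rule power2_le_imp_le) simp
qed

lemma integrable_if_square_integrable_bounded_support:
  fixes w :: "real^'d::finite \<Rightarrow> complex^'m::finite"
  assumes w: "square_integrable w" "\<And>y. w y \<noteq> 0 \<Longrightarrow> norm y \<le> c"
  shows "integrable lebesgue w"
proof (rule Bochner_Integration.integrable_bound)
  show "integrable lebesgue (\<lambda>x. indicator (cball 0 c) x + (norm (w x))\<^sup>2)"
    using w(1) integrable_indicator_bounded[of "cball (0::real^'d) c"]
    by (intro Bochner_Integration.integrable_add) (auto simp: square_integrable_def)
  show "AE x in lebesgue. norm (w x) \<le> norm (indicator (cball 0 c) x + (norm (w x))\<^sup>2)"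
  proof (rule AE_I2)
    fix x
    have "norm (w x) \<le> 1 + (norm (w x))\<^sup>2"
      using sum_squares_bound[of 1 "norm (w x)"] norm_ge_zero[of "w x"] by (simp, linarith)
    then show "norm (w x) \<le> norm (indicator (cball 0 c) x + (norm (w x))\<^sup>2)"
      using w(2)[of x] by (cases "w x = 0") (auto simp: indicator_def)
  qed
qed (use w(1) in \<open>simp add: square_integrable_def\<close>)

text \<open>A test function is Lipschitz, so the mollification differs from it by $O(1/n)$ uniformly, and both are
supported in a fixed ball.\<close>

lemma conv_test_fun_tendsto:
  fixes \<psi> :: "real^'d::finite \<Rightarrow> complex^'m::finite"
  assumes \<rho>: "\<And>n. mollifier (1 / real (Suc n)) (\<rho> n)" and \<psi>: "test_fun \<psi>"
  shows "(\<lambda>n. abs_L2 (conv (\<rho> n) \<psi>)) \<longlonglongrightarrow> abs_L2 \<psi>"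
proof -
  obtain B where B: "B \<ge> 0" "\<And>x y. norm (\<psi> x - \<psi> y) \<le> B * norm (x - y)" using test_fun_Lipschitz[OF \<psi>] by metis
  obtain c where c: "\<And>x. \<psi> x \<noteq> 0 \<Longrightarrow> norm x \<le> c"
    using test_fun_bounded_support[OF \<psi>] unfolding bounded_iff by auto
  have i\<psi>: "integrable lebesgue \<psi>" by (rule test_fun_integrable[OF \<psi>])
  define \<mu> where "\<mu> = measure lebesgue (cball (0::real^'d) (c + 1))"
  have "norm (abs_L2 (conv (\<rho> n) \<psi>) - abs_L2 \<psi>) \<le> B * (1 / real (Suc n)) * sqrt \<mu>" for n
  proof -
    define e where "e = 1 / real (Suc n)"
    have e: "e \<le> 1" by (simp add: e_def)
    have \<rho>n: "mollifier e (\<rho> n)" using \<rho> by (simp add: e_def)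
    have ptw: "norm (conv (\<rho> n) \<psi> x - \<psi> x) \<le> B * e" for x
    proof -
      have ii: "integrable lebesgue (\<lambda>y. \<rho> n (x - y) *\<^sub>R \<psi> y)" "integrable lebesgue (\<lambda>y. \<rho> n (x - y) *\<^sub>R \<psi> x)"
        using \<rho>n mollifier_integrable[OF \<rho>n] by (auto simp: mollifier_def intro!: integrable_conv i\<psi>)
      have "conv (\<rho> n) \<psi> x - \<psi> x = (LINT y|lebesgue. \<rho> n (x - y) *\<^sub>R (\<psi> y - \<psi> x))"
        using ii mollifier_integral(1)[OF \<rho>n] mollifier_integrable[OF \<rho>n]
        by (simp add: conv_def scaleR_diff_right)
      also have "norm \<dots> \<le> (LINT y|lebesgue. norm (\<rho> n (x - y) *\<^sub>R (\<psi> y - \<psi> x)))"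
        by (rule integral_norm_bound)
      also have "\<dots> \<le> (LINT y|lebesgue. \<rho> n (x - y) * (B * e))"
      proof (rule integral_mono)
        show "integrable lebesgue (\<lambda>y. norm (\<rho> n (x - y) *\<^sub>R (\<psi> y - \<psi> x)))"
          unfolding scaleR_diff_right by (intro integrable_norm Bochner_Integration.integrable_diff ii)
        show "integrable lebesgue (\<lambda>y. \<rho> n (x - y) * (B * e))"
          using mollifier_integrable[OF \<rho>n] by simp
        fix y
        show "norm (\<rho> n (x - y) *\<^sub>R (\<psi> y - \<psi> x)) \<le> \<rho> n (x - y) * (B * e)"
        proof (cases "norm (x - y) \<ge> e")
          case True
          then show ?thesis using \<rho>n by (simp add: mollifier_def)
        next
          case False
          then have "norm (\<psi> y - \<psi> x) \<le> B * e"
            using B(2)[of y x] mult_left_mono[OF _ B(1), of "norm (x - y)" e] by (simp add: norm_minus_commute)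
          then show ?thesis using \<rho>n by (simp add: mollifier_def mult_left_mono)
        qed
      qed
      also have "\<dots> = B * e" using mollifier_integral(1)[OF \<rho>n] by simp
      finally show ?thesis .
    qed
    have supp: "conv (\<rho> n) \<psi> x - \<psi> x = 0" if "x \<notin> cball 0 (c + 1)" for x
    proof -
      have "conv (\<rho> n) \<psi> x = 0"
        by (rule conv_eq_0[OF c]) (use \<rho>n e that in \<open>auto simp: mollifier_def\<close>)
      moreover have "\<psi> x = 0" using c[of x] that by fastforce
      ultimately show ?thesis by simp
    qed
    have sq: "square_integrable (conv (\<rho> n) \<psi>)" "square_integrable \<psi>"
      using conv_L2_contraction(1)[OF \<rho>n i\<psi>] test_fun_square_integrable[OF \<psi>] by auto
    have "(norm (abs_L2 (\<lambda>x. conv (\<rho> n) \<psi> x - \<psi> x)))\<^sup>2 = (LINT x|lebesgue. (norm (conv (\<rho> n) \<psi> x - \<psi> x))\<^sup>2)"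
      by (rule norm_abs_L2[OF square_integrable_diff[OF sq]])
    also have "\<dots> \<le> (LINT x|lebesgue. (B * e)\<^sup>2 * indicator (cball (0::real^'d) (c + 1)) x)"
    proof (rule integral_mono)
      show "integrable lebesgue (\<lambda>x. (norm (conv (\<rho> n) \<psi> x - \<psi> x))\<^sup>2)"
        using square_integrable_diff[OF sq] by (simp add: square_integrable_def)
      show "integrable lebesgue (\<lambda>x::real^'d. (B * e)\<^sup>2 * indicator (cball 0 (c + 1)) x)"
        using integrable_indicator_bounded[of "cball (0::real^'d) (c + 1)"] by (intro integrable_mult_right) auto
      fix x show "(norm (conv (\<rho> n) \<psi> x - \<psi> x))\<^sup>2 \<le> (B * e)\<^sup>2 * indicator (cball 0 (c + 1)) x"
        using supp[of x] power_mono[OF ptw[of x], of 2] by (cases "x \<in> cball 0 (c + 1)") (auto simp: indicator_def)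
    qed
    also have "\<dots> = (B * e * sqrt \<mu>)\<^sup>2" by (simp add: \<mu>_def power_mult_distrib)
    finally have "norm (abs_L2 (\<lambda>x. conv (\<rho> n) \<psi> x - \<psi> x)) \<le> B * e * sqrt \<mu>"
      by (rule power2_le_imp_le) (use B(1) in \<open>auto simp: e_def \<mu>_def\<close>)
    then show ?thesis by (simp add: abs_L2_diff sq e_def)
  qed
  then have "\<forall>\<^sub>F n in sequentially. norm (abs_L2 (conv (\<rho> n) \<psi>) - abs_L2 \<psi>) \<le> B * (1 / real (Suc n)) * sqrt \<mu>"
    by (intro always_eventually allI)
  moreover have "(\<lambda>n. B * (1 / real (Suc n)) * sqrt \<mu>) \<longlonglongrightarrow> B * 0 * sqrt \<mu>"
    by (intro tendsto_intros LIMSEQ_Suc[OF lim_1_over_n])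
  then have "(\<lambda>n. B * (1 / real (Suc n)) * sqrt \<mu>) \<longlonglongrightarrow> 0" by simp
  ultimately have "(\<lambda>n. abs_L2 (conv (\<rho> n) \<psi>) - abs_L2 \<psi>) \<longlonglongrightarrow> 0"
    by (rule Lim_null_comparison)
  then show ?thesis by (rule LIM_zero_cancel)
qed

text \<open>Mollifications are uniformly bounded on $L^2$, so that convergence extends from the dense set of test
functions.\<close>

lemma conv_tendsto:
  fixes w :: "real^'d::finite \<Rightarrow> complex^'m::finite"
  assumes \<rho>: "\<And>n. mollifier (1 / real (Suc n)) (\<rho> n)"
    and w: "square_integrable w" "\<And>y. w y \<noteq> 0 \<Longrightarrow> norm y \<le> c"
  shows "(\<lambda>n. abs_L2 (conv (\<rho> n) w)) \<longlonglongrightarrow> abs_L2 w"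
proof (rule LIMSEQ_I)
  fix \<epsilon> :: real assume "\<epsilon> > 0"
  obtain \<psi> where \<psi>: "test_fun \<psi>" "norm (abs_L2 w - abs_L2 \<psi>) < \<epsilon> / 3"
    using test_funs_dense[of "\<epsilon> / 3" "abs_L2 w"] \<open>\<epsilon> > 0\<close> by auto
  note iw = integrable_if_square_integrable_bounded_support[OF w]
  note sq = w(1) test_fun_square_integrable[OF \<psi>(1)]
  note i\<psi> = test_fun_integrable[OF \<psi>(1)]
  have near: "norm (abs_L2 (conv (\<rho> n) w) - abs_L2 (conv (\<rho> n) \<psi>)) < \<epsilon> / 3" for n
  proof -
    have t: "test_fun (\<rho> n)" using \<rho> by (simp add: mollifier_def)
    have "(\<lambda>x. conv (\<rho> n) w x - conv (\<rho> n) \<psi> x) = conv (\<rho> n) (\<lambda>y. w y - \<psi> y)"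
      using integrable_conv[OF t iw] integrable_conv[OF t i\<psi>]
      by (intro ext) (simp add: conv_def scaleR_diff_right)
    then have "abs_L2 (conv (\<rho> n) w) - abs_L2 (conv (\<rho> n) \<psi>) = abs_L2 (conv (\<rho> n) (\<lambda>y. w y - \<psi> y))"
      using abs_L2_diff[OF conv_L2_contraction(1)[OF \<rho> iw sq(1), of n] conv_L2_contraction(1)[OF \<rho> i\<psi> sq(2), of n]]
      by simp
    also have "norm \<dots> \<le> norm (abs_L2 (\<lambda>y. w y - \<psi> y))"
      using conv_L2_contraction(2)[OF \<rho> Bochner_Integration.integrable_diff[OF iw i\<psi>] square_integrable_diff[OF sq]] .
    also have "\<dots> < \<epsilon> / 3" using \<psi>(2) by (simp add: abs_L2_diff[OF sq])
    finally show ?thesis .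
  qed
  obtain N where N: "\<And>n. n \<ge> N \<Longrightarrow> norm (abs_L2 (conv (\<rho> n) \<psi>) - abs_L2 \<psi>) < \<epsilon> / 3"
    using LIMSEQ_D[OF conv_test_fun_tendsto[OF \<rho> \<psi>(1)], of "\<epsilon> / 3"] \<open>\<epsilon> > 0\<close> by auto
  have "norm (abs_L2 (conv (\<rho> n) w) - abs_L2 w) < \<epsilon>" if "n \<ge> N" for n
    using near[of n] N[OF that] \<psi>(2)
      norm_triangle_ineq[of "abs_L2 (conv (\<rho> n) w) - abs_L2 (conv (\<rho> n) \<psi>)" "abs_L2 (conv (\<rho> n) \<psi>) - abs_L2 \<psi>"]
      norm_triangle_ineq[of "abs_L2 (conv (\<rho> n) w) - abs_L2 \<psi>" "abs_L2 \<psi> - abs_L2 w"]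
    by (simp add: norm_minus_commute)
  then show "\<exists>no. \<forall>n\<ge>no. norm (abs_L2 (conv (\<rho> n) w) - abs_L2 w) < \<epsilon>" by blast
qed

section \<open>Multiplication operators\<close>

text \<open>Multiplication by an entry of $Q$ is the case $L=\mathrm{id}$; for an entry of $V$, cut off to a ball,
$L$ moves one component of a vector to another place.\<close>

lemma square_integrable_mult_linear:
  fixes f :: "real^'d::finite \<Rightarrow> complex^'m::finite" and L :: "complex^'m \<Rightarrow> complex^'m"
  assumes q: "q \<in> borel_measurable lebesgue" "AE x in lebesgue. \<bar>q x\<bar> \<le> C" and L: "bounded_linear L"
    and f: "square_integrable f"
  shows "square_integrable (\<lambda>x. q x *\<^sub>R L (f x))"
    and "norm (abs_L2 (\<lambda>x. q x *\<^sub>R L (f x))) \<le> \<bar>C\<bar> * onorm L * norm (abs_L2 f)"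
proof -
  let ?K = "\<bar>C\<bar> * onorm L"
  have [measurable]: "f \<in> borel_measurable lebesgue" "q \<in> borel_measurable lebesgue"
    using f q by (auto simp: square_integrable_def)
  have "(\<lambda>x. L (f x)) \<in> borel_measurable lebesgue"
    by (rule borel_measurable_continuous_on[OF linear_continuous_on[OF L]]) simp
  then have m [measurable]: "(\<lambda>x. q x *\<^sub>R L (f x)) \<in> borel_measurable lebesgue" by simp
  have bound: "AE x in lebesgue. (norm (q x *\<^sub>R L (f x)))\<^sup>2 \<le> ?K\<^sup>2 * (norm (f x))\<^sup>2"
    using q(2)
  proof eventually_elim
    case (elim x)
    have "\<bar>q x\<bar> * norm (L (f x)) \<le> \<bar>C\<bar> * (onorm L * norm (f x))"
      using elim by (intro mult_mono onorm[OF L]) auto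
    then have "norm (q x *\<^sub>R L (f x)) \<le> ?K * norm (f x)" by (simp add: mult.assoc)
    then show ?case by (metis norm_ge_zero power_mono power_mult_distrib)
  qed
  have i: "integrable lebesgue (\<lambda>x. ?K\<^sup>2 * (norm (f x))\<^sup>2)"
    using f by (simp add: square_integrable_def)
  show sq: "square_integrable (\<lambda>x. q x *\<^sub>R L (f x))"
    unfolding square_integrable_def
  proof (intro conjI m Bochner_Integration.integrable_bound[OF i])
    show "AE x in lebesgue. norm ((norm (q x *\<^sub>R L (f x)))\<^sup>2) \<le> norm (?K\<^sup>2 * (norm (f x))\<^sup>2)"
      using bound by eventually_elim (simp add: abs_mult)
  qed measurable
  have "(norm (abs_L2 (\<lambda>x. q x *\<^sub>R L (f x))))\<^sup>2 \<le> (LINT x|lebesgue. ?K\<^sup>2 * (norm (f x))\<^sup>2)"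
    unfolding norm_abs_L2[OF sq] using sq i bound
    by (intro integral_mono_AE) (auto simp: square_integrable_def)
  also have "\<dots> = (?K * norm (abs_L2 f))\<^sup>2" by (simp add: norm_abs_L2[OF f] power_mult_distrib)
  finally show "norm (abs_L2 (\<lambda>x. q x *\<^sub>R L (f x))) \<le> ?K * norm (abs_L2 f)"
    by (rule power2_le_imp_le) (simp add: onorm_pos_le[OF L])
qed

lemma mult_linear_tendsto:
  fixes f :: "nat \<Rightarrow> real^'d::finite \<Rightarrow> complex^'m::finite" and L :: "complex^'m \<Rightarrow> complex^'m"
  assumes q: "q \<in> borel_measurable lebesgue" "AE x in lebesgue. \<bar>q x\<bar> \<le> C" and L: "bounded_linear L"
    and f: "\<And>n. square_integrable (f n)" "square_integrable g" "(\<lambda>n. abs_L2 (f n)) \<longlonglongrightarrow> abs_L2 g"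
  shows "(\<lambda>n. abs_L2 (\<lambda>x. q x *\<^sub>R L (f n x))) \<longlonglongrightarrow> abs_L2 (\<lambda>x. q x *\<^sub>R L (g x))"
proof -
  have "norm (abs_L2 (\<lambda>x. q x *\<^sub>R L (f n x)) - abs_L2 (\<lambda>x. q x *\<^sub>R L (g x)))
      \<le> \<bar>C\<bar> * onorm L * norm (abs_L2 (f n) - abs_L2 g)" for n
  proof -
    have "(\<lambda>x. q x *\<^sub>R L (f n x) - q x *\<^sub>R L (g x)) = (\<lambda>x. q x *\<^sub>R L (f n x - g x))"
      by (simp add: linear_simps(2)[OF L] scaleR_diff_right)
    then have "abs_L2 (\<lambda>x. q x *\<^sub>R L (f n x)) - abs_L2 (\<lambda>x. q x *\<^sub>R L (g x)) = abs_L2 (\<lambda>x. q x *\<^sub>R L (f n x - g x))"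
      by (simp add: abs_L2_diff[symmetric] square_integrable_mult_linear(1)[OF q L] f)
    then show ?thesis
      using square_integrable_mult_linear(2)[OF q L square_integrable_diff[OF f(1)[of n] f(2)]]
      by (simp add: abs_L2_diff f)
  qed
  then have "\<forall>\<^sub>F n in sequentially. norm (abs_L2 (\<lambda>x. q x *\<^sub>R L (f n x)) - abs_L2 (\<lambda>x. q x *\<^sub>R L (g x)))
      \<le> \<bar>C\<bar> * onorm L * norm (abs_L2 (f n) - abs_L2 g)" by (intro always_eventually allI)
  moreover have "(\<lambda>n. \<bar>C\<bar> * onorm L * norm (abs_L2 (f n) - abs_L2 g)) \<longlonglongrightarrow> 0"
    using f(3) by (intro tendsto_mult_right_zero tendsto_norm_zero LIM_zero)
  ultimately show ?thesis by (rule LIM_zero_cancel[OF Lim_null_comparison])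
qed

lemma square_integrable_sum:
  assumes "\<And>i. i \<in> I \<Longrightarrow> square_integrable (f i)"
  shows "square_integrable (\<lambda>x. \<Sum>i\<in>I. f i x)"
  using assms
  by (induction I rule: infinite_finite_induct) (auto intro: square_integrable_add square_integrable_0)

lemma abs_L2_sum:
  assumes "\<And>i. i \<in> I \<Longrightarrow> square_integrable (f i)"
  shows "abs_L2 (\<lambda>x. \<Sum>i\<in>I. f i x) = (\<Sum>i\<in>I. abs_L2 (f i))"
  using assms
  by (induction I rule: infinite_finite_induct)
    (auto simp: abs_L2_add square_integrable_sum zero_L2_def)

section \<open>The coefficients\<close>

text \<open>A real matrix acting on complex vectors, as a sum of the operators just considered, one for each entry.\<close>

definition matrix_apply :: "real^'m^'m \<Rightarrow> complex^'m \<Rightarrow> complex^'m::finite"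
  where "matrix_apply M z = (\<Sum>i\<in>UNIV. \<Sum>j\<in>UNIV. M $ i $ j *\<^sub>R axis i (z $ j))"

lemma complex_matrix_mult: "complex_matrix M *v z = matrix_apply M z"
proof (subst vec_eq_iff, rule allI)
  fix k
  have "matrix_apply M z $ k = (\<Sum>i\<in>UNIV. if i = k then (\<Sum>j\<in>UNIV. M $ i $ j *\<^sub>R z $ j) else 0)"
    unfolding matrix_apply_def sum_component by (intro sum.cong refl) (auto simp: axis_def)
  then show "(complex_matrix M *v z) $ k = matrix_apply M z $ k"
    by (simp add: complex_matrix_def matrix_vector_mult_def scaleR_conv_of_real)
qed

lemma inner_matrix_apply: "matrix_apply M z \<bullet> w = z \<bullet> matrix_apply (transpose M) w"
proof -
  have 1: "axis i a \<bullet> (w :: complex^'m) = a \<bullet> w $ i" for i a and w :: "complex^'m" by (rule inner_axis')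
  have "matrix_apply M z \<bullet> w = (\<Sum>i\<in>UNIV. \<Sum>j\<in>UNIV. M $ i $ j * (z $ j \<bullet> w $ i))"
    by (simp add: matrix_apply_def inner_sum_left 1)
  also have "\<dots> = (\<Sum>j\<in>UNIV. \<Sum>i\<in>UNIV. M $ i $ j * (z $ j \<bullet> w $ i))" by (rule sum.swap)
  also have "\<dots> = z \<bullet> matrix_apply (transpose M) w"
    by (simp add: matrix_apply_def inner_sum_right inner_axis transpose_def)
  finally show ?thesis .
qed

lemma Re_hermitian_inner: "Re (hermitian_inner z w) = z \<bullet> w"
  by (simp add: hermitian_inner_def inner_vec_def inner_complex_def)

text \<open>Ellipticity on $\mathbb{R}^d$ passes to families of vectors by applying it to their coordinates with
respect to an orthonormal basis. In this way the complex components of a gradient are treated at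
once.\<close>

lemma quadratic_form_lower_bound:
  fixes a :: "'d::finite \<Rightarrow> 'b::euclidean_space" and M :: "real^'d^'d"
  assumes "\<And>\<xi>. \<eta> * (norm \<xi>)\<^sup>2 \<le> (M *v \<xi>) \<bullet> \<xi>"
  shows "\<eta> * (\<Sum>k\<in>UNIV. (norm (a k))\<^sup>2) \<le> (\<Sum>k\<in>UNIV. a k \<bullet> (\<Sum>j\<in>UNIV. M $ j $ k *\<^sub>R a j))"
proof -
  have "\<eta> * (\<Sum>k\<in>UNIV. (a k \<bullet> e) * (a k \<bullet> e)) \<le> (\<Sum>k\<in>UNIV. \<Sum>j\<in>UNIV. M $ j $ k * ((a k \<bullet> e) * (a j \<bullet> e)))" for e
  proof -
    define \<xi> :: "real^'d" where "\<xi> = (\<chi> k. a k \<bullet> e)"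
    have "(M *v \<xi>) \<bullet> \<xi> = (\<Sum>j\<in>UNIV. \<Sum>k\<in>UNIV. M $ j $ k * ((a k \<bullet> e) * (a j \<bullet> e)))"
      by (simp add: \<xi>_def inner_vec_def matrix_vector_mult_def sum_distrib_right mult.assoc)
    also have "\<dots> = (\<Sum>k\<in>UNIV. \<Sum>j\<in>UNIV. M $ j $ k * ((a k \<bullet> e) * (a j \<bullet> e)))" by (rule sum.swap)
    finally show ?thesis
      using assms[of \<xi>] by (simp add: \<xi>_def power2_norm_eq_inner inner_vec_def)
  qed
  then have "(\<Sum>e\<in>Basis. \<eta> * (\<Sum>k\<in>UNIV. (a k \<bullet> e) * (a k \<bullet> e)))
      \<le> (\<Sum>e\<in>Basis. \<Sum>k\<in>UNIV. \<Sum>j\<in>UNIV. M $ j $ k * ((a k \<bullet> e) * (a j \<bullet> e)))"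
    by (intro sum_mono)
  moreover have "(\<Sum>e\<in>Basis. \<eta> * (\<Sum>k\<in>UNIV. (a k \<bullet> e) * (a k \<bullet> e))) = \<eta> * (\<Sum>k\<in>UNIV. (norm (a k))\<^sup>2)"
    unfolding power2_norm_eq_inner euclidean_inner[of "a k" "a k" for k]
    by (simp add: sum_distrib_left) (rule sum.swap)
  moreover have "(\<Sum>e\<in>Basis. \<Sum>k\<in>UNIV. \<Sum>j\<in>UNIV. M $ j $ k * ((a k \<bullet> e) * (a j \<bullet> e)))
      = (\<Sum>k\<in>UNIV. a k \<bullet> (\<Sum>j\<in>UNIV. M $ j $ k *\<^sub>R a j))"
  proof -
    have "(\<Sum>e\<in>Basis. \<Sum>k\<in>UNIV. \<Sum>j\<in>UNIV. M $ j $ k * ((a k \<bullet> e) * (a j \<bullet> e)))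
        = (\<Sum>k\<in>UNIV. \<Sum>e\<in>Basis. \<Sum>j\<in>UNIV. M $ j $ k * ((a k \<bullet> e) * (a j \<bullet> e)))" by (rule sum.swap)
    also have "\<dots> = (\<Sum>k\<in>UNIV. \<Sum>j\<in>UNIV. \<Sum>e\<in>Basis. M $ j $ k * ((a k \<bullet> e) * (a j \<bullet> e)))"
      by (intro sum.cong refl sum.swap)
    also have "\<dots> = (\<Sum>k\<in>UNIV. a k \<bullet> (\<Sum>j\<in>UNIV. M $ j $ k *\<^sub>R a j))"
    proof (intro sum.cong refl)
      fix k
      have "(\<Sum>e\<in>Basis. c * ((a k \<bullet> e) * (a j \<bullet> e))) = c * (a k \<bullet> a j)" for c j
        by (subst euclidean_inner[of "a k" "a j"]) (rule sum_distrib_left[symmetric])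
      then show "(\<Sum>j\<in>UNIV. \<Sum>e\<in>Basis. M $ j $ k * ((a k \<bullet> e) * (a j \<bullet> e)))
          = a k \<bullet> (\<Sum>j\<in>UNIV. M $ j $ k *\<^sub>R a j)"
        by (simp add: inner_sum_right)
    qed
    finally show ?thesis .
  qed
  ultimately show ?thesis by simp
qed

text \<open>The field $Q^{T}g$, for a field $g$ with components $g_j$.\<close>

definition Q_grad :: "(real^'d::finite \<Rightarrow> real^'d^'d) \<Rightarrow> ('d \<Rightarrow> real^'d \<Rightarrow> complex^'m) \<Rightarrow> 'd \<Rightarrow> real^'d \<Rightarrow> complex^'m::finite"
  where "Q_grad Q g k x = (\<Sum>j\<in>UNIV. Q x $ j $ k *\<^sub>R g j x)"

definition V_adj :: "(real^'d::finite \<Rightarrow> real^'m^'m) \<Rightarrow> (real^'d \<Rightarrow> complex^'m) \<Rightarrow> real^'d \<Rightarrow> complex^'m::finite"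
  where "V_adj V \<psi> x = matrix_apply (transpose (V x)) (\<psi> x)"

lemma matrix_apply_linear:
  "matrix_apply M (z + w) = matrix_apply M z + matrix_apply M w"
  "matrix_apply M (r *\<^sub>R z) = r *\<^sub>R matrix_apply M z"
  "matrix_apply M (c *s z) = c *s matrix_apply M z"
  unfolding complex_matrix_mult[symmetric]
  by (simp_all add: vec_eq_iff matrix_vector_mult_def sum.distrib sum_distrib_left scaleR_sum_right algebra_simps)

lemma V_adj_linear:
  "V_adj V (\<lambda>x. f x + g x) x = V_adj V f x + V_adj V g x"
  "V_adj V (\<lambda>x. q x *\<^sub>R f x) x = q x *\<^sub>R V_adj V f x"
  "V_adj V (\<lambda>x. c *s f x) x = c *s V_adj V f x"
  by (simp_all add: V_adj_def matrix_apply_linear)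

lemma bounded_linear_axis_nth: "bounded_linear (\<lambda>z :: complex^'m::finite. axis i (z $ j))"
proof -
  have "linear (\<lambda>z :: complex^'m. axis i (z $ j))"
    by (rule linearI) (auto simp: vec_eq_iff axis_def)
  then show ?thesis by (simp add: linear_conv_bounded_linear)
qed

context
  fixes Q :: "(real^'d::finite) \<Rightarrow> real^'d^'d" 
  assumes Q: "diffusion_matrix Q"
begin

lemma Q_elliptic: obtains \<eta> where "\<eta> > 0" "\<And>x \<xi>. \<eta> * (norm \<xi>)\<^sup>2 \<le> (Q x *v \<xi>) \<bullet> \<xi>"
  using Q unfolding diffusion_matrix_def by blast

lemma Q_bounded: obtains C where "\<And>x. \<bar>Q x $ i $ j\<bar> \<le> C"
  using Q unfolding diffusion_matrix_def bounded_iff by (metis rangeI real_norm_def)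

lemma Q_measurable: "(\<lambda>x. Q x $ i $ j) \<in> borel_measurable lebesgue"
proof -
  have "C_k 1 (\<lambda>x. Q x $ i $ j)" using Q unfolding diffusion_matrix_def by blast
  then have "continuous_on UNIV (\<lambda>x. Q x $ i $ j)" by (rule C_k_imp_continuous)
  then show ?thesis by (intro measurable_completion) (simp add: borel_measurable_continuous_onI)
qed

lemma Q_mult_square_integrable:
  fixes f :: "real^'d \<Rightarrow> complex^'m::finite"
  assumes f: "square_integrable f"
  shows "square_integrable (\<lambda>x. Q x $ i $ j *\<^sub>R f x)"
proof -
  obtain C where "\<And>x. \<bar>Q x $ i $ j\<bar> \<le> C" using Q_bounded[of i j] by blast
  then show ?thesis
    using square_integrable_mult_linear(1)[OF Q_measurable[of i j] _ bounded_linear_ident f, of C] by simp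
qed

lemma Q_grad_square_integrable:
  assumes "\<And>j. square_integrable (g j)"
  shows "square_integrable (Q_grad Q g k)"
  unfolding Q_grad_def[abs_def] by (intro square_integrable_sum Q_mult_square_integrable assms)

lemma abs_L2_Q_grad:
  assumes "\<And>j. square_integrable (g j)"
  shows "abs_L2 (Q_grad Q g k) = (\<Sum>j\<in>UNIV. abs_L2 (\<lambda>x. Q x $ j $ k *\<^sub>R g j x))"
  unfolding Q_grad_def[abs_def] by (intro abs_L2_sum Q_mult_square_integrable assms)

lemma Q_grad_tendsto:
  fixes f :: "nat \<Rightarrow> 'd \<Rightarrow> real^'d \<Rightarrow> complex^'m::finite"
  assumes f: "\<And>n j. square_integrable (f n j)" "\<And>j. square_integrable (g j)"
    "\<And>j. (\<lambda>n. abs_L2 (f n j)) \<longlonglongrightarrow> abs_L2 (g j)"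
  shows "(\<lambda>n. abs_L2 (Q_grad Q (f n) k)) \<longlonglongrightarrow> abs_L2 (Q_grad Q g k)"
proof -
  have "(\<lambda>n. abs_L2 (\<lambda>x. Q x $ j $ k *\<^sub>R f n j x)) \<longlonglongrightarrow> abs_L2 (\<lambda>x. Q x $ j $ k *\<^sub>R g j x)" for j
  proof -
    obtain C where "\<And>x. \<bar>Q x $ j $ k\<bar> \<le> C" using Q_bounded[of j k] by blast
    then show ?thesis
      using mult_linear_tendsto[OF Q_measurable[of j k] _ bounded_linear_ident f(1)[of _ j] f(2)[of j] f(3)[of j], of C]
      by simp
  qed
  then show ?thesis unfolding abs_L2_Q_grad[OF f(1)] abs_L2_Q_grad[OF f(2)] by (intro tendsto_sum)
qed

end

context
  fixes V :: "(real^'d::finite) \<Rightarrow> real^'m^'m::finite"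
  assumes V: "accretive_potential V"
begin

text \<open>Local boundedness of $V$ is used only through these truncated entries: functions supported in a
common ball do not see the truncation (\<open>V_adj_cutoff\<close>).\<close>

lemma V_cutoff:
  obtains C where "(\<lambda>x. indicator (cball 0 c) x * V x $ i $ j) \<in> borel_measurable lebesgue"
    "AE x in lebesgue. \<bar>indicator (cball 0 c) x * V x $ i $ j\<bar> \<le> C"
proof -
  have Vij: "Linf_loc (\<lambda>x. V x $ i $ j)" using V unfolding accretive_potential_def by blast
  then obtain C where C: "AE x in lebesgue. x \<in> cball 0 c \<longrightarrow> \<bar>V x $ i $ j\<bar> \<le> C"
    unfolding Linf_loc_def using compact_cball by blast
  from C have "AE x in lebesgue. \<bar>indicator (cball 0 c) x * V x $ i $ j\<bar> \<le> \<bar>C\<bar>"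
    by eventually_elim (auto simp: indicator_def abs_mult)
  moreover have "(\<lambda>x. indicator (cball 0 c) x * V x $ i $ j) \<in> borel_measurable lebesgue"
    using Vij unfolding Linf_loc_def
    by (intro borel_measurable_times borel_measurable_indicator) auto
  ultimately show thesis using that by blast
qed

lemma V_cutoff_square_integrable:
  fixes f :: "real^'d \<Rightarrow> complex^'m" and i' j' :: 'm
  assumes "square_integrable f"
  shows "square_integrable (\<lambda>x. (indicator (cball 0 c) x * V x $ i $ j) *\<^sub>R axis i' (f x $ j'))"
proof -
  obtain C where "(\<lambda>x. indicator (cball 0 c) x * V x $ i $ j) \<in> borel_measurable lebesgue"
    "AE x in lebesgue. \<bar>indicator (cball 0 c) x * V x $ i $ j\<bar> \<le> C" using V_cutoff[of c i j] by blast
  then show ?thesis by (rule square_integrable_mult_linear(1)[where L = "\<lambda>z. axis i' (z $ j')", OF _ _ bounded_linear_axis_nth assms])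
qed

lemma V_adj_cutoff:
  assumes "\<And>x. f x \<noteq> 0 \<Longrightarrow> norm x \<le> c"
  shows "V_adj V f = (\<lambda>x. \<Sum>i\<in>UNIV. \<Sum>j\<in>UNIV. (indicator (cball 0 c) x * V x $ j $ i) *\<^sub>R axis i (f x $ j))"
proof
  fix x
  have 0: "axis i (0::complex) = 0" for i :: 'm by (simp add: vec_eq_iff axis_def)
  show "V_adj V f x = (\<Sum>i\<in>UNIV. \<Sum>j\<in>UNIV. (indicator (cball 0 c) x * V x $ j $ i) *\<^sub>R axis i (f x $ j))"
    using assms[of x]
    by (cases "f x = 0") (auto simp: V_adj_def matrix_apply_def transpose_def indicator_def 0)
qed

lemma V_adj_square_integrable:
  assumes "square_integrable f" "\<And>x. f x \<noteq> 0 \<Longrightarrow> norm x \<le> c"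
  shows "square_integrable (V_adj V f)"
  by (subst V_adj_cutoff[where f = f and c = c, OF assms(2)], assumption)
    (intro square_integrable_sum V_cutoff_square_integrable assms(1))

lemma V_adj_tendsto:
  assumes f: "\<And>n. square_integrable (f n)" "square_integrable g" "(\<lambda>n. abs_L2 (f n)) \<longlonglongrightarrow> abs_L2 g"
    and supp: "\<And>n x. f n x \<noteq> 0 \<Longrightarrow> norm x \<le> c" "\<And>x. g x \<noteq> 0 \<Longrightarrow> norm x \<le> c"
  shows "(\<lambda>n. abs_L2 (V_adj V (f n))) \<longlonglongrightarrow> abs_L2 (V_adj V g)"
proof -
  have "(\<lambda>n. abs_L2 (\<lambda>x. (indicator (cball 0 c) x * V x $ i $ j) *\<^sub>R axis j (f n x $ i)))
      \<longlonglongrightarrow> abs_L2 (\<lambda>x. (indicator (cball 0 c) x * V x $ i $ j) *\<^sub>R axis j (g x $ i))" for i j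
  proof -
    obtain C where "(\<lambda>x. indicator (cball 0 c) x * V x $ i $ j) \<in> borel_measurable lebesgue"
      "AE x in lebesgue. \<bar>indicator (cball 0 c) x * V x $ i $ j\<bar> \<le> C" using V_cutoff[of c i j] by blast
    then show ?thesis by (rule mult_linear_tendsto[where L = "\<lambda>z. axis j (z $ i)", OF _ _ bounded_linear_axis_nth f])
  qed
  then have "(\<lambda>n. \<Sum>i\<in>UNIV. \<Sum>j\<in>UNIV. abs_L2 (\<lambda>x. (indicator (cball 0 c) x * V x $ j $ i) *\<^sub>R axis i (f n x $ j)))
      \<longlonglongrightarrow> (\<Sum>i\<in>UNIV. \<Sum>j\<in>UNIV. abs_L2 (\<lambda>x. (indicator (cball 0 c) x * V x $ j $ i) *\<^sub>R axis i (g x $ j)))"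
    by (intro tendsto_sum)
  moreover have "V_adj V (f n) = (\<lambda>x. \<Sum>i\<in>UNIV. \<Sum>j\<in>UNIV. (indicator (cball 0 c) x * V x $ j $ i) *\<^sub>R axis i (f n x $ j))" for n
    by (rule V_adj_cutoff) (rule supp(1))
  moreover have "V_adj V g = (\<lambda>x. \<Sum>i\<in>UNIV. \<Sum>j\<in>UNIV. (indicator (cball 0 c) x * V x $ j $ i) *\<^sub>R axis i (g x $ j))"
    by (rule V_adj_cutoff) (rule supp(2))
  ultimately show ?thesis
    by (simp add: abs_L2_sum square_integrable_sum V_cutoff_square_integrable f)
qed

lemma V_adj_accretive: "f x \<bullet> V_adj V f x \<ge> 0"
proof -
  have "0 \<le> Re (hermitian_inner (complex_matrix (V x) *v f x) (f x))"
    using V unfolding accretive_potential_def by blast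
  then show ?thesis
    by (simp add: Re_hermitian_inner complex_matrix_mult inner_matrix_apply V_adj_def)
qed

end

section \<open>The weak formulation\<close>

text \<open>The real part of the Hermitian pairing of a vector of distributions with a vector-valued function.
For functions in $L^2$ it is their real inner product.\<close>

definition pairing :: "('m::finite \<Rightarrow> 'd::finite distribution) \<Rightarrow> (real^'d \<Rightarrow> complex^'m) \<Rightarrow> real"
  where "pairing S \<psi> = (\<Sum>i\<in>UNIV. Re (S i (\<lambda>x. cnj (\<psi> x $ i))))"

text \<open>The part of linearity that allows a complex equation to be recovered from real parts.\<close>

definition homogeneous :: "'d::finite distribution \<Rightarrow> bool"
  where "homogeneous S \<longleftrightarrow> (\<forall>\<phi>\<in>test_functions. \<forall>c. S (\<lambda>x. c * \<phi> x) = c * S \<phi>)"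

lemma homogeneousD: "homogeneous S \<Longrightarrow> test_fun \<phi> \<Longrightarrow> S (\<lambda>x. c * \<phi> x) = c * S \<phi>"
  by (simp add: homogeneous_def test_functions_iff)

lemma test_fun_cnj_component:
  fixes \<psi> :: "real^'d::finite \<Rightarrow> complex^'m::finite"
  assumes "test_fun \<psi>"
  shows "test_fun (\<lambda>x. cnj (\<psi> x $ i))"
    and "partial_deriv k (\<lambda>x. cnj (\<psi> x $ i)) = (\<lambda>x. cnj (partial_deriv k \<psi> x $ i))"
proof -
  have L: "bounded_linear (\<lambda>z :: complex^'m. cnj (z $ i))"
    by (rule bounded_linear_compose[OF bounded_linear_cnj bounded_linear_vec_nth])
  show "test_fun (\<lambda>x. cnj (\<psi> x $ i))" by (rule test_fun_linear[OF L assms])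
  show "partial_deriv k (\<lambda>x. cnj (\<psi> x $ i)) = (\<lambda>x. cnj (partial_deriv k \<psi> x $ i))"
    by (intro ext partial_deriv_linear[OF L] test_fun_differentiable assms)
qed

text \<open>Test functions supported in one component recover the individual distributions, and multiplication by
$-i$ recovers imaginary parts from real parts.\<close>

lemma distr_eq_iff_pairing:
  fixes S R :: "'m::finite \<Rightarrow> 'd::finite distribution"
  assumes S: "\<And>i. homogeneous (S i)" and R: "\<And>i. homogeneous (R i)"
  shows "(\<forall>i. distr_eq (S i) (R i)) \<longleftrightarrow> (\<forall>\<psi>. test_fun \<psi> \<longrightarrow> pairing S \<psi> = pairing R \<psi>)"
proof (intro iffI allI impI)
  fix \<psi> :: "real^'d \<Rightarrow> complex^'m" assume "\<forall>i. distr_eq (S i) (R i)" "test_fun \<psi>"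
  then show "pairing S \<psi> = pairing R \<psi>"
    unfolding pairing_def distr_eq_def test_functions_iff Ball_def
    by (intro sum.cong refl) (simp add: test_fun_cnj_component)
next
  fix i assume eq: "\<forall>\<psi>. test_fun \<psi> \<longrightarrow> pairing S \<psi> = pairing R \<psi>"
  show "distr_eq (S i) (R i)"
    unfolding distr_eq_def test_functions_iff Ball_def
  proof (intro allI impI)
    fix \<phi> :: "real^'d \<Rightarrow> complex" assume \<phi>: "test_fun \<phi>"
    have "Re (c * S i \<phi>) = Re (c * R i \<phi>)" for c
    proof -
      let ?\<psi> = "\<lambda>x. axis i (cnj (c * \<phi> x)) :: complex^'m"
      have "linear (\<lambda>z. axis i (cnj (c * z)) :: complex^'m)"
        by (rule linearI) (auto simp: vec_eq_iff axis_def algebra_simps)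
      then have \<psi>: "test_fun ?\<psi>" by (intro test_fun_linear[OF _ \<phi>]) (simp add: linear_conv_bounded_linear)
      have "pairing T ?\<psi> = Re (c * T i \<phi>)" if T: "\<And>j. homogeneous (T j)" for T
      proof -
        have "Re (T j (\<lambda>x. cnj (?\<psi> x $ j))) = (if j = i then Re (c * T i \<phi>) else 0)" for j
          using homogeneousD[OF T \<phi>, of i c] homogeneousD[OF T \<phi>, of j 0]
          by (cases "j = i") (auto simp: axis_def)
        then show ?thesis by (simp add: pairing_def)
      qed
      with eq \<psi> S R show ?thesis by metis
    qed
    from this[of 1] this[of "- \<i>"] show "S i \<phi> = R i \<phi>" by (simp add: complex_eq_iff)
  qed
qed

lemma homogeneous_regular: "homogeneous (regular_distr f)"
  by (simp add: homogeneous_def regular_distr_def mult.left_commute)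

lemma homogeneous_deriv:
  fixes S :: "'d::finite distribution" and k :: 'd
  assumes "homogeneous S"
  shows "homogeneous (distr_deriv k S)"
  unfolding homogeneous_def
proof (intro ballI allI)
  fix \<phi> :: "real^'d \<Rightarrow> complex" and c assume "\<phi> \<in> test_functions"
  then have \<phi>: "test_fun \<phi>" by (simp add: test_functions_iff)
  have "partial_deriv k (\<lambda>x. c * \<phi> x) = (\<lambda>x. c * partial_deriv k \<phi> x)"
    by (intro ext partial_deriv_linear bounded_linear_mult_right test_fun_differentiable \<phi>)
  then show "distr_deriv k S (\<lambda>x. c * \<phi> x) = c * distr_deriv k S \<phi>"
    by (simp add: distr_deriv_def homogeneousD[OF assms test_fun_partial_deriv[OF \<phi>]])
qed

lemma pairing_deriv:
  assumes "test_fun \<psi>"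
  shows "pairing (\<lambda>i. distr_deriv k (S i)) \<psi> = - pairing S (partial_deriv k \<psi>)"
  by (simp add: pairing_def distr_deriv_def test_fun_cnj_component[OF assms] sum_negf)

lemma pairing_regular:
  fixes w \<psi> :: "real^'d::finite \<Rightarrow> complex^'m::finite"
  assumes w: "square_integrable w" and \<psi>: "square_integrable \<psi>"
  shows "pairing (\<lambda>i. regular_distr (\<lambda>x. w x $ i)) \<psi> = (LINT x|lebesgue. w x \<bullet> \<psi> x)"
proof -
  have i: "integrable lebesgue (\<lambda>x. w x $ i * cnj (\<psi> x $ i))" for i
  proof (rule Bochner_Integration.integrable_bound)
    show "integrable lebesgue (\<lambda>x. (norm (w x))\<^sup>2 + (norm (\<psi> x))\<^sup>2)"
      using w \<psi> by (auto simp: square_integrable_def)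
    have nth: "(\<lambda>x. f x $ i) \<in> borel_measurable lebesgue" if "square_integrable f" for f :: "real^'d \<Rightarrow> complex^'m"
      using that by (intro borel_measurable_continuous_on[of "\<lambda>z. z $ i"] continuous_intros)
        (auto simp: square_integrable_def)
    have "(\<lambda>x. cnj (\<psi> x $ i)) \<in> borel_measurable lebesgue"
      by (intro borel_measurable_continuous_on[of cnj] continuous_intros nth \<psi>)
    then show "(\<lambda>x. w x $ i * cnj (\<psi> x $ i)) \<in> borel_measurable lebesgue"
      using nth[OF w] by simp
    show "AE x in lebesgue. norm (w x $ i * cnj (\<psi> x $ i)) \<le> norm ((norm (w x))\<^sup>2 + (norm (\<psi> x))\<^sup>2)"
    proof (rule AE_I2)
      fix x
      have "norm (w x $ i) * norm (\<psi> x $ i) \<le> norm (w x) * norm (\<psi> x)"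
        by (intro mult_mono Finite_Cartesian_Product.norm_nth_le) auto
      also have "\<dots> \<le> 2 * norm (w x) * norm (\<psi> x)" by simp
      also have "\<dots> \<le> (norm (w x))\<^sup>2 + (norm (\<psi> x))\<^sup>2" by (rule sum_squares_bound)
      finally show "norm (w x $ i * cnj (\<psi> x $ i)) \<le> norm ((norm (w x))\<^sup>2 + (norm (\<psi> x))\<^sup>2)"
        by (simp add: norm_mult)
    qed
  qed
  have "pairing (\<lambda>i. regular_distr (\<lambda>x. w x $ i)) \<psi> = (\<Sum>i\<in>UNIV. LINT x|lebesgue. Re (w x $ i * cnj (\<psi> x $ i)))"
    unfolding pairing_def regular_distr_def
    by (intro sum.cong refl integral_bounded_linear[OF bounded_linear_Re i, symmetric])
  also have "\<dots> = (LINT x|lebesgue. (\<Sum>i\<in>UNIV. Re (w x $ i * cnj (\<psi> x $ i))))"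
    by (intro Bochner_Integration.integral_sum[symmetric] integrable_bounded_linear[OF bounded_linear_Re i])
  also have "\<dots> = (LINT x|lebesgue. w x \<bullet> \<psi> x)"
    by (simp add: inner_vec_def inner_complex_def)
  finally show ?thesis .
qed

lemma pairing_component:
  assumes "square_integrable \<psi>"
  shows "pairing (\<lambda>i. regular_distr (component u i)) \<psi> = u \<bullet> abs_L2 \<psi>"
  unfolding component_def[abs_def]
  using pairing_regular[OF square_integrable_rep_L2 assms] inner_abs_L2_right[OF assms] by simp

lemma has_weak_deriv_iff:
  "has_weak_deriv k u g \<longleftrightarrow>
    (\<forall>\<psi>. test_fun \<psi> \<longrightarrow> u \<bullet> abs_L2 (partial_deriv k \<psi>) + g \<bullet> abs_L2 \<psi> = 0)"
proof -
  have "has_weak_deriv k u g \<longleftrightarrow> (\<forall>\<psi>. test_fun \<psi> \<longrightarrow>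
      pairing (\<lambda>i. distr_deriv k (regular_distr (component u i))) \<psi> = pairing (\<lambda>i. regular_distr (component g i)) \<psi>)"
    unfolding has_weak_deriv_def by (intro distr_eq_iff_pairing homogeneous_deriv homogeneous_regular)
  also have "\<dots> \<longleftrightarrow> (\<forall>\<psi>. test_fun \<psi> \<longrightarrow> - (u \<bullet> abs_L2 (partial_deriv k \<psi>)) = g \<bullet> abs_L2 \<psi>)"
    by (auto simp: pairing_deriv pairing_component test_fun_square_integrable test_fun_partial_deriv)
  finally show ?thesis by (simp add: neg_eq_iff_add_eq_0)
qed

lemma has_weak_deriv_unique:
  assumes "has_weak_deriv k u g" "has_weak_deriv k u g'"
  shows "g = g'"
proof -
  have "g - g' = 0"
    using assms by (intro orthogonal_to_test_funs_imp_0) (fastforce simp: has_weak_deriv_iff inner_diff_left)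
  then show ?thesis by simp
qed

lemma weak_deriv_eqI: "has_weak_deriv k u g \<Longrightarrow> weak_deriv k u = g"
  unfolding weak_deriv_def by (rule some_equality) (auto intro: has_weak_deriv_unique)

text \<open>For $G=\nabla u$ this is the weak form of $-\mathrm{div}(Q\nabla u)+Vu$. It is linear in $(G,u)$, with
the coefficients acting on the test function.\<close>

definition weak_form :: "(real^'d \<Rightarrow> real^'d^'d) \<Rightarrow> (real^'d \<Rightarrow> real^'m^'m) \<Rightarrow>
    ('d \<Rightarrow> ('d::finite, 'm::finite) L2) \<Rightarrow> ('d, 'm) L2 \<Rightarrow> (real^'d \<Rightarrow> complex^'m) \<Rightarrow> real"
  where "weak_form Q V G u \<psi> =
    (\<Sum>k\<in>UNIV. G k \<bullet> abs_L2 (Q_grad Q (\<lambda>j. partial_deriv j \<psi>) k)) + u \<bullet> abs_L2 (V_adj V \<psi>)"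

context
  fixes Q :: "(real^'d::finite) \<Rightarrow> real^'d^'d" and V :: "(real^'d) \<Rightarrow> real^'m^'m::finite"
  assumes Q: "diffusion_matrix Q" and V: "accretive_potential V"
begin

lemma pairing_Delta_Q:
  fixes u :: "('d, 'm) L2"
  assumes \<psi>: "test_fun \<psi>"
  shows "pairing (Delta_Q Q u) \<psi> = - (\<Sum>k\<in>UNIV. weak_deriv k u \<bullet> abs_L2 (Q_grad Q (\<lambda>j. partial_deriv j \<psi>) k))"
proof -
  let ?G = "\<lambda>k. rep_L2 (weak_deriv k u)"
  let ?F = "\<lambda>j x. \<Sum>k\<in>UNIV. Q x $ j $ k *\<^sub>R ?G k x"
  have d: "square_integrable (partial_deriv j \<psi>)" for j
    by (intro test_fun_square_integrable test_fun_partial_deriv \<psi>)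
  have QG: "square_integrable (\<lambda>x. Q x $ j $ k *\<^sub>R ?G k x)" for j k
    by (intro Q_mult_square_integrable Q square_integrable_rep_L2)
  have F: "square_integrable (?F j)" for j by (intro square_integrable_sum QG)
  have Fi: "(\<lambda>x. \<Sum>k\<in>UNIV. complex_of_real (Q x $ j $ k) * component (weak_deriv k u) i x) = (\<lambda>x. ?F j x $ i)" for i j
    by (simp add: component_def) (simp add: scaleR_conv_of_real)
  have "pairing (Delta_Q Q u) \<psi> = (\<Sum>j\<in>UNIV. pairing (\<lambda>i. distr_deriv j (regular_distr (\<lambda>x. ?F j x $ i))) \<psi>)"
    unfolding pairing_def Delta_Q_def Fi Re_sum by (rule sum.swap)
  also have "\<dots> = (\<Sum>j\<in>UNIV. - (LINT x|lebesgue. ?F j x \<bullet> partial_deriv j \<psi> x))"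
    by (simp only: pairing_deriv[OF \<psi>] pairing_regular[OF F d])
  also have "\<dots> = - (\<Sum>j\<in>UNIV. \<Sum>k\<in>UNIV. weak_deriv k u \<bullet> abs_L2 (\<lambda>x. Q x $ j $ k *\<^sub>R partial_deriv j \<psi> x))"
    unfolding sum_negf
  proof (intro arg_cong[of _ _ uminus] sum.cong refl)
    fix j
    have "(LINT x|lebesgue. ?F j x \<bullet> partial_deriv j \<psi> x)
        = (LINT x|lebesgue. (\<Sum>k\<in>UNIV. (Q x $ j $ k *\<^sub>R ?G k x) \<bullet> partial_deriv j \<psi> x))"
      by (simp only: inner_sum_left)
    also have "\<dots> = (\<Sum>k\<in>UNIV. LINT x|lebesgue. (Q x $ j $ k *\<^sub>R ?G k x) \<bullet> partial_deriv j \<psi> x)"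
      by (intro Bochner_Integration.integral_sum integrable_inner_square_integrable QG d)
    also have "\<dots> = (\<Sum>k\<in>UNIV. weak_deriv k u \<bullet> abs_L2 (\<lambda>x. Q x $ j $ k *\<^sub>R partial_deriv j \<psi> x))"
      by (intro sum.cong refl) (simp add: inner_abs_L2_right Q_mult_square_integrable Q d)
    finally show "(LINT x|lebesgue. ?F j x \<bullet> partial_deriv j \<psi> x)
      = (\<Sum>k\<in>UNIV. weak_deriv k u \<bullet> abs_L2 (\<lambda>x. Q x $ j $ k *\<^sub>R partial_deriv j \<psi> x))" .
  qed
  also have "(\<Sum>j\<in>UNIV. \<Sum>k\<in>UNIV. weak_deriv k u \<bullet> abs_L2 (\<lambda>x. Q x $ j $ k *\<^sub>R partial_deriv j \<psi> x))
      = (\<Sum>k\<in>UNIV. \<Sum>j\<in>UNIV. weak_deriv k u \<bullet> abs_L2 (\<lambda>x. Q x $ j $ k *\<^sub>R partial_deriv j \<psi> x))"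
    by (rule sum.swap)
  also have "\<dots> = (\<Sum>k\<in>UNIV. weak_deriv k u \<bullet> abs_L2 (Q_grad Q (\<lambda>j. partial_deriv j \<psi>) k))"
    by (simp only: abs_L2_Q_grad[OF Q d] inner_sum_right)
  finally show ?thesis .
qed

text \<open>Here $Vu$ is only locally square integrable; on the support of $\psi$ it agrees with the function
obtained from the truncated entries.\<close>

lemma pairing_V:
  fixes u :: "('d, 'm) L2"
  assumes \<psi>: "test_fun \<psi>"
  shows "pairing (\<lambda>i. regular_distr (\<lambda>x. (complex_matrix (V x) *v rep_L2 u x) $ i)) \<psi> = u \<bullet> abs_L2 (V_adj V \<psi>)"
proof -
  obtain c where c: "\<And>x. \<psi> x \<noteq> 0 \<Longrightarrow> norm x \<le> c"
    using test_fun_bounded_support[OF \<psi>] unfolding bounded_iff by auto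
  let ?W = "\<lambda>x. \<Sum>i\<in>UNIV. \<Sum>j\<in>UNIV. (indicator (cball 0 c) x * V x $ i $ j) *\<^sub>R axis i (rep_L2 u x $ j)"
  have W: "square_integrable ?W"
    by (intro square_integrable_sum V_cutoff_square_integrable V square_integrable_rep_L2)
  have W_eq: "?W x = complex_matrix (V x) *v rep_L2 u x" if "\<psi> x \<noteq> 0" for x
    using c[OF that] by (simp add: complex_matrix_mult matrix_apply_def indicator_def)
  have "(\<lambda>x. (complex_matrix (V x) *v rep_L2 u x) $ i * cnj (\<psi> x $ i)) = (\<lambda>x. ?W x $ i * cnj (\<psi> x $ i))" for i
  proof
    fix x show "(complex_matrix (V x) *v rep_L2 u x) $ i * cnj (\<psi> x $ i) = ?W x $ i * cnj (\<psi> x $ i)"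
      using W_eq[of x] by (cases "\<psi> x = 0") auto
  qed
  then have "pairing (\<lambda>i. regular_distr (\<lambda>x. (complex_matrix (V x) *v rep_L2 u x) $ i)) \<psi>
      = pairing (\<lambda>i. regular_distr (\<lambda>x. ?W x $ i)) \<psi>"
    unfolding pairing_def regular_distr_def by simp
  also have "\<dots> = (LINT x|lebesgue. ?W x \<bullet> \<psi> x)"
    by (rule pairing_regular[OF W test_fun_square_integrable[OF \<psi>]])
  also have "\<dots> = (LINT x|lebesgue. rep_L2 u x \<bullet> V_adj V \<psi> x)"
  proof (intro Bochner_Integration.integral_cong refl)
    fix x show "?W x \<bullet> \<psi> x = rep_L2 u x \<bullet> V_adj V \<psi> x"
      using W_eq[of x] by (cases "\<psi> x = 0")
        (auto simp: complex_matrix_mult inner_matrix_apply V_adj_def matrix_apply_linear(2)[of _ 0 0, simplified])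
  qed
  also have "\<dots> = u \<bullet> abs_L2 (V_adj V \<psi>)"
    by (rule inner_abs_L2_right[symmetric], rule V_adj_square_integrable[OF V test_fun_square_integrable[OF \<psi>] c])
  finally show ?thesis .
qed

text \<open>The weak gradient is unique, so it may be quantified existentially; in this form membership in the
graph is evidently stable under linear combinations.\<close>

lemma operator_A_iff:
  fixes u f :: "('d, 'm) L2"
  shows "(u, f) \<in> operator_A Q V \<longleftrightarrow>
    (\<exists>G. (\<forall>k. has_weak_deriv k u (G k)) \<and> (\<forall>\<psi>. test_fun \<psi> \<longrightarrow> weak_form Q V G u \<psi> + f \<bullet> abs_L2 \<psi> = 0))"
proof -
  have hom: "homogeneous (calA Q V u i)" for i
  proof -
    have "homogeneous (Delta_Q Q u i)"
      unfolding homogeneous_def Delta_Q_def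
      using homogeneous_deriv[OF homogeneous_regular]
      by (auto simp: homogeneous_def sum_distrib_left intro!: sum.cong)
    then show ?thesis
      using homogeneous_regular[of "\<lambda>x. (complex_matrix (V x) *v rep_L2 u x) $ i"]
      by (simp add: homogeneous_def calA_def right_diff_distrib)
  qed
  have "(\<forall>i. distr_eq (calA Q V u i) (regular_distr (component f i)))
      \<longleftrightarrow> (\<forall>\<psi>. test_fun \<psi> \<longrightarrow> pairing (calA Q V u) \<psi> = pairing (\<lambda>i. regular_distr (component f i)) \<psi>)"
    by (intro distr_eq_iff_pairing hom homogeneous_regular)
  also have "\<dots> \<longleftrightarrow> (\<forall>\<psi>. test_fun \<psi> \<longrightarrow> weak_form Q V (\<lambda>k. weak_deriv k u) u \<psi> + f \<bullet> abs_L2 \<psi> = 0)"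
  proof -
    have "pairing (calA Q V u) \<psi> = - weak_form Q V (\<lambda>k. weak_deriv k u) u \<psi>" if "test_fun \<psi>" for \<psi>
    proof -
      have "pairing (calA Q V u) \<psi> = pairing (Delta_Q Q u) \<psi>
          - pairing (\<lambda>i. regular_distr (\<lambda>x. (complex_matrix (V x) *v rep_L2 u x) $ i)) \<psi>"
        by (simp add: pairing_def calA_def sum_subtractf)
      then show ?thesis using that by (simp add: pairing_Delta_Q pairing_V weak_form_def)
    qed
    then show ?thesis by (auto simp: pairing_component test_fun_square_integrable neg_eq_iff_add_eq_0)
  qed
  finally have *: "(u, f) \<in> operator_A Q V \<longleftrightarrow> u \<in> H1 \<and>
      (\<forall>\<psi>. test_fun \<psi> \<longrightarrow> weak_form Q V (\<lambda>k. weak_deriv k u) u \<psi> + f \<bullet> abs_L2 \<psi> = 0)"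
    by (simp add: operator_A_def)
  show ?thesis
  proof
    assume A: "(u, f) \<in> operator_A Q V"
    then have "\<forall>k. has_weak_deriv k u (weak_deriv k u)"
      unfolding * H1_def weak_deriv_def by (auto intro: someI_ex)
    with A show "\<exists>G. (\<forall>k. has_weak_deriv k u (G k)) \<and>
        (\<forall>\<psi>. test_fun \<psi> \<longrightarrow> weak_form Q V G u \<psi> + f \<bullet> abs_L2 \<psi> = 0)"
      unfolding * by (intro exI[of _ "\<lambda>k. weak_deriv k u"]) auto
  next
    assume "\<exists>G. (\<forall>k. has_weak_deriv k u (G k)) \<and>
        (\<forall>\<psi>. test_fun \<psi> \<longrightarrow> weak_form Q V G u \<psi> + f \<bullet> abs_L2 \<psi> = 0)"
    then obtain G where G: "\<And>k. has_weak_deriv k u (G k)"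
      "\<And>\<psi>. test_fun \<psi> \<Longrightarrow> weak_form Q V G u \<psi> + f \<bullet> abs_L2 \<psi> = 0" by blast
    have "(\<lambda>k. weak_deriv k u) = G" by (rule ext, rule weak_deriv_eqI[OF G(1)])
    with G show "(u, f) \<in> operator_A Q V" unfolding * by (auto simp: H1_def)
  qed
qed

end

section \<open>Dissipativity\<close>

text \<open>For fixed $x$ the function $y\mapsto\rho(x-y)$ is a test function, and its derivative is
$-(\partial_k\rho)(x-y)$; mollification therefore turns weak derivatives into classical ones.\<close>

lemma partial_deriv_conv_weak:
  fixes w g :: "real^'d::finite \<Rightarrow> complex^'m::finite"
  assumes \<rho>: "test_fun \<rho>" and w: "integrable lebesgue w" and g: "integrable lebesgue g"
    and weak: "\<And>\<psi>. test_fun \<psi> \<Longrightarrow> (LINT x|lebesgue. w x \<bullet> partial_deriv k \<psi> x) = - (LINT x|lebesgue. g x \<bullet> \<psi> x)"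
  shows "partial_deriv k (conv \<rho> w) = conv \<rho> g"
proof (rule ext, rule euclidean_eqI)
  fix x and b :: "complex^'m"
  let ?\<psi> = "\<lambda>y. \<rho> (x - y) *\<^sub>R b"
  have reflect: "test_fun (\<lambda>y. \<rho> (x - y))" using test_fun_affine[OF \<rho>, of "-1" x] by simp
  have \<psi>: "test_fun ?\<psi>" by (rule test_fun_linear[OF bounded_linear_scaleR_left reflect])
  have "partial_deriv k (\<lambda>y. \<rho> (x - y)) y = - partial_deriv k \<rho> (x - y)" for y
    using partial_deriv_affine(1)[OF test_fun_differentiable[OF \<rho>], of k "-1" x y] by simp
  then have d: "partial_deriv k ?\<psi> y = - partial_deriv k \<rho> (x - y) *\<^sub>R b" for y
    using partial_deriv_linear[OF bounded_linear_scaleR_left test_fun_differentiable[OF reflect], of k b y] by simp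
  have "partial_deriv k (conv \<rho> w) x \<bullet> b = (LINT y|lebesgue. (partial_deriv k \<rho> (x - y) *\<^sub>R w y) \<bullet> b)"
    unfolding partial_deriv_conv[OF \<rho> w] conv_def
    by (rule integral_inner_left[symmetric]) (rule integrable_conv[OF test_fun_partial_deriv[OF \<rho>] w])
  also have "\<dots> = - (LINT y|lebesgue. w y \<bullet> partial_deriv k ?\<psi> y)"
    by (simp add: d)
  also have "\<dots> = (LINT y|lebesgue. (\<rho> (x - y) *\<^sub>R g y) \<bullet> b)"
    by (simp add: weak[OF \<psi>])
  also have "\<dots> = conv \<rho> g x \<bullet> b"
    unfolding conv_def by (rule integral_inner_left) (rule integrable_conv[OF \<rho> g])
  finally show "partial_deriv k (conv \<rho> w) x \<bullet> b = conv \<rho> g x \<bullet> b" .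
qed

lemma test_fun_mult_square_integrable:
  fixes f :: "real^'d::finite \<Rightarrow> complex^'m::finite"
  assumes \<theta>: "test_fun \<theta>" and f: "square_integrable f"
  shows "square_integrable (\<lambda>x. \<theta> x *\<^sub>R f x)"
proof -
  obtain B where "\<And>x. norm (\<theta> x) \<le> B" using test_fun_bounded[OF \<theta>] by metis
  then show ?thesis
    using square_integrable_mult_linear(1)[OF test_fun_lebesgue_measurable[OF \<theta>] _ bounded_linear_ident f, of B] by simp
qed

lemma weak_product_rule:
  fixes u g :: "('d::finite, 'm::finite) L2"
  assumes weak: "has_weak_deriv k u g" and \<theta>: "test_fun (\<theta> :: real^'d \<Rightarrow> real)" and \<psi>: "test_fun \<psi>"
  shows "(LINT x|lebesgue. (\<theta> x *\<^sub>R rep_L2 u x) \<bullet> partial_deriv k \<psi> x)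
    = - (LINT x|lebesgue. (\<theta> x *\<^sub>R rep_L2 g x + partial_deriv k \<theta> x *\<^sub>R rep_L2 u x) \<bullet> \<psi> x)"
proof -
  note \<theta>' = test_fun_partial_deriv[OF \<theta>, of k] and \<psi>' = test_fun_partial_deriv[OF \<psi>, of k]
  have \<theta>\<psi>: "test_fun (\<lambda>x. \<theta> x *\<^sub>R \<psi> x)"
    by (rule test_fun_bilinear[OF bounded_bilinear_scaleR \<theta> test_fun_C_k[OF \<psi>]])
  have d: "partial_deriv k (\<lambda>x. \<theta> x *\<^sub>R \<psi> x) = (\<lambda>x. \<theta> x *\<^sub>R partial_deriv k \<psi> x + partial_deriv k \<theta> x *\<^sub>R \<psi> x)"
    by (intro ext partial_deriv_bilinear bounded_bilinear_scaleR test_fun_differentiable \<theta> \<psi>)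
  note sq = test_fun_mult_square_integrable[OF \<theta> test_fun_square_integrable[OF \<psi>']]
    test_fun_mult_square_integrable[OF \<theta>' test_fun_square_integrable[OF \<psi>]]
    test_fun_square_integrable[OF \<theta>\<psi>]
  have "u \<bullet> abs_L2 (partial_deriv k (\<lambda>x. \<theta> x *\<^sub>R \<psi> x)) + g \<bullet> abs_L2 (\<lambda>x. \<theta> x *\<^sub>R \<psi> x) = 0"
    using weak \<theta>\<psi> unfolding has_weak_deriv_iff by blast
  then have "(LINT x|lebesgue. rep_L2 u x \<bullet> (\<theta> x *\<^sub>R partial_deriv k \<psi> x))
      + (LINT x|lebesgue. rep_L2 u x \<bullet> (partial_deriv k \<theta> x *\<^sub>R \<psi> x))
      + (LINT x|lebesgue. rep_L2 g x \<bullet> (\<theta> x *\<^sub>R \<psi> x)) = 0"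
    unfolding d by (simp add: abs_L2_add sq inner_add_right inner_abs_L2_right)
  moreover have "(LINT x|lebesgue. (\<theta> x *\<^sub>R rep_L2 g x + partial_deriv k \<theta> x *\<^sub>R rep_L2 u x) \<bullet> \<psi> x)
      = (LINT x|lebesgue. rep_L2 g x \<bullet> (\<theta> x *\<^sub>R \<psi> x) + rep_L2 u x \<bullet> (partial_deriv k \<theta> x *\<^sub>R \<psi> x))"
    by (simp add: inner_add_left)
  moreover have "\<dots> = (LINT x|lebesgue. rep_L2 g x \<bullet> (\<theta> x *\<^sub>R \<psi> x))
      + (LINT x|lebesgue. rep_L2 u x \<bullet> (partial_deriv k \<theta> x *\<^sub>R \<psi> x))"
    by (intro Bochner_Integration.integral_add integrable_inner_square_integrable square_integrable_rep_L2 sq)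
  moreover have "(LINT x|lebesgue. (\<theta> x *\<^sub>R rep_L2 u x) \<bullet> partial_deriv k \<psi> x)
      = (LINT x|lebesgue. rep_L2 u x \<bullet> (\<theta> x *\<^sub>R partial_deriv k \<psi> x))" by simp
  ultimately show ?thesis by linarith
qed

lemma Q_grad_linear:
  "Q_grad Q (\<lambda>j x. f j x + g j x) k x = Q_grad Q f k x + Q_grad Q g k x"
  "Q_grad Q (\<lambda>j x. q x *\<^sub>R f j x) k x = q x *\<^sub>R Q_grad Q f k x"
  by (simp_all add: Q_grad_def scaleR_add_right sum.distrib scaleR_sum_right mult.commute)

lemma weak_form_linear:
  "weak_form Q V (\<lambda>k. G k + G' k) (u + u') \<psi> = weak_form Q V G u \<psi> + weak_form Q V G' u' \<psi>"
  "weak_form Q V (\<lambda>k. r *\<^sub>R G k) (r *\<^sub>R u) \<psi> = r * weak_form Q V G u \<psi>"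
  by (simp_all add: weak_form_def inner_add_left sum.distrib sum_distrib_left algebra_simps)

lemma has_weak_deriv_linear:
  "has_weak_deriv k u g \<Longrightarrow> has_weak_deriv k u' g' \<Longrightarrow> has_weak_deriv k (u + u') (g + g')"
  "has_weak_deriv k u g \<Longrightarrow> has_weak_deriv k (r *\<^sub>R u) (r *\<^sub>R g)"
  unfolding has_weak_deriv_iff by (auto simp: inner_add_left algebra_simps simp flip: distrib_left)

lemma has_weak_deriv_test_fun:
  assumes "test_fun \<psi>"
  shows "has_weak_deriv k (abs_L2 \<psi>) (abs_L2 (partial_deriv k \<psi>))"
  unfolding has_weak_deriv_iff
  using integration_by_parts[OF assms]
  by (simp add: inner_abs_L2 test_fun_square_integrable test_fun_partial_deriv assms)

lemma inner_scalar_mult_complex: "(c *s a) \<bullet> b = a \<bullet> (cnj c *s (b :: complex^'n::finite))"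
  by (simp add: inner_vec_def inner_complex_def algebra_simps)

lemma abs_L2_scaleC: "square_integrable f \<Longrightarrow> abs_L2 (\<lambda>x. c *s f x) = c *\<^sub>C abs_L2 f"
  by (simp add: scaleC_L2.abs_eq L2_rel_def)

lemma inner_scaleC_L2: "(c *\<^sub>C u) \<bullet> v = u \<bullet> (cnj c *\<^sub>C (v :: ('a::finite, 'b::finite) L2))"
proof -
  have "abs_L2 (\<lambda>x. c *s rep_L2 u x) \<bullet> abs_L2 (rep_L2 v) = abs_L2 (rep_L2 u) \<bullet> abs_L2 (\<lambda>x. cnj c *s rep_L2 v x)"
    unfolding inner_abs_L2[OF square_integrable_scaleC[OF square_integrable_rep_L2] square_integrable_rep_L2]
      inner_abs_L2[OF square_integrable_rep_L2 square_integrable_scaleC[OF square_integrable_rep_L2]]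
    by (simp add: inner_scalar_mult_complex)
  then show ?thesis by (simp add: abs_L2_scaleC square_integrable_rep_L2)
qed

lemma bounded_linear_scaleC_L2: "bounded_linear (\<lambda>u :: ('a::finite, 'b::finite) L2. c *\<^sub>C u)"
proof (rule bounded_linear_intro[where K = "cmod c"])
  show "c *\<^sub>C (r *\<^sub>R u) = r *\<^sub>R (c *\<^sub>C u)" for r and u :: "('a, 'b) L2"
    by (metis mult.commute scaleC_of_real scaleC_scaleC)
qed (simp_all add: scaleC_add_right norm_scaleC mult.commute)

context
  fixes Q :: "(real^'d::finite) \<Rightarrow> real^'d^'d" and V :: "(real^'d) \<Rightarrow> real^'m^'m::finite"
  assumes Q: "diffusion_matrix Q" and V: "accretive_potential V"
begin

text \<open>The mollifications $\rho_n*(\theta u)$ are test functions. Their gradients are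
$\rho_n*(\theta G_j+\partial_j\theta\,u)$ and their supports lie in one ball, so every term of the
weak form converges.\<close>

lemma weak_form_extends_to_cutoff:
  fixes u f :: "('d, 'm) L2" and G :: "'d \<Rightarrow> ('d, 'm) L2"
  assumes G: "\<And>k. has_weak_deriv k u (G k)"
    and weak: "\<And>\<psi>. test_fun \<psi> \<Longrightarrow> weak_form Q V G u \<psi> + f \<bullet> abs_L2 \<psi> = 0"
    and \<theta>: "test_fun (\<theta> :: real^'d \<Rightarrow> real)"
  shows "(\<Sum>k\<in>UNIV. G k \<bullet> abs_L2 (Q_grad Q (\<lambda>j x. \<theta> x *\<^sub>R rep_L2 (G j) x + partial_deriv j \<theta> x *\<^sub>R rep_L2 u x) k))
    + u \<bullet> abs_L2 (V_adj V (\<lambda>x. \<theta> x *\<^sub>R rep_L2 u x)) + f \<bullet> abs_L2 (\<lambda>x. \<theta> x *\<^sub>R rep_L2 u x) = 0"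
proof -
  define w where "w x = \<theta> x *\<^sub>R rep_L2 u x" for x
  define g where "g j x = \<theta> x *\<^sub>R rep_L2 (G j) x + partial_deriv j \<theta> x *\<^sub>R rep_L2 u x" for j x
  obtain c where c: "\<And>x. \<theta> x \<noteq> 0 \<or> (\<exists>j. partial_deriv j \<theta> x \<noteq> 0) \<Longrightarrow> norm x \<le> c"
  proof -
    have "bounded (closure {x. \<theta> x \<noteq> 0})" using test_fun_bounded_support[OF \<theta>] by (rule bounded_closure)
    then obtain c where "\<And>x. x \<in> closure {x. \<theta> x \<noteq> 0} \<Longrightarrow> norm x \<le> c" unfolding bounded_iff by auto
    moreover have "x \<in> closure {x. \<theta> x \<noteq> 0}" if "\<theta> x \<noteq> 0 \<or> (\<exists>j. partial_deriv j \<theta> x \<noteq> 0)" for x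
      using that partial_deriv_eq_0[of x \<theta>] closure_subset[of "{x. \<theta> x \<noteq> 0}"] by auto
    ultimately show thesis using that by blast
  qed
  have wc: "norm x \<le> c" if "w x \<noteq> 0" for x using that c[of x] by (auto simp: w_def)
  have gc: "norm x \<le> c" if "g j x \<noteq> 0" for j x by (rule c, rule ccontr) (use that in \<open>simp add: g_def\<close>)
  have w: "square_integrable w" unfolding w_def
    by (intro test_fun_mult_square_integrable \<theta> square_integrable_rep_L2)
  have g: "square_integrable (g j)" for j unfolding g_def
    by (intro square_integrable_add test_fun_mult_square_integrable test_fun_partial_deriv \<theta> square_integrable_rep_L2)
  note wi = integrable_if_square_integrable_bounded_support[OF w wc]
    and gi = integrable_if_square_integrable_bounded_support[OF g gc]
  obtain \<rho> :: "nat \<Rightarrow> real^'d \<Rightarrow> real" where \<rho>: "\<And>n. mollifier (1 / real (Suc n)) (\<rho> n)"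
    using mollifier_exists[of "1 / real (Suc n)" for n] by (metis of_nat_0_less_iff zero_less_divide_1_iff zero_less_Suc)
  have \<rho>t: "test_fun (\<rho> n)" for n using \<rho> by (simp add: mollifier_def)
  have t: "test_fun (conv (\<rho> n) w)" for n by (rule test_fun_conv[OF \<rho> wi wc])
  have d: "partial_deriv j (conv (\<rho> n) w) = conv (\<rho> n) (g j)" for j n
  proof (rule partial_deriv_conv_weak[OF \<rho>t wi gi])
    show "(LINT x|lebesgue. w x \<bullet> partial_deriv j \<psi> x) = - (LINT x|lebesgue. g j x \<bullet> \<psi> x)"
      if "test_fun \<psi>" for \<psi>
      unfolding w_def g_def by (rule weak_product_rule[OF G \<theta> that])
  qed
  have sqw: "square_integrable (conv (\<rho> n) w)" for n by (rule conv_L2_contraction(1)[OF \<rho> wi w])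
  have sqg: "square_integrable (conv (\<rho> n) (g j))" for n j by (rule conv_L2_contraction(1)[OF \<rho> gi g])
  have lim: "(\<lambda>n. abs_L2 (conv (\<rho> n) w)) \<longlonglongrightarrow> abs_L2 w" "(\<lambda>n. abs_L2 (conv (\<rho> n) (g j))) \<longlonglongrightarrow> abs_L2 (g j)" for j
    by (rule conv_tendsto[OF \<rho> w wc], assumption) (rule conv_tendsto[OF \<rho> g gc])
  have supp: "norm x \<le> c + 1" if "conv (\<rho> n) w x \<noteq> 0" for n x
  proof (rule ccontr)
    assume "\<not> norm x \<le> c + 1"
    moreover have "1 / real (Suc n) \<le> 1" by simp
    ultimately have "norm x \<ge> c + 1 / real (Suc n)" by linarith
    then have "conv (\<rho> n) w x = 0"
      by (intro conv_eq_0[OF wc, where e = "1 / real (Suc n)"]) (use \<rho>[of n] in \<open>auto simp: mollifier_def\<close>)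
    with that show False by simp
  qed
  have wc': "norm x \<le> c + 1" if "w x \<noteq> 0" for x using wc[OF that] by simp
  have "(\<lambda>n. (\<Sum>k\<in>UNIV. G k \<bullet> abs_L2 (Q_grad Q (\<lambda>j. conv (\<rho> n) (g j)) k))
      + u \<bullet> abs_L2 (V_adj V (conv (\<rho> n) w)) + f \<bullet> abs_L2 (conv (\<rho> n) w))
    \<longlonglongrightarrow> (\<Sum>k\<in>UNIV. G k \<bullet> abs_L2 (Q_grad Q g k)) + u \<bullet> abs_L2 (V_adj V w) + f \<bullet> abs_L2 w"
    by (intro tendsto_intros Q_grad_tendsto[OF Q sqg g lim(2)] V_adj_tendsto[OF V sqw w lim(1) supp wc'] lim(1))
  moreover have "(\<Sum>k\<in>UNIV. G k \<bullet> abs_L2 (Q_grad Q (\<lambda>j. conv (\<rho> n) (g j)) k))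
      + u \<bullet> abs_L2 (V_adj V (conv (\<rho> n) w)) + f \<bullet> abs_L2 (conv (\<rho> n) w) = 0" for n
    using weak[OF t[of n]] by (simp add: weak_form_def d)
  ultimately have "(\<Sum>k\<in>UNIV. G k \<bullet> abs_L2 (Q_grad Q g k)) + u \<bullet> abs_L2 (V_adj V w) + f \<bullet> abs_L2 w = 0"
    by (simp add: LIMSEQ_const_iff)
  then show ?thesis by (simp add: w_def[abs_def] g_def[abs_def])
qed

text \<open>Test with $\theta u$. By the product rule the principal part splits into
$\theta\langle Q G,G\rangle\ge0$ and a term with $\nabla\theta$, and
$\theta\,\mathrm{Re}\langle Vu,u\rangle\ge0$.\<close>

lemma localized_energy_inequality:
  fixes u f :: "('d, 'm) L2" and G :: "'d \<Rightarrow> ('d, 'm) L2"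
  assumes G: "\<And>k. has_weak_deriv k u (G k)"
    and weak: "\<And>\<psi>. test_fun \<psi> \<Longrightarrow> weak_form Q V G u \<psi> + f \<bullet> abs_L2 \<psi> = 0"
    and \<theta>: "test_fun (\<theta> :: real^'d \<Rightarrow> real)" and nonneg: "\<And>x. \<theta> x \<ge> 0"
  shows "f \<bullet> abs_L2 (\<lambda>x. \<theta> x *\<^sub>R rep_L2 u x)
    \<le> - (\<Sum>k\<in>UNIV. G k \<bullet> abs_L2 (Q_grad Q (\<lambda>j x. partial_deriv j \<theta> x *\<^sub>R rep_L2 u x) k))"
proof -
  let ?G = "\<lambda>j. rep_L2 (G j)"
  obtain c where c: "\<And>x. \<theta> x \<noteq> 0 \<Longrightarrow> norm x \<le> c"
    using test_fun_bounded_support[OF \<theta>] unfolding bounded_iff by auto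
  have sq1: "square_integrable (\<lambda>x. \<theta> x *\<^sub>R ?G j x)" for j
    by (intro test_fun_mult_square_integrable \<theta> square_integrable_rep_L2)
  have sq2: "square_integrable (\<lambda>x. partial_deriv j \<theta> x *\<^sub>R rep_L2 u x)" for j
    by (intro test_fun_mult_square_integrable test_fun_partial_deriv \<theta> square_integrable_rep_L2)
  have sq3: "square_integrable (\<lambda>x. \<theta> x *\<^sub>R rep_L2 u x)"
    by (intro test_fun_mult_square_integrable \<theta> square_integrable_rep_L2)
  have sqV: "square_integrable (V_adj V (\<lambda>x. \<theta> x *\<^sub>R rep_L2 u x))"
    by (rule V_adj_square_integrable[OF V sq3, of c]) (use c in auto)
  have sqQ: "square_integrable (Q_grad Q (\<lambda>j x. \<theta> x *\<^sub>R ?G j x) k)" for k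
    by (intro Q_grad_square_integrable[OF Q] sq1)
  have split: "abs_L2 (Q_grad Q (\<lambda>j x. \<theta> x *\<^sub>R ?G j x + partial_deriv j \<theta> x *\<^sub>R rep_L2 u x) k)
      = abs_L2 (Q_grad Q (\<lambda>j x. \<theta> x *\<^sub>R ?G j x) k) + abs_L2 (Q_grad Q (\<lambda>j x. partial_deriv j \<theta> x *\<^sub>R rep_L2 u x) k)" for k
    unfolding Q_grad_linear(1)[abs_def]
    by (intro abs_L2_add Q_grad_square_integrable[OF Q] sq1 sq2)
  obtain \<eta> where \<eta>: "\<eta> > 0" "\<And>x \<xi>. \<eta> * (norm \<xi>)\<^sup>2 \<le> (Q x *v \<xi>) \<bullet> \<xi>" using Q_elliptic[OF Q] by blast
  have "(\<Sum>k\<in>UNIV. G k \<bullet> abs_L2 (Q_grad Q (\<lambda>j x. \<theta> x *\<^sub>R ?G j x) k))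
      = (LINT x|lebesgue. (\<Sum>k\<in>UNIV. ?G k x \<bullet> Q_grad Q (\<lambda>j x. \<theta> x *\<^sub>R ?G j x) k x))"
    by (subst Bochner_Integration.integral_sum)
      (auto intro!: integrable_inner_square_integrable square_integrable_rep_L2 sqQ
        simp: inner_abs_L2_right[OF sqQ])
  also have "\<dots> \<ge> 0"
  proof (intro Bochner_Integration.integral_nonneg)
    fix x
    have "0 \<le> \<theta> x * (\<eta> * (\<Sum>k\<in>UNIV. (norm (?G k x))\<^sup>2))"
      using nonneg \<eta>(1) by (intro mult_nonneg_nonneg sum_nonneg) auto
    also have "\<dots> \<le> \<theta> x * (\<Sum>k\<in>UNIV. ?G k x \<bullet> (\<Sum>j\<in>UNIV. Q x $ j $ k *\<^sub>R ?G j x))"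
      by (intro mult_left_mono quadratic_form_lower_bound \<eta> nonneg)
    also have "\<dots> = (\<Sum>k\<in>UNIV. ?G k x \<bullet> Q_grad Q (\<lambda>j x. \<theta> x *\<^sub>R ?G j x) k x)"
      unfolding Q_grad_linear(2) by (simp add: Q_grad_def sum_distrib_left)
    finally show "0 \<le> (\<Sum>k\<in>UNIV. ?G k x \<bullet> Q_grad Q (\<lambda>j x. \<theta> x *\<^sub>R ?G j x) k x)" .
  qed
  finally have 1: "0 \<le> (\<Sum>k\<in>UNIV. G k \<bullet> abs_L2 (Q_grad Q (\<lambda>j x. \<theta> x *\<^sub>R ?G j x) k))" .
  have "u \<bullet> abs_L2 (V_adj V (\<lambda>x. \<theta> x *\<^sub>R rep_L2 u x)) = (LINT x|lebesgue. \<theta> x * (rep_L2 u x \<bullet> V_adj V (rep_L2 u) x))"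
    by (simp add: inner_abs_L2_right[OF sqV] V_adj_linear(2))
  also have "\<dots> \<ge> 0"
    by (intro Bochner_Integration.integral_nonneg mult_nonneg_nonneg nonneg V_adj_accretive[OF V])
  finally have 2: "0 \<le> u \<bullet> abs_L2 (V_adj V (\<lambda>x. \<theta> x *\<^sub>R rep_L2 u x))" .
  show ?thesis
    using weak_form_extends_to_cutoff[OF G weak \<theta>] 1 2 unfolding split
    by (simp add: inner_add_right sum.distrib)
qed

text \<open>With $\theta_n(x)=\beta(x/(n+1))$ the localized inequality becomes
$\beta(0)\langle f,u\rangle\le0$ in the limit: $\theta_n\to\beta(0)$ boundedly, while
$|\nabla\theta_n|\le C/(n+1)$ makes the right-hand side vanish.\<close>

lemma operator_A_dissipative:
  fixes u f :: "('d, 'm) L2"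
  assumes "(u, f) \<in> operator_A Q V"
  shows "f \<bullet> u \<le> 0"
proof -
  obtain G where G: "\<And>k. has_weak_deriv k u (G k)"
    and weak: "\<And>\<psi>. test_fun \<psi> \<Longrightarrow> weak_form Q V G u \<psi> + f \<bullet> abs_L2 \<psi> = 0"
    using assms operator_A_iff[OF Q V] by blast
  define \<beta> :: "real^'d \<Rightarrow> real" where "\<beta> = bump 1 (\<chi> i. - 1) (\<chi> i. (1 :: real))"
  have \<beta>: "test_fun (\<beta> :: real^'d \<Rightarrow> real)" unfolding \<beta>_def by (rule test_fun_bump) simp
  have "\<beta> 0 \<noteq> 0" unfolding \<beta>_def by (subst bump_nonzero_iff) (auto simp: mem_box_cart)
  then have \<beta>0: "\<beta> 0 > 0" using bump_bounds(1) by (simp add: \<beta>_def order_less_le)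
  define s where "s n = 1 / real (Suc n)" for n
  have s: "s \<longlonglongrightarrow> 0" "s n \<noteq> 0" for n
    unfolding s_def by (rule LIMSEQ_Suc[OF lim_1_over_n]) simp
  define \<theta> where "\<theta> n x = \<beta> (s n *\<^sub>R x + 0)" for n x
  have \<theta>: "test_fun (\<theta> n)" for n unfolding \<theta>_def by (rule test_fun_affine[OF \<beta> s(2)])
  have \<theta>': "partial_deriv j (\<theta> n) x = s n * partial_deriv j \<beta> (s n *\<^sub>R x)" for j n x
    using partial_deriv_affine(1)[OF test_fun_differentiable[OF \<beta>], of j "s n" 0 x] by (simp add: \<theta>_def[abs_def])
  have nonneg: "\<theta> n x \<ge> 0" for n x unfolding \<theta>_def \<beta>_def by (rule bump_bounds)
  have sq1: "square_integrable (\<lambda>x. \<theta> n x *\<^sub>R rep_L2 u x)" for n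
    by (intro test_fun_mult_square_integrable \<theta> square_integrable_rep_L2)
  have sq2: "square_integrable (\<lambda>x. partial_deriv j (\<theta> n) x *\<^sub>R rep_L2 u x)" for j n
    by (intro test_fun_mult_square_integrable test_fun_partial_deriv \<theta> square_integrable_rep_L2)
  have "(\<lambda>n. f \<bullet> abs_L2 (\<lambda>x. \<theta> n x *\<^sub>R rep_L2 u x)) \<longlonglongrightarrow> (LINT x|lebesgue. \<beta> 0 * (rep_L2 f x \<bullet> rep_L2 u x))"
    unfolding inner_abs_L2_right[OF sq1]
  proof (rule integral_dominated_convergence[where w = "\<lambda>x. \<bar>rep_L2 f x \<bullet> rep_L2 u x\<bar>"])
    have i: "integrable lebesgue (\<lambda>x. rep_L2 f x \<bullet> rep_L2 u x)"
      by (intro integrable_inner_square_integrable square_integrable_rep_L2)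
    then show "integrable lebesgue (\<lambda>x. \<bar>rep_L2 f x \<bullet> rep_L2 u x\<bar>)" by (rule integrable_abs)
    show "(\<lambda>x. \<beta> 0 * (rep_L2 f x \<bullet> rep_L2 u x)) \<in> borel_measurable lebesgue" using i by simp
    show "(\<lambda>x. rep_L2 f x \<bullet> (\<theta> n x *\<^sub>R rep_L2 u x)) \<in> borel_measurable lebesgue" for n
      by (intro borel_measurable_integrable integrable_inner_square_integrable square_integrable_rep_L2 sq1)
    show "AE x in lebesgue. (\<lambda>n. rep_L2 f x \<bullet> (\<theta> n x *\<^sub>R rep_L2 u x)) \<longlonglongrightarrow> \<beta> 0 * (rep_L2 f x \<bullet> rep_L2 u x)"
    proof (rule AE_I2)
      fix x :: "real^'d"
      have "(\<lambda>n. s n *\<^sub>R x + 0) \<longlonglongrightarrow> 0 *\<^sub>R x + 0" by (intro tendsto_intros s)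
      then have "(\<lambda>n. \<theta> n x) \<longlonglongrightarrow> \<beta> 0"
        unfolding \<theta>_def using test_fun_continuous[OF \<beta>, of UNIV]
        by (intro continuous_on_tendsto_compose[of UNIV \<beta>]) auto
      then show "(\<lambda>n. rep_L2 f x \<bullet> (\<theta> n x *\<^sub>R rep_L2 u x)) \<longlonglongrightarrow> \<beta> 0 * (rep_L2 f x \<bullet> rep_L2 u x)"
        by (simp add: tendsto_mult_right)
    qed
    show "AE x in lebesgue. norm (rep_L2 f x \<bullet> (\<theta> n x *\<^sub>R rep_L2 u x)) \<le> \<bar>rep_L2 f x \<bullet> rep_L2 u x\<bar>" for n
    proof (rule AE_I2)
      fix x
      have "\<bar>\<theta> n x\<bar> \<le> 1" using nonneg[of n x] bump_bounds(2) by (simp add: \<theta>_def \<beta>_def)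
      then show "norm (rep_L2 f x \<bullet> (\<theta> n x *\<^sub>R rep_L2 u x)) \<le> \<bar>rep_L2 f x \<bullet> rep_L2 u x\<bar>"
        using mult_right_mono[of "\<bar>\<theta> n x\<bar>" 1 "\<bar>rep_L2 f x \<bullet> rep_L2 u x\<bar>"] by (simp add: abs_mult)
    qed
  qed
  moreover have "(\<lambda>n. - (\<Sum>k\<in>UNIV. G k \<bullet> abs_L2 (Q_grad Q (\<lambda>j x. partial_deriv j (\<theta> n) x *\<^sub>R rep_L2 u x) k))) \<longlonglongrightarrow> 0"
  proof -
    have small: "(\<lambda>n. abs_L2 (\<lambda>x. partial_deriv j (\<theta> n) x *\<^sub>R rep_L2 u x)) \<longlonglongrightarrow> abs_L2 (\<lambda>x. 0)" for j
    proof -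
      obtain B where B: "\<And>x. norm (partial_deriv j \<beta> x) \<le> B"
        using test_fun_bounded[OF test_fun_partial_deriv[OF \<beta>]] by metis
      have "norm (abs_L2 (\<lambda>x. partial_deriv j (\<theta> n) x *\<^sub>R rep_L2 u x)) \<le> \<bar>s n * B\<bar> * onorm (\<lambda>z :: complex^'m. z) * norm u" for n
      proof -
        have "\<bar>partial_deriv j (\<theta> n) x\<bar> \<le> s n * B" for x
          using B[of "s n *\<^sub>R x"] by (simp add: \<theta>' abs_mult s_def divide_right_mono)
        then show ?thesis
          using square_integrable_mult_linear(2)[OF test_fun_lebesgue_measurable[OF test_fun_partial_deriv[OF \<theta>]]
              _ bounded_linear_ident square_integrable_rep_L2[of u], of j n "s n * B"] by simp
      qed
      then have "\<forall>\<^sub>F n in sequentially. norm (abs_L2 (\<lambda>x. partial_deriv j (\<theta> n) x *\<^sub>R rep_L2 u x))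
          \<le> \<bar>s n * B\<bar> * onorm (\<lambda>z :: complex^'m. z) * norm u" by (intro always_eventually allI)
      moreover have "(\<lambda>n. \<bar>s n * B\<bar> * onorm (\<lambda>z :: complex^'m. z) * norm u) \<longlonglongrightarrow> \<bar>0 * B\<bar> * onorm (\<lambda>z :: complex^'m. z) * norm u"
        by (intro tendsto_intros s)
      then have "(\<lambda>n. \<bar>s n * B\<bar> * onorm (\<lambda>z :: complex^'m. z) * norm u) \<longlonglongrightarrow> 0" by simp
      ultimately have "(\<lambda>n. abs_L2 (\<lambda>x. partial_deriv j (\<theta> n) x *\<^sub>R rep_L2 u x)) \<longlonglongrightarrow> 0"
        by (rule Lim_null_comparison)
      then show ?thesis by (simp add: zero_L2_def)
    qed
    have 0: "abs_L2 (Q_grad Q (\<lambda>j x. 0) k) = (0 :: ('d, 'm) L2)" for k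
      by (simp add: Q_grad_def[abs_def] zero_L2_def)
    have "(\<lambda>n. - (\<Sum>k\<in>UNIV. G k \<bullet> abs_L2 (Q_grad Q (\<lambda>j x. partial_deriv j (\<theta> n) x *\<^sub>R rep_L2 u x) k)))
        \<longlonglongrightarrow> - (\<Sum>k\<in>UNIV. G k \<bullet> abs_L2 (Q_grad Q (\<lambda>j x. 0) k))"
      by (intro tendsto_intros Q_grad_tendsto[OF Q sq2 square_integrable_0 small])
    then show ?thesis by (simp add: 0)
  qed
  ultimately have "(LINT x|lebesgue. \<beta> 0 * (rep_L2 f x \<bullet> rep_L2 u x)) \<le> 0"
    by (rule LIMSEQ_le) (use localized_energy_inequality[OF G weak \<theta> nonneg] in blast)
  then have "\<beta> 0 * (f \<bullet> u) \<le> 0"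
    using inner_abs_L2_right[OF square_integrable_rep_L2, of f u] by simp
  then show ?thesis using \<beta>0 by (simp add: mult_le_0_iff)
qed

section \<open>The range condition\<close>

lemma subspace_operator_A: "subspace (operator_A Q V)"
proof (rule subspaceI)
  have "(0, 0) \<in> operator_A Q V"
    unfolding operator_A_iff[OF Q V] by (intro exI[of _ "\<lambda>k. 0"]) (simp add: has_weak_deriv_iff weak_form_def)
  then show "0 \<in> operator_A Q V" by (simp add: zero_prod_def)
next
  fix x y assume "x \<in> operator_A Q V" "y \<in> operator_A Q V"
  then obtain u f G u' f' G' where *: "x = (u, f)" "y = (u', f')"
      "\<And>k. has_weak_deriv k u (G k)" "\<And>\<psi>. test_fun \<psi> \<Longrightarrow> weak_form Q V G u \<psi> + f \<bullet> abs_L2 \<psi> = 0"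
      "\<And>k. has_weak_deriv k u' (G' k)" "\<And>\<psi>. test_fun \<psi> \<Longrightarrow> weak_form Q V G' u' \<psi> + f' \<bullet> abs_L2 \<psi> = 0"
    using operator_A_iff[OF Q V] by (metis surj_pair)
  have "(u + u', f + f') \<in> operator_A Q V"
    unfolding operator_A_iff[OF Q V]
    using *(4)[of _] *(6)[of _]
    by (intro exI[of _ "\<lambda>k. G k + G' k"] conjI allI impI has_weak_deriv_linear *(3,5))
      (fastforce simp: weak_form_linear inner_add_left)
  then show "x + y \<in> operator_A Q V" by (simp add: *(1,2))
next
  fix r x assume "x \<in> operator_A Q V"
  then obtain u f G where *: "x = (u, f)"
      "\<And>k. has_weak_deriv k u (G k)" "\<And>\<psi>. test_fun \<psi> \<Longrightarrow> weak_form Q V G u \<psi> + f \<bullet> abs_L2 \<psi> = 0"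
    using operator_A_iff[OF Q V] by (metis surj_pair)
  have "(r *\<^sub>R u, r *\<^sub>R f) \<in> operator_A Q V"
    unfolding operator_A_iff[OF Q V]
    by (intro exI[of _ "\<lambda>k. r *\<^sub>R G k"] conjI allI impI has_weak_deriv_linear *(2))
      (simp add: weak_form_linear *(3) flip: distrib_left)
  then show "r *\<^sub>R x \<in> operator_A Q V" by (simp add: *(1))
qed

text \<open>Lions' theorem in $L^2\times(L^2)^d$. A test function $\psi$ is represented by $P\psi=(\psi,\nabla\psi)$,
and $S\psi$ represents the functional
$(u,G)\mapsto\langle u,\psi\rangle+h\,(\langle G,Q^{T}\nabla\psi\rangle+\langle u,V^{T}\psi\rangle)$.
The space $M$ of constraints annihilates all $P\psi$; since it contains $(\partial_k\psi,\psi e_k)$ by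
integration by parts, the second component of the solution is the weak gradient of the first.\<close>

lemma operator_A_range:
  fixes z :: "('d, 'm) L2"
  assumes h: "h > 0"
  obtains u f where "(u, f) \<in> operator_A Q V" "u - h *\<^sub>R f = z"
proof -
  define P :: "(real^'d \<Rightarrow> complex^'m) \<Rightarrow> ('d, 'm) L2 \<times> (('d, 'm) L2 ^ 'd)"
    where "P \<psi> = (abs_L2 \<psi>, \<chi> k. abs_L2 (partial_deriv k \<psi>))" for \<psi>
  define S :: "(real^'d \<Rightarrow> complex^'m) \<Rightarrow> ('d, 'm) L2 \<times> (('d, 'm) L2 ^ 'd)"
    where "S \<psi> = (abs_L2 \<psi> + h *\<^sub>R abs_L2 (V_adj V \<psi>),
      \<chi> k. h *\<^sub>R abs_L2 (Q_grad Q (\<lambda>j. partial_deriv j \<psi>) k))" for \<psi>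
  define R where "R = {(P \<psi>, S \<psi>) | \<psi>. test_fun \<psi>}"
  define M where "M = {m. \<forall>\<psi>. test_fun \<psi> \<longrightarrow> P \<psi> \<bullet> m = 0}"
  have sq: "square_integrable \<psi>" "square_integrable (partial_deriv k \<psi>)"
    "square_integrable (Q_grad Q (\<lambda>j. partial_deriv j \<psi>) k)" "square_integrable (V_adj V \<psi>)"
    if t: "test_fun \<psi>" for \<psi> :: "real^'d \<Rightarrow> complex^'m" and k
  proof -
    obtain c where c: "\<And>x. \<psi> x \<noteq> 0 \<Longrightarrow> norm x \<le> c"
      using test_fun_bounded_support[OF t] unfolding bounded_iff by auto
    show "square_integrable \<psi>" "square_integrable (partial_deriv k \<psi>)"
      using t by (auto intro: test_fun_square_integrable test_fun_partial_deriv)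
    show "square_integrable (Q_grad Q (\<lambda>j. partial_deriv j \<psi>) k)"
      by (intro Q_grad_square_integrable[OF Q] test_fun_square_integrable test_fun_partial_deriv t)
    show "square_integrable (V_adj V \<psi>)"
      by (rule V_adj_square_integrable[OF V test_fun_square_integrable[OF t] c])
  qed
  have add: "P (\<lambda>x. \<phi> x + \<psi> x) = P \<phi> + P \<psi>" "S (\<lambda>x. \<phi> x + \<psi> x) = S \<phi> + S \<psi>"
    if t: "test_fun \<phi>" "test_fun \<psi>" for \<phi> \<psi>
  proof -
    have d: "partial_deriv k (\<lambda>x. \<phi> x + \<psi> x) = (\<lambda>x. partial_deriv k \<phi> x + partial_deriv k \<psi> x)" for k
      by (intro ext partial_deriv_add test_fun_differentiable t)
    show "P (\<lambda>x. \<phi> x + \<psi> x) = P \<phi> + P \<psi>"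
      by (simp add: P_def d abs_L2_add sq t vec_eq_iff)
    show "S (\<lambda>x. \<phi> x + \<psi> x) = S \<phi> + S \<psi>"
      unfolding S_def d Q_grad_linear(1)[abs_def] V_adj_linear(1)[abs_def]
      by (simp add: abs_L2_add sq t vec_eq_iff scaleR_add_right)
  qed
  have scale: "P (\<lambda>x. r *\<^sub>R \<psi> x) = r *\<^sub>R P \<psi>" "S (\<lambda>x. r *\<^sub>R \<psi> x) = r *\<^sub>R S \<psi>"
    if t: "test_fun \<psi>" for \<psi> r
  proof -
    have d: "partial_deriv k (\<lambda>x. r *\<^sub>R \<psi> x) = (\<lambda>x. r *\<^sub>R partial_deriv k \<psi> x)" for k
      by (intro ext partial_deriv_linear bounded_linear_scaleR_right test_fun_differentiable t)
    show "P (\<lambda>x. r *\<^sub>R \<psi> x) = r *\<^sub>R P \<psi>"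
      by (simp add: P_def d abs_L2_scaleR sq t vec_eq_iff)
    show "S (\<lambda>x. r *\<^sub>R \<psi> x) = r *\<^sub>R S \<psi>"
      unfolding S_def d Q_grad_linear(2)[abs_def] V_adj_linear(2)[abs_def]
      by (simp add: abs_L2_scaleR sq t vec_eq_iff scaleR_add_right mult.commute)
  qed
  have R: "subspace R"
  proof (rule subspaceI)
    have "P (\<lambda>x. 0) = 0" "S (\<lambda>x. 0) = 0"
      using scale[OF test_fun_0, of 0] by simp_all
    then have "(0, 0) = (P (\<lambda>x. 0), S (\<lambda>x. 0))" by simp
    then show "0 \<in> R" unfolding R_def zero_prod_def using test_fun_0 by blast
  next
    fix x y assume "x \<in> R" "y \<in> R"
    then obtain \<phi> \<psi> where *: "x = (P \<phi>, S \<phi>)" "y = (P \<psi>, S \<psi>)" "test_fun \<phi>" "test_fun \<psi>"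
      unfolding R_def by blast
    then have "x + y = (P (\<lambda>x. \<phi> x + \<psi> x), S (\<lambda>x. \<phi> x + \<psi> x))" by (simp add: add)
    then show "x + y \<in> R" unfolding R_def using test_fun_add[OF *(3,4)] by blast
  next
    fix r x assume "x \<in> R"
    then obtain \<psi> where *: "x = (P \<psi>, S \<psi>)" "test_fun \<psi>" unfolding R_def by blast
    then have "r *\<^sub>R x = (P (\<lambda>x. r *\<^sub>R \<psi> x), S (\<lambda>x. r *\<^sub>R \<psi> x))" by (simp add: scale)
    then show "r *\<^sub>R x \<in> R"
      unfolding R_def using test_fun_linear[OF bounded_linear_scaleR_right *(2)] by blast
  qed
  have M: "subspace M"
    by (rule subspaceI) (auto simp: M_def inner_add_right)
  obtain \<eta> where \<eta>: "\<eta> > 0" "\<And>x \<xi>. \<eta> * (norm \<xi>)\<^sup>2 \<le> (Q x *v \<xi>) \<bullet> \<xi>" using Q_elliptic[OF Q] by blast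
  define c where "c = min 1 (h * \<eta>)"
  have c: "c > 0" "c \<le> 1" "c \<le> h * \<eta>" using h \<eta>(1) by (auto simp: c_def)
  have coercive: "c * (norm (P \<psi>))\<^sup>2 \<le> P \<psi> \<bullet> S \<psi>" if t: "test_fun \<psi>" for \<psi>
  proof -
    let ?D = "\<lambda>k. partial_deriv k \<psi>"
    have "\<eta> * (\<Sum>k\<in>UNIV. (norm (abs_L2 (?D k)))\<^sup>2) = (LINT x|lebesgue. \<eta> * (\<Sum>k\<in>UNIV. (norm (?D k x))\<^sup>2))"
      by (simp add: norm_abs_L2 sq t) (subst Bochner_Integration.integral_sum, use sq(2)[OF t] in \<open>auto simp: square_integrable_def\<close>)
    also have "\<dots> \<le> (LINT x|lebesgue. (\<Sum>k\<in>UNIV. ?D k x \<bullet> Q_grad Q ?D k x))"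
    proof (rule integral_mono)
      show "integrable lebesgue (\<lambda>x. \<eta> * (\<Sum>k\<in>UNIV. (norm (?D k x))\<^sup>2))"
        using sq(2)[OF t] by (auto simp: square_integrable_def)
      show "integrable lebesgue (\<lambda>x. \<Sum>k\<in>UNIV. ?D k x \<bullet> Q_grad Q ?D k x)"
        by (intro Bochner_Integration.integrable_sum integrable_inner_square_integrable sq t)
      fix x show "\<eta> * (\<Sum>k\<in>UNIV. (norm (?D k x))\<^sup>2) \<le> (\<Sum>k\<in>UNIV. ?D k x \<bullet> Q_grad Q ?D k x)"
        unfolding Q_grad_def by (rule quadratic_form_lower_bound) (rule \<eta>)
    qed
    also have "\<dots> = (\<Sum>k\<in>UNIV. abs_L2 (?D k) \<bullet> abs_L2 (Q_grad Q ?D k))"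
      by (subst Bochner_Integration.integral_sum)
        (auto intro!: integrable_inner_square_integrable sq t simp: inner_abs_L2 sq t)
    finally have 1: "\<eta> * (\<Sum>k\<in>UNIV. (norm (abs_L2 (?D k)))\<^sup>2) \<le> (\<Sum>k\<in>UNIV. abs_L2 (?D k) \<bullet> abs_L2 (Q_grad Q ?D k))" .
    have 2: "0 \<le> abs_L2 \<psi> \<bullet> abs_L2 (V_adj V \<psi>)"
      unfolding inner_abs_L2[OF sq(1)[OF t] sq(4)[OF t]]
      by (intro Bochner_Integration.integral_nonneg V_adj_accretive[OF V])
    have "c * (norm (P \<psi>))\<^sup>2 = c * (norm (abs_L2 \<psi>))\<^sup>2 + c * (\<Sum>k\<in>UNIV. (norm (abs_L2 (?D k)))\<^sup>2)"
      by (simp add: P_def power2_norm_eq_inner inner_vec_def distrib_left)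
    also have "\<dots> \<le> 1 * (norm (abs_L2 \<psi>))\<^sup>2 + (h * \<eta>) * (\<Sum>k\<in>UNIV. (norm (abs_L2 (?D k)))\<^sup>2)"
      using c by (intro add_mono mult_right_mono sum_nonneg) auto
    also have "\<dots> \<le> (norm (abs_L2 \<psi>))\<^sup>2 + h * (\<Sum>k\<in>UNIV. abs_L2 (?D k) \<bullet> abs_L2 (Q_grad Q ?D k))
        + h * (abs_L2 \<psi> \<bullet> abs_L2 (V_adj V \<psi>))"
      using mult_left_mono[OF 1 less_imp_le[OF h]] mult_nonneg_nonneg[OF less_imp_le[OF h] 2]
      unfolding mult.assoc by linarith
    also have "\<dots> = P \<psi> \<bullet> S \<psi>"
      by (simp add: P_def S_def power2_norm_eq_inner inner_vec_def inner_add_right sum_distrib_left)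
    finally show ?thesis .
  qed
  obtain w where w: "\<And>m. m \<in> M \<Longrightarrow> w \<bullet> m = 0" "\<And>p s. (p, s) \<in> R \<Longrightarrow> w \<bullet> s = (z, 0) \<bullet> p"
  proof (rule lions_solvability[OF R M c(1), of "(z, 0)"])
    show "p \<bullet> m = 0" if "(p, s) \<in> R" "m \<in> M" for p s m
      using that unfolding R_def M_def by blast
    show "c * (norm p)\<^sup>2 \<le> p \<bullet> s" if "(p, s) \<in> R" for p s
      using that coercive unfolding R_def by blast
  qed (use that in blast)
  obtain u G where uG: "w = (u, G)" by (cases w)
  \<comment> \<open>The value forced by $u-hf=z$.\<close>
  define f where "f = (1 / h) *\<^sub>R (u - z)"
  have "has_weak_deriv k u (G $ k)" for k
    unfolding has_weak_deriv_iff
  proof (intro allI impI)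
    fix \<psi> :: "real^'d \<Rightarrow> complex^'m" assume t: "test_fun \<psi>"
    have "(abs_L2 (partial_deriv k \<psi>), axis k (abs_L2 \<psi>)) \<in> M"
      unfolding M_def
    proof (intro CollectI allI impI)
      fix \<phi> :: "real^'d \<Rightarrow> complex^'m" assume "test_fun \<phi>"
      then show "P \<phi> \<bullet> (abs_L2 (partial_deriv k \<psi>), axis k (abs_L2 \<psi>)) = 0"
        using has_weak_deriv_test_fun[of \<phi> k] t unfolding has_weak_deriv_iff
        by (simp add: P_def inner_axis)
    qed
    from w(1)[OF this] show "u \<bullet> abs_L2 (partial_deriv k \<psi>) + G $ k \<bullet> abs_L2 \<psi> = 0"
      by (simp add: uG inner_axis)
  qed
  moreover have "weak_form Q V (($) G) u \<psi> + f \<bullet> abs_L2 \<psi> = 0" if t: "test_fun \<psi>" for \<psi>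
  proof -
    have "(P \<psi>, S \<psi>) \<in> R" using t unfolding R_def by blast
    from w(2)[OF this] have "u \<bullet> abs_L2 \<psi> + h * weak_form Q V (($) G) u \<psi> = z \<bullet> abs_L2 \<psi>"
      by (simp add: uG P_def S_def weak_form_def inner_vec_def inner_add_right sum_distrib_left algebra_simps)
    then show ?thesis using h by (simp add: f_def inner_diff_left field_simps)
  qed
  ultimately have "(u, f) \<in> operator_A Q V" unfolding operator_A_iff[OF Q V] by blast
  moreover have "u - h *\<^sub>R f = z" using h by (simp add: f_def)
  ultimately show thesis by (rule that)
qed

section \<open>Generation\<close>

lemma operator_A_single_valued:
  assumes "(0, f) \<in> operator_A Q V"
  shows "f = 0"
proof -
  obtain G where G: "\<And>k. has_weak_deriv k 0 (G k)"
    and weak: "\<And>\<psi>. test_fun \<psi> \<Longrightarrow> weak_form Q V G 0 \<psi> + f \<bullet> abs_L2 \<psi> = 0"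
    using assms operator_A_iff[OF Q V] by blast
  have "has_weak_deriv k (0 :: ('d, 'm) L2) 0" for k by (simp add: has_weak_deriv_iff)
  then have "G k = 0" for k using G has_weak_deriv_unique by blast
  then show ?thesis
    using weak by (intro orthogonal_to_test_funs_imp_0) (simp add: weak_form_def)
qed

lemma m_dissipative_operator_A: "m_dissipative (operator_A Q V)"
proof
  show A: "subspace (operator_A Q V)" by (rule subspace_operator_A)
  show "norm x \<le> norm (x - h *\<^sub>R y)" if xy: "(x, y) \<in> operator_A Q V" and h: "h > 0" for x y and h :: real
  proof -
    have "norm x * norm x \<le> (x - h *\<^sub>R y) \<bullet> x"
      using mult_nonneg_nonpos[OF _ operator_A_dissipative[OF xy], of h] h
      by (simp add: inner_diff_left power2_norm_eq_inner flip: power2_eq_square)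
    also have "\<dots> \<le> norm (x - h *\<^sub>R y) * norm x" by (rule norm_cauchy_schwarz)
    finally show ?thesis by (cases "x = 0") auto
  qed
  show "\<exists>x y. (x, y) \<in> operator_A Q V \<and> x - h *\<^sub>R y = z" if "h > 0" for h :: real and z
    using operator_A_range[OF that] by metis
  show "closure (fst ` operator_A Q V) = UNIV"
  proof (rule dense_if_orthogonal_trivial)
    show "subspace (fst ` operator_A Q V)"
      by (rule linear_subspace_image[OF _ A]) (rule bounded_linear.linear[OF bounded_linear_fst])
    fix v assume orth: "\<And>d. d \<in> fst ` operator_A Q V \<Longrightarrow> v \<bullet> d = 0"
    obtain u f where uf: "(u, f) \<in> operator_A Q V" "u - 1 *\<^sub>R f = v"
      using operator_A_range[of 1 v] by auto
    have "v \<bullet> u = 0" using orth[of u] uf(1) by force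
    moreover have "v \<bullet> u = u \<bullet> u - f \<bullet> u" using uf(2) by (simp add: inner_diff_left flip: uf(2))
    ultimately have "u \<bullet> u \<le> 0" using operator_A_dissipative[OF uf(1)] by simp
    then have "u = 0" by (metis inner_ge_zero order_antisym inner_eq_zero_iff)
    then have "f = 0" using operator_A_single_valued uf(1) by simp
    with \<open>u = 0\<close> show "v = 0" using uf(2) by simp
  qed
qed

text \<open>The factor $c$ moves to the test function as its conjugate.\<close>

lemma operator_A_scaleC:
  assumes "(u, f) \<in> operator_A Q V"
  shows "(c *\<^sub>C u, c *\<^sub>C f) \<in> operator_A Q V"
proof -
  obtain G where G: "\<And>k. has_weak_deriv k u (G k)"
    and weak: "\<And>\<psi>. test_fun \<psi> \<Longrightarrow> weak_form Q V G u \<psi> + f \<bullet> abs_L2 \<psi> = 0"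
    using assms operator_A_iff[OF Q V] by blast
  have "linear (\<lambda>z :: complex^'m. cnj c *s z)"
    by (rule linearI) (simp_all add: vec_eq_iff algebra_simps)
  then have L: "bounded_linear (\<lambda>z :: complex^'m. cnj c *s z)" by (simp add: linear_conv_bounded_linear)
  have t: "test_fun (\<lambda>x. cnj c *s \<psi> x)" if "test_fun \<psi>" for \<psi> :: "real^'d \<Rightarrow> complex^'m"
    by (rule test_fun_linear[OF L that])
  have d: "partial_deriv k (\<lambda>x. cnj c *s \<psi> x) = (\<lambda>x. cnj c *s partial_deriv k \<psi> x)"
    if "test_fun \<psi>" for k and \<psi> :: "real^'d \<Rightarrow> complex^'m"
    by (intro ext partial_deriv_linear[OF L] test_fun_differentiable that)
  have "has_weak_deriv k (c *\<^sub>C u) (c *\<^sub>C G k)" for k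
    unfolding has_weak_deriv_iff
  proof (intro allI impI)
    fix \<psi> :: "real^'d \<Rightarrow> complex^'m" assume \<psi>: "test_fun \<psi>"
    have "u \<bullet> abs_L2 (partial_deriv k (\<lambda>x. cnj c *s \<psi> x)) + G k \<bullet> abs_L2 (\<lambda>x. cnj c *s \<psi> x) = 0"
      using G t[OF \<psi>] unfolding has_weak_deriv_iff by blast
    then show "(c *\<^sub>C u) \<bullet> abs_L2 (partial_deriv k \<psi>) + (c *\<^sub>C G k) \<bullet> abs_L2 \<psi> = 0"
      by (simp add: d[OF \<psi>] inner_scaleC_L2 abs_L2_scaleC test_fun_square_integrable test_fun_partial_deriv \<psi>)
  qed
  moreover have "weak_form Q V (\<lambda>k. c *\<^sub>C G k) (c *\<^sub>C u) \<psi> + (c *\<^sub>C f) \<bullet> abs_L2 \<psi> = 0" if \<psi>: "test_fun \<psi>" for \<psi>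
  proof -
    obtain r where r: "\<And>x. \<psi> x \<noteq> 0 \<Longrightarrow> norm x \<le> r"
      using test_fun_bounded_support[OF \<psi>] unfolding bounded_iff by auto
    have sqQ: "square_integrable (Q_grad Q (\<lambda>j. partial_deriv j \<psi>) k)" for k
      by (intro Q_grad_square_integrable[OF Q] test_fun_square_integrable test_fun_partial_deriv \<psi>)
    have sqV: "square_integrable (V_adj V \<psi>)"
      by (rule V_adj_square_integrable[OF V test_fun_square_integrable[OF \<psi>] r])
    have "Q_grad Q (\<lambda>j x. cnj c *s partial_deriv j \<psi> x) k = (\<lambda>x. cnj c *s Q_grad Q (\<lambda>j. partial_deriv j \<psi>) k x)" for k
      by (rule ext) (simp add: Q_grad_def vec_eq_iff sum_distrib_left scaleR_conv_of_real algebra_simps)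
    then have "weak_form Q V G u (\<lambda>x. cnj c *s \<psi> x) = weak_form Q V (\<lambda>k. c *\<^sub>C G k) (c *\<^sub>C u) \<psi>"
      unfolding weak_form_def d[OF \<psi>] V_adj_linear(3)[abs_def]
      by (simp add: abs_L2_scaleC sqQ sqV inner_scaleC_L2)
    then show ?thesis
      using weak[OF t[OF \<psi>]] by (simp add: inner_scaleC_L2 abs_L2_scaleC test_fun_square_integrable \<psi>)
  qed
  ultimately show ?thesis
    unfolding operator_A_iff[OF Q V] by (intro exI[of _ "\<lambda>k. c *\<^sub>C G k"]) simp
qed

end

theorem corollary3p3:
  fixes Q :: "(real^'d::finite) \<Rightarrow> real^'d^'d"
    and V :: "(real^'d) \<Rightarrow> real^'m^'m::finite"
  assumes "diffusion_matrix Q"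
    and "accretive_potential V"
  shows "\<exists>T :: real \<Rightarrow> ('d, 'm) L2 \<Rightarrow> ('d, 'm) L2.
    contraction_semigroup T \<and> generates (operator_A Q V) T"
proof -
  interpret m_dissipative "operator_A Q V" by (rule m_dissipative_operator_A[OF assms])
  have "bounded_clinear (T t)" if "t \<ge> 0" for t
    unfolding bounded_clinear_def
  proof (intro conjI allI bounded_linear_T that)
    show "T t (c *\<^sub>C x) = c *\<^sub>C T t x" for c x
      by (rule T_commutes[OF bounded_linear_scaleC_L2 _ that]) (rule operator_A_scaleC[OF assms])
  qed
  then have "C0_semigroup T"
    unfolding C0_semigroup_def using T_0 T_add T_strongly_continuous by blast
  then have "contraction_semigroup T"
    unfolding contraction_semigroup_def using norm_T_le by blast
  moreover have "generates (operator_A Q V) T"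
    unfolding generates_def generator_def by (rule generator_T)
  ultimately show ?thesis by blast
qed

end
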